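(* Let $p\in[1,\infty)$, $x_0\in\mathcal{X}$, and $\mathfrak{F}=\{f\in C(\mathcal{X}):|f(x)|\le1+\rho(x_0,x)^p\ \forall x\in\mathcal X\}$, and assume $\mathfrak F$ satisfies Hypothesis $(\mathbf{H_1})$. Then the following are equivalent: (i) $\Phi$ admits a unique invariant probability measure $\mu$ and $\lim_{t\to\infty}W_p(P_t(x,\cdot),\mu)=0$ for all $x\in\mathcal{X}$; (ii) $\Phi$ is eventually continuous with respect to $\mathfrak F$ on $\mathcal X$ and there exists $z\in\mathcal X$ such that $\Phi$ satisfies $(\mathcal C_1)$ at $z$; (iii) there exists $z\in\mathcal X$ such that $\Phi$ is eventually continuous with respect to $\mathfrak F$ at $z$ and satisfies $(\mathcal C_1)$ at $z$.
   Context: Standing setting: $(\mathcal{X},\rho)$ is a Polish space; $\Phi=\{\Phi_t\}_{t\ge0}$ is a càdlàg Feller Markov process on $\mathcal{X}$ (hence strong Markov) with laws $\mathbb{P}^x$ and transition kernels $P_t(x,\cdot)$; $P_tf(x)=\int f\,dP_t(x,\cdot)$ whenever $\int|f|\,dP_t(x,\cdot)<\infty$ for all $x,t$. $B(z,r)$ is the open ball. The $p$-Wasserstein distance is $W_p(\mu,\nu)=\inf_{\pi}\left(\int\rho(x,y)^p\pi(dx,dy)\right)^{1/p}$, the infimum over couplings $\pi$ of $\mu,\nu$. $(\mathcal C_1)$ at $z$: for every $r>0$, $\inf_{x\in\mathcal X}\liminf_{t\to\infty}P_t(x,B(z,r))>0$. $\Phi$ is eventually continuous with respect to $\mathfrak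 F$ at $x$ if for every $f\in\mathfrak F$, $\limsup_{x'\to x}\limsup_{t\to\infty}|P_tf(x')-P_tf(x)|=0$; "on $\mathcal X$" means at every point. Hypothesis $(\mathbf{H_1})$: for every $f\in\mathfrak F$ and $x$, $\{f(\Phi_t)\}_{t\ge0}$ is uniformly integrable under $\mathbb P^x$, i.e. $\lim_{K\to\infty}\sup_t\mathbb E^x(|f(\Phi_t)|\chi_{\{|f(\Phi_t)|\ge K\}})=0$. *)

theory Defs
  imports "HOL-Probability.Probability"
begin

text \<open>The process: laws M x (= P^x) on a common sample space, paths Phi t omega.\<close>

definition kernel :: "('a::polish_space \<Rightarrow> 'w measure) \<Rightarrow> (real \<Rightarrow> 'w \<Rightarrow> 'a) \<Rightarrow> real \<Rightarrow> 'a \<Rightarrow> 'a measure" where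
  "kernel M Phi t x = distr (M x) borel (Phi t)"

definition natural_filtration :: "'w measure \<Rightarrow> (real \<Rightarrow> 'w \<Rightarrow> 'a::polish_space) \<Rightarrow> real \<Rightarrow> 'w measure" where
  "natural_filtration N Phi t =
     sigma (space N) {Phi s -` A \<inter> space N | s A. 0 \<le> s \<and> s \<le> t \<and> A \<in> sets borel}"

definition markov_process :: "('a::polish_space \<Rightarrow> 'w measure) \<Rightarrow> (real \<Rightarrow> 'w \<Rightarrow> 'a) \<Rightarrow> bool" where
  "markov_process M Phi \<longleftrightarrow>
     (\<forall>x. prob_space (M x)) \<and> (\<forall>x y. sets (M x) = sets (M y)) \<and>
     (\<forall>x t. Phi t \<in> measurable (M x) borel) \<and>
     (\<forall>x. AE \<omega> in M x. Phi 0 \<omega> = x) \<and>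
     (\<forall>t A. A \<in> sets borel \<longrightarrow> (\<lambda>x. emeasure (kernel M Phi t x) A) \<in> borel_measurable borel) \<and>
     (\<forall>x s t (f::'a \<Rightarrow> real). 0 \<le> s \<longrightarrow> 0 \<le> t \<longrightarrow> f \<in> borel_measurable borel \<longrightarrow> bounded (range f) \<longrightarrow>
        (AE \<omega> in M x. real_cond_exp (M x) (natural_filtration (M x) Phi t) (\<lambda>\<omega>. f (Phi (t + s) \<omega>)) \<omega>
                       = (\<integral>y. f y \<partial>kernel M Phi s (Phi t \<omega>))))"

definition cadlag_paths :: "('a::polish_space \<Rightarrow> 'w measure) \<Rightarrow> (real \<Rightarrow> 'w \<Rightarrow> 'a) \<Rightarrow> bool" where
  "cadlag_paths M Phi \<longleftrightarrow>
     (\<forall>x. \<forall>\<omega>\<in>space (M x). \<forall>t\<ge>0. continuous (at_right t) (\<lambda>s. Phi s \<omega>) \<and>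
        (0 < t \<longrightarrow> (\<exists>l. ((\<lambda>s. Phi s \<omega>) \<longlongrightarrow> l) (at_left t))))"

definition feller :: "('a::polish_space \<Rightarrow> 'w measure) \<Rightarrow> (real \<Rightarrow> 'w \<Rightarrow> 'a) \<Rightarrow> bool" where
  "feller M Phi \<longleftrightarrow>
     (\<forall>t\<ge>0. \<forall>f::'a \<Rightarrow> real. continuous_on UNIV f \<longrightarrow> bounded (range f) \<longrightarrow>
        continuous_on UNIV (\<lambda>x. \<integral>y. f y \<partial>kernel M Phi t x))"

definition cadlag_feller_markov :: "('a::polish_space \<Rightarrow> 'w measure) \<Rightarrow> (real \<Rightarrow> 'w \<Rightarrow> 'a) \<Rightarrow> bool" where
  "cadlag_feller_markov M Phi \<longleftrightarrow> markov_process M Phi \<and> cadlag_paths M Phi \<and> feller M Phi"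

definition invariant_prob :: "('a::polish_space \<Rightarrow> 'w measure) \<Rightarrow> (real \<Rightarrow> 'w \<Rightarrow> 'a) \<Rightarrow> 'a measure \<Rightarrow> bool" where
  "invariant_prob M Phi \<mu> \<longleftrightarrow> prob_space \<mu> \<and> sets \<mu> = sets borel \<and>
     (\<forall>t\<ge>0. \<forall>A\<in>sets borel. (\<integral>\<^sup>+x. emeasure (kernel M Phi t x) A \<partial>\<mu>) = emeasure \<mu> A)"

definition couplings :: "'a::metric_space measure \<Rightarrow> 'a measure \<Rightarrow> ('a \<times> 'a) measure set" where
  "couplings \<mu> \<nu> = {\<pi>. sets \<pi> = sets (borel \<Otimes>\<^sub>M borel) \<and> distr \<pi> borel fst = \<mu> \<and> distr \<pi> borel snd = \<nu>}"

definition wasserstein :: "real \<Rightarrow> 'a::metric_space measure \<Rightarrow> 'a measure \<Rightarrow> ennreal" where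
  "wasserstein p \<mu> \<nu> =
     (let c = (INF \<pi>\<in>couplings \<mu> \<nu>. \<integral>\<^sup>+z. ennreal (dist (fst z) (snd z) powr p) \<partial>\<pi>)
      in if c = \<infinity> then \<infinity> else ennreal (enn2real c powr (1 / p)))"

definition Ffam :: "real \<Rightarrow> 'a::metric_space \<Rightarrow> ('a \<Rightarrow> real) set" where
  "Ffam p x0 = {f. continuous_on UNIV f \<and> (\<forall>x. \<bar>f x\<bar> \<le> 1 + dist x0 x powr p)}"

definition H1 :: "('a::polish_space \<Rightarrow> 'w measure) \<Rightarrow> (real \<Rightarrow> 'w \<Rightarrow> 'a) \<Rightarrow> ('a \<Rightarrow> real) set \<Rightarrow> bool" where
  "H1 M Phi F \<longleftrightarrow> (\<forall>f\<in>F. \<forall>x.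
     ((\<lambda>K. SUP t\<in>{0..}. \<integral>\<^sup>+\<omega>. ennreal (\<bar>f (Phi t \<omega>)\<bar> * indicator {\<omega>. \<bar>f (Phi t \<omega>)\<bar> \<ge> K} \<omega>) \<partial>M x)
       \<longlongrightarrow> 0) at_top)"

definition eventually_continuous_at :: "('a::polish_space \<Rightarrow> 'w measure) \<Rightarrow> (real \<Rightarrow> 'w \<Rightarrow> 'a) \<Rightarrow> ('a \<Rightarrow> real) set \<Rightarrow> 'a \<Rightarrow> bool" where
  "eventually_continuous_at M Phi F x \<longleftrightarrow> (\<forall>f\<in>F.
     Limsup (at x) (\<lambda>x'. Limsup at_top (\<lambda>t. ereal \<bar>(\<integral>y. f y \<partial>kernel M Phi t x') - (\<integral>y. f y \<partial>kernel M Phi t x)\<bar>)) \<le> 0)"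

definition C1_at :: "('a::polish_space \<Rightarrow> 'w measure) \<Rightarrow> (real \<Rightarrow> 'w \<Rightarrow> 'a) \<Rightarrow> 'a \<Rightarrow> bool" where
  "C1_at M Phi z \<longleftrightarrow> (\<forall>r>0. (INF x. Liminf at_top (\<lambda>t. ereal (measure (kernel M Phi t x) (ball z r)))) > 0)"

end

theory Submission
  imports Defs
begin

text \<open>
  The implication from (iii) to (i) rests on four observations.

  (1) Run two independent copies of the process from x and y until both are near z, which happens
  with probability bounded below. Eventual continuity at z then contracts the asymptotic oscillation
  of P_t f, so P_t f(x) - P_t f(y) tends to 0 for all x, y and all bounded continuous f.

  (2) No mass escapes: if it did, there would be nonnegative continuous functions h_j with bounded
  sum and times q_j tending to infinity with P_{q_j} h_j(z) bounded below. By a gliding hump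
  argument the convergence in (1) is uniform in j; by the Feller property and Baire's theorem it is
  uniform on a ball that the process started at z visits with asymptotic frequency bounded below.
  Hence at one late time many of the h_j would have large integral simultaneously, which
  contradicts the bounded sum.

  (3) A cluster point L of the functionals f \<mapsto> P_t f(z) is invariant by (1) and satisfies
  Daniell's condition by (2), so it is an invariant probability measure, to which every P_t(x,.)
  converges weakly, again by (1).

  (4) Weak convergence and uniform integrability give couplings with small cost, built from a
  continuous partition of unity with supports of small diameter.

  Conversely, couplings with small cost give weak convergence, which yields (ii) after truncation.
\<close>

section \<open>Bounded continuous functions and Daniell's representation theorem\<close>

text \<open>The difficulty is tightness. Coincidence holds for one f and one pair x, y at a time,
  without a rate, and (iii) supplies no compact sets; a cluster point of f \<mapsto> P_t f(z) is at
  first only a finitely additive mean. Countable additivity asks that P_t g_k(z) become small for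
  some k and all late t when g_k decreases to 0, and the humps are differences g_k - g_l along a
  sparse subsequence. Uniformity is gained twice, from different sources. Over j: every subsum of
  the h_j is itself bounded and continuous, so coincidence applies to all subsums, which is what a
  gliding hump needs. Over x: the points at which the estimate holds from time N on form a closed
  set, and Baire's theorem is applied inside the closed set of recurrent points rather than in the
  whole space, because the ball that it yields must be one that the process revisits. All this
  concerns bounded continuous functions, which scaling puts into the family F; uniform integrability
  then carries weak convergence over to the unbounded cost \<rho>^p and to unbounded members of
  F.\<close>

definition bcont :: "('a::topological_space \<Rightarrow> real) \<Rightarrow> bool" where
  "bcont f \<longleftrightarrow> continuous_on UNIV f \<and> bounded (range f)"

lemma bcontI: "continuous_on UNIV f \<Longrightarrow> (\<And>x. \<bar>f x\<bar> \<le> B) \<Longrightarrow> bcont f"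
  by (auto simp: bcont_def bounded_iff)

lemma bcontE:
  assumes "bcont f"
  obtains B where "0 < B" "\<And>x. \<bar>f x\<bar> \<le> B"
proof -
  obtain B where "\<And>x. \<bar>f x\<bar> \<le> B"
    using assms by (auto simp: bcont_def bounded_iff)
  then have "\<bar>f x\<bar> \<le> max B 1" for x
    by (simp add: le_max_iff_disj)
  then show thesis
    by (intro that[of "max B 1"]) auto
qed

lemma bcont_cont: "bcont f \<Longrightarrow> continuous_on UNIV f"
  by (simp add: bcont_def)

lemma bcont_const [simp]: "bcont (\<lambda>x. c)"
  by (rule bcontI[of _ "\<bar>c\<bar>"]) auto

lemma bcont_add:
  assumes "bcont f" "bcont g"
  shows "bcont (\<lambda>x. f x + g x)"
proof -
  obtain B where B: "\<And>x. \<bar>f x\<bar> \<le> B"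
    using bcontE[OF assms(1)] by metis
  obtain C where C: "\<And>x. \<bar>g x\<bar> \<le> C"
    using bcontE[OF assms(2)] by metis
  have "\<bar>f x + g x\<bar> \<le> B + C" for x
    using B[of x] C[of x] by linarith
  then show ?thesis
    using assms by (intro bcontI[of _ "B + C"] continuous_on_add) (auto simp: bcont_def)
qed

lemma bcont_mult:
  assumes "bcont f" "bcont g"
  shows "bcont (\<lambda>x. f x * g x)"
proof -
  obtain B where B: "\<And>x. \<bar>f x\<bar> \<le> B"
    using bcontE[OF assms(1)] by metis
  obtain C where C: "\<And>x. \<bar>g x\<bar> \<le> C"
    using bcontE[OF assms(2)] by metis
  have "\<bar>f x * g x\<bar> \<le> B * C" for x
    using B[of x] C[of x] by (simp add: abs_mult mult_mono')
  then show ?thesis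
    using assms by (intro bcontI[of _ "B * C"] continuous_on_mult) (auto simp: bcont_def)
qed

lemma bcont_cmult: "bcont f \<Longrightarrow> bcont (\<lambda>x. c * f x)"
  by (rule bcont_mult) auto

lemma bcont_diff: "bcont f \<Longrightarrow> bcont g \<Longrightarrow> bcont (\<lambda>x. f x - g x)"
  using bcont_add[of f "\<lambda>x. -1 * g x"] bcont_cmult[of g "-1"] by simp

lemma bcont_max:
  assumes "bcont f" "bcont g"
  shows "bcont (\<lambda>x. max (f x) (g x))"
proof -
  obtain B where B: "\<And>x. \<bar>f x\<bar> \<le> B"
    using bcontE[OF assms(1)] by metis
  obtain C where C: "\<And>x. \<bar>g x\<bar> \<le> C"
    using bcontE[OF assms(2)] by metis
  have "\<bar>max (f x) (g x)\<bar> \<le> max B C" for x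
    using B[of x] C[of x] by linarith
  then show ?thesis
    using assms by (intro bcontI[of _ "max B C"] continuous_on_max) (auto simp: bcont_def)
qed

lemma bcont_min:
  assumes "bcont f" "bcont g"
  shows "bcont (\<lambda>x. min (f x) (g x))"
proof -
  obtain B where B: "\<And>x. \<bar>f x\<bar> \<le> B"
    using bcontE[OF assms(1)] by metis
  obtain C where C: "\<And>x. \<bar>g x\<bar> \<le> C"
    using bcontE[OF assms(2)] by metis
  have "\<bar>min (f x) (g x)\<bar> \<le> max B C" for x
    using B[of x] C[of x] by linarith
  then show ?thesis
    using assms by (intro bcontI[of _ "max B C"] continuous_on_min) (auto simp: bcont_def)
qed

lemma bcont_sum: "(\<And>i. i \<in> I \<Longrightarrow> bcont (f i)) \<Longrightarrow> bcont (\<lambda>x. \<Sum>i\<in>I. f i x)"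
  by (induction I rule: infinite_finite_induct) (auto intro: bcont_add)

lemma bcont_measurable:
  "sets M = sets borel \<Longrightarrow> bcont f \<Longrightarrow> f \<in> borel_measurable M"
  using borel_measurable_continuous_onI[of f] measurable_cong_sets[of M borel borel borel]
  by (auto simp: bcont_def)

lemma integrable_bcont:
  assumes "finite_measure M" "sets M = sets borel" "bcont f"
  shows "integrable M f"
proof -
  obtain B where "\<And>x. \<bar>f x\<bar> \<le> B"
    using bcontE[OF assms(3)] by metis
  then show ?thesis
    using assms by (intro finite_measure.integrable_const_bound[where B = B]) (auto intro!: bcont_measurable)
qed

lemma open_eq_bcont_pos:
  fixes U :: "'a::metric_space set"
  assumes "open U"
  obtains f :: "'a \<Rightarrow> real" where "bcont f" "\<And>x. 0 \<le> f x" "\<And>x. f x \<le> 1" "U = {x. 0 < f x}"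
\<comment> \<open>\<open>infdist\<close> to the empty set is 0, so the distance to the complement
  describes U only when the complement is nonempty.\<close>
proof (cases "U = UNIV")
  case True
  then show ?thesis by (intro that[of "\<lambda>_. 1"]) auto
next
  case False
  have "x \<in> U \<longleftrightarrow> 0 < infdist x (- U)" for x
    using in_closed_iff_infdist_zero[of "- U" x] assms False infdist_nonneg[of x "- U"]
    by (auto simp: closed_Compl less_le)
  then show ?thesis
    by (intro that[of "\<lambda>x. min 1 (infdist x (- U))"])
      (auto intro!: bcontI[of _ 1] continuous_intros simp: infdist_nonneg abs_if)
qed

text \<open>Slicing by height: the i-th summand is the part of y between the levels i and i + 1.
  Daniell's theorem is checked on such slices.\<close>

lemma sum_clamp: 
  fixes y :: real
  assumes "0 \<le> y"
  shows "(\<Sum>i<N. max 0 (min 1 (y - real i))) = min y (real N)"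
  using assms by (induction N) (auto simp: min_def max_def)

text \<open>Counts the slices that y reaches. The bound by N strengthens the claim so that the
  induction closes; y + 1 alone would not absorb the next summand.\<close>

lemma sum_of_bool_less_le:
  fixes y :: real
  assumes "0 \<le> y"
  shows "(\<Sum>i<N. indicator {i. real i < y} i) \<le> min (real N) (y + 1)"
proof (induction N)
  case (Suc N)
  then show ?case
    using assms by (cases "real N < y") (simp_all add: min_def split: if_splits)
qed (use assms in auto)

text \<open>Kindler's argument: the sets between the graphs of two bounded continuous functions
  form a semiring on which the integral of the height is a countably additive content.\<close>

theorem daniell_representation:
  fixes L :: "('a::metric_space \<Rightarrow> real) \<Rightarrow> real"
  assumes add: "\<And>f g. bcont f \<Longrightarrow> bcont g \<Longrightarrow> L (\<lambda>x. f x + g x) = L f + L g"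
    and scale: "\<And>c f. bcont f \<Longrightarrow> L (\<lambda>x. c * f x) = c * L f"
    and pos: "\<And>f. bcont f \<Longrightarrow> (\<And>x. 0 \<le> f x) \<Longrightarrow> 0 \<le> L f"
    and one: "L (\<lambda>x. 1) = 1"
    and cont: "\<And>g::nat \<Rightarrow> 'a \<Rightarrow> real. (\<And>k. bcont (g k)) \<Longrightarrow> (\<And>k x. 0 \<le> g k x) \<Longrightarrow>
       (\<And>k x. g (Suc k) x \<le> g k x) \<Longrightarrow> (\<And>x. (\<lambda>k. g k x) \<longlonglongrightarrow> 0) \<Longrightarrow> (\<lambda>k. L (g k)) \<longlonglongrightarrow> 0"
  obtains \<mu> where "prob_space \<mu>" "sets \<mu> = sets borel" "\<And>f. bcont f \<Longrightarrow> (\<integral>x. f x \<partial>\<mu>) = L f"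
proof -
  have diff: "L (\<lambda>x. f x - g x) = L f - L g" if "bcont f" "bcont g" for f g
    using add[OF that(1) bcont_cmult[OF that(2), of "-1"]] scale[OF that(2), of "-1"] by simp
  have L0: "L (\<lambda>x. 0) = 0"
    using scale[of "\<lambda>x. 1" 0] by simp
  have sum: "L (\<lambda>x. \<Sum>i\<in>J. f i x) = (\<Sum>i\<in>J. L (f i))" if "finite J" "\<And>i. i \<in> J \<Longrightarrow> bcont (f i)" for J :: "nat set" and f
    using that by (induction J rule: finite_induct) (auto simp: L0 add bcont_sum)
  \<comment> \<open>A pair (g, f) stands for the region between two graphs in the product with the
    real line, and \<open>m\<close> is its content. Half-open sections make regions stacked on one
    another disjoint.\<close>
  define I where "I = {(g, f). bcont g \<and> bcont f \<and> (\<forall>x::'a. g x \<le> f x)}"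
  define G where "G = (\<lambda>(g, f). {(x::'a, t::real). g x \<le> t \<and> t < f x})"
  define m where "m = (\<lambda>(g, f). ennreal (L (\<lambda>x. f x - g x)))"
  define N where "N = extend_measure UNIV I G m"
  \<comment> \<open>Additivity is first checked over each point: the sections are half-open
    intervals that partition [g x, f x), and Lebesgue measure is countably additive.\<close>
  have pointwise: "(\<Sum>n. ennreal (snd (A n) x - fst (A n) x)) = ennreal (f x - g x)"
    if "A \<in> UNIV \<rightarrow> I" "disjoint_family (G \<circ> A)" "(\<Union>i. G (A i)) = G (g, f)" "(g, f) \<in> I"
    for A :: "nat \<Rightarrow> _" and g f x
  proof -
    have le: "fst (A n) x \<le> snd (A n) x" for n
      using that(1) by (auto simp: I_def Pi_iff split: prod.splits)
    have le': "g x \<le> f x"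
      using that(4) by (auto simp: I_def)
    have sec: "{fst (A n) x ..< snd (A n) x} = Pair x -` G (A n)" for n
      by (auto simp: G_def split: prod.splits)
    have "(\<Sum>n. emeasure lborel {fst (A n) x ..< snd (A n) x}) = emeasure lborel (\<Union>n. {fst (A n) x ..< snd (A n) x})"
    proof (rule suminf_emeasure)
      show "disjoint_family (\<lambda>n. {fst (A n) x ..< snd (A n) x})"
        using that(2) unfolding sec disjoint_family_on_def by fastforce
    qed auto
    also have "(\<Union>n. {fst (A n) x ..< snd (A n) x}) = {g x ..< f x}"
      unfolding sec vimage_UN[symmetric] that(3) by (auto simp: G_def)
    finally show ?thesis
      using le le' by simp
  qed
  have G_emeasure: "emeasure N (G i) = m i" if "i \<in> I" for i
    using N_def that
  proof (rule extend_measure_caratheodory)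
    show "semiring_of_sets UNIV (G ` I)"
    proof
      show "{} \<in> G ` I"
        by (rule image_eqI[of _ _ "(\<lambda>_. 0, \<lambda>_. 0)"]) (auto simp: G_def I_def)
    next
      fix a b assume "a \<in> G ` I" "b \<in> G ` I"
      then obtain g f g' f' where a: "a = G (g, f)" "(g, f) \<in> I" and b: "b = G (g', f')" "(g', f') \<in> I"
        by auto
      have "a \<inter> b = G (\<lambda>x. max (g x) (g' x), \<lambda>x. max (min (f x) (f' x)) (max (g x) (g' x)))"
        unfolding a b G_def by auto
      then show "a \<inter> b \<in> G ` I"
        using a b by (auto simp: I_def intro!: bcont_max bcont_min)
      \<comment> \<open>The part of a below g' and the part above f'. The maxima and minima keep the
        lower graph under the upper one where such a part is empty.\<close>
      let ?c = "G (g, \<lambda>x. max (g x) (min (f x) (g' x)))"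
      let ?d = "G (\<lambda>x. min (f x) (max (g x) (f' x)), f)"
      have "a - b = ?c \<union> ?d" "?c \<inter> ?d = {}"
        using a(2) b(2) unfolding a b G_def I_def by (auto simp: max_def min_def) (smt (verit))+
      moreover have "?c \<in> G ` I" "?d \<in> G ` I"
        using a b by (auto simp: I_def intro!: bcont_max bcont_min imageI)
      ultimately show "\<exists>C\<subseteq>G ` I. finite C \<and> disjoint C \<and> a - b = \<Union> C"
        by (intro exI[of _ "{?c, ?d}"]) (auto simp: disjoint_def)
    qed simp
  next
    fix i assume "i \<in> I" "G i = {}"
    then obtain g f where i: "i = (g, f)" "(g, f) \<in> I" "G (g, f) = {}"
      by (cases i) auto
    have "f x = g x" for x
    proof (rule ccontr)
      assume "f x \<noteq> g x"
      moreover have "g x \<le> f x"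
        using i(2) by (simp add: I_def)
      ultimately have "(x, g x) \<in> G (g, f)"
        by (simp add: G_def)
      then show False using i by simp
    qed
    then have "(\<lambda>x. f x - g x) = (\<lambda>x. 0)"
      by auto
    then show "m i = 0"
      by (simp add: i(1) m_def L0)
  next
    fix i j assume "i \<in> I" "j \<in> I" and eq: "G i = G j"
    then obtain g f g' f' where ij: "i = (g, f)" "j = (g', f')" "(g, f) \<in> I" "(g', f') \<in> I"
      by (cases i; cases j) auto
    have "f x - g x = f' x - g' x" for x
    proof -
      have "{g x..<f x} = Pair x -` G i" "{g' x..<f' x} = Pair x -` G j"
        by (auto simp: G_def ij(1,2))
      then have "emeasure lborel {g x..<f x} = emeasure lborel {g' x..<f' x}"
        using eq by simp
      moreover have "g x \<le> f x" "g' x \<le> f' x"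
        using ij(3,4) by (auto simp: I_def)
      ultimately show ?thesis
        by simp
    qed
    then show "m i = m j"
      by (simp add: ij(1,2) m_def)
  next
    fix A :: "nat \<Rightarrow> _" and j
    assume A: "A \<in> UNIV \<rightarrow> I" "j \<in> I" "disjoint_family (G \<circ> A)" "(\<Union>i. G (A i)) = G j"
    obtain g f where j: "j = (g, f)"
      by (cases j)
    define h where "h n x = snd (A n) x - fst (A n) x" for n x
    have hb: "bcont (h n)" "0 \<le> h n x" for n x
      using A(1) unfolding h_def[abs_def] I_def Pi_iff by (auto simp: case_prod_beta intro!: bcont_diff)
    have fg: "bcont f" "bcont g" "bcont (\<lambda>x. f x - g x)" "\<And>x. 0 \<le> f x - g x"
      using A(2) by (auto simp: j I_def intro!: bcont_diff)
    have sums: "(\<lambda>n. h n x) sums (f x - g x)" for x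
    proof -
      have "(\<Sum>n. ennreal (h n x)) = ennreal (f x - g x)"
        using pointwise[OF A(1,3), of g f x] A(2,4) by (simp add: j h_def)
      moreover have "(\<lambda>n. ennreal (h n x)) sums (\<Sum>n. ennreal (h n x))"
        by (intro summable_sums) auto
      ultimately show ?thesis
        using hb fg(4) by simp
    qed
    \<comment> \<open>The remainders of the series decrease pointwise to 0, so Daniell's condition
      \<open>cont\<close> turns the pointwise identity into one for L.\<close>
    define d where "d k x = (f x - g x) - (\<Sum>n<k. h n x)" for k x
    have "(\<lambda>k. L (d k)) \<longlonglongrightarrow> 0"
    proof (rule cont)
      show "bcont (d k)" for k
        unfolding d_def[abs_def] by (intro bcont_diff bcont_sum fg hb)
      show "0 \<le> d k x" for k x
        using sum_le_suminf[OF sums_summable[OF sums], of "{..<k}" x] hb sums_unique[OF sums, of x]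
        by (simp add: d_def)
      show "d (Suc k) x \<le> d k x" for k x
        using hb by (simp add: d_def)
      have "(\<lambda>k. (f x - g x) - (\<Sum>n<k. h n x)) \<longlonglongrightarrow> (f x - g x) - (f x - g x)" for x
        using sums[of x] unfolding sums_def by (intro tendsto_intros)
      then show "(\<lambda>k. d k x) \<longlonglongrightarrow> 0" for x
        by (simp add: d_def)
    qed
    moreover have "L (d k) = L (\<lambda>x. f x - g x) - (\<Sum>n<k. L (h n))" for k
      unfolding d_def[abs_def] using fg hb by (subst diff) (auto simp: sum intro!: bcont_sum)
    ultimately have "(\<lambda>k. L (\<lambda>x. f x - g x) - (\<Sum>n<k. L (h n))) \<longlonglongrightarrow> 0"
      by simp
    then have "(\<lambda>k. L (\<lambda>x. f x - g x) - (L (\<lambda>x. f x - g x) - (\<Sum>n<k. L (h n)))) \<longlonglongrightarrow> L (\<lambda>x. f x - g x) - 0"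
      by (intro tendsto_intros)
    then have "(\<lambda>n. L (h n)) sums L (\<lambda>x. f x - g x)"
      by (simp add: sums_def)
    then have "(\<lambda>n. ennreal (L (h n))) sums ennreal (L (\<lambda>x. f x - g x))"
      using hb fg by (subst sums_ennreal) (auto intro!: pos)
    moreover have "m (A n) = ennreal (L (h n))" for n
      by (simp add: m_def h_def[abs_def] split: prod.splits)
    ultimately show "(\<Sum>n. m (A n)) = m j"
      by (simp add: sums_iff m_def j)
  qed simp
  have setsN: "sets N = sigma_sets UNIV (G ` I)"
    unfolding N_def by (rule sets_extend_measure) auto
  have spN: "space N = UNIV"
    unfolding N_def by (rule space_extend_measure) auto
  have GN: "G i \<in> sets N" if "i \<in> I" for i
    using that unfolding setsN by auto
  have cyl: "U \<times> UNIV \<in> sets N" if "open U" for U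
  proof -
    obtain f :: "'a \<Rightarrow> real" where f: "bcont f" "\<And>x. 0 \<le> f x" "U = {x. 0 < f x}"
      using open_eq_bcont_pos[OF \<open>open U\<close>] by metis
    \<comment> \<open>Over points with f x = 0 the region from -n to \<open>h n\<close> is empty.
      Where f x > 0 the minimum equals 1 for large n, and the top -n + n^2 then passes every
      height.\<close>
    define h where "h n x = - real n + real n * real n * min 1 (real n * f x)" for n x
    have hI: "(\<lambda>_. - real n, h n) \<in> I" for n
      using f by (auto simp: I_def h_def[abs_def] intro!: bcont_diff bcont_cmult bcont_min)
    have "U \<times> UNIV = (\<Union>n. G (\<lambda>_. - real n, h n))"
    proof (intro equalityI subsetI)
      fix p assume "p \<in> U \<times> (UNIV::real set)"
      then obtain x t where p: "p = (x, t)" "0 < f x" by (auto simp: f)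
      obtain n where n: "max (\<bar>t\<bar> + 2) (1 / f x) \<le> real n"
        using real_arch_simple by blast
      then have "1 \<le> real n * f x"
        using p(2) by (simp add: divide_le_eq)
      moreover have "t < - real n + real n * real n"
      proof -
        have "real n * 2 \<le> real n * real n"
          using n by (intro mult_left_mono) auto
        then show ?thesis using n by linarith
      qed
      moreover have "- real n \<le> t"
        using n by auto
      ultimately show "p \<in> (\<Union>n. G (\<lambda>_. - real n, h n))"
        by (auto simp: p G_def h_def min_def)
    next
      fix p assume "p \<in> (\<Union>n. G (\<lambda>_. - real n, h n))"
      then obtain n where n: "p \<in> G (\<lambda>_. - real n, h n)"
        by auto
      obtain x t where p': "p = (x, t)"
        by (cases p)
      have p: "p = (x, t)" "- real n < h n x"
        using n unfolding p' G_def by auto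
      then have "f x \<noteq> 0"
        by (auto simp: h_def)
      then show "p \<in> U \<times> UNIV"
        using f(2)[of x] by (auto simp: p f less_le)
    qed
    then show ?thesis
      using GN[OF hI] by auto
  qed
  have [measurable]: "fst \<in> measurable N borel"
    using cyl by (intro borel_measurableI) (auto simp: spN fst_vimage_eq_Times)
  \<comment> \<open>The region under the constant 1 has content L 1 = 1; its projection to the base
    is a probability measure.\<close>
  define E where "E = G (\<lambda>_. 0, \<lambda>_. 1)"
  have EI: "(\<lambda>_. 0, \<lambda>_. 1) \<in> I"
    by (auto simp: I_def)
  have E[measurable]: "E \<in> sets N"
    unfolding E_def by (intro GN EI)
  define \<mu> where "\<mu> = distr (density N (indicator E)) borel fst"
  have sets_\<mu>: "sets \<mu> = sets borel"
    by (simp add: \<mu>_def)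
  have em: "emeasure \<mu> B = emeasure N (E \<inter> (B \<times> UNIV))" if [measurable]: "B \<in> sets borel" for B
  proof -
    have [measurable]: "B \<times> UNIV \<in> sets N"
      using measurable_sets[of fst N borel B] by (simp add: spN fst_vimage_eq_Times)
    have "emeasure \<mu> B = emeasure (density N (indicator E)) (B \<times> UNIV)"
      by (simp add: \<mu>_def emeasure_distr spN fst_vimage_eq_Times)
    also have "\<dots> = emeasure N (E \<inter> (B \<times> UNIV))"
      by (simp add: emeasure_density indicator_inter_arith[symmetric])
    finally show ?thesis .
  qed
  have prob: "prob_space \<mu>"
  proof
    have "emeasure \<mu> UNIV = m (\<lambda>_. 0, \<lambda>_. 1)"
      using em[of UNIV] G_emeasure[OF EI] by (simp add: E_def)
    then show "emeasure \<mu> (space \<mu>) = 1"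
      by (simp add: \<mu>_def m_def one)
  qed
  interpret prob_space \<mu> by (rule prob)
  have fin: "finite_measure \<mu>"
    by (rule finite_measure_axioms)
  \<comment> \<open>A crude bound: the region under u lies in the part of \<open>E\<close> over {u >
    0}. Applied to thin slices it becomes sharp.\<close>
  have L_le: "L u \<le> measure \<mu> {x. 0 < u x}" if u: "bcont u" "\<And>x. 0 \<le> u x" "\<And>x. u x \<le> 1" for u
  proof -
    have uI: "(\<lambda>_. 0, u) \<in> I"
      using u by (auto simp: I_def)
    have meas: "{x. 0 < u x} \<in> sets borel"
      using bcont_measurable[OF refl u(1)] by measurable
    have "ennreal (L u) = emeasure N (G (\<lambda>_. 0, u))"
      using G_emeasure[OF uI] by (simp add: m_def)
    also have "\<dots> \<le> emeasure N (E \<inter> ({x. 0 < u x} \<times> UNIV))"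
    proof (rule emeasure_mono)
      show "G (\<lambda>_. 0, u) \<subseteq> E \<inter> ({x. 0 < u x} \<times> UNIV)"
        using u(3) by (auto simp: G_def E_def intro: less_le_trans le_less_trans)
      show "E \<inter> ({x. 0 < u x} \<times> UNIV) \<in> sets N"
        using measurable_sets[of fst N borel, OF _ meas] E
        by (auto simp: spN fst_vimage_eq_Times[symmetric] simp del: vimage_Collect_eq)
    qed
    also have "\<dots> = ennreal (measure \<mu> {x. 0 < u x})"
      using em[OF meas] by (simp add: emeasure_eq_measure)
    finally show ?thesis
      by (simp add: ennreal_le_iff)
  qed
  have step: "L f \<le> (\<integral>x. f x \<partial>\<mu>)" if f: "bcont f" "\<And>x. 0 \<le> f x" "\<And>x. f x \<le> 1" for f
  proof (rule field_le_epsilon)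
    fix e :: real assume "0 < e"
    then obtain n where n: "inverse (real (Suc n)) < e"
      using reals_Archimedean by blast
    \<comment> \<open>k * f is cut into k slices of height 1. Replacing each slice by the indicator
      of the set it reaches adds at most 1 in total, hence at most 1 / k after division.\<close>
    define k where "k = Suc n"
    have k: "0 < k" "1 / real k < e"
      using n by (auto simp: k_def inverse_eq_divide)
    define u where "u i x = max 0 (min 1 (real k * f x - real i))" for i x
    have u: "bcont (u i)" "0 \<le> u i x" "u i x \<le> 1" for i x
      unfolding u_def[abs_def] by (auto intro!: bcont_max bcont_min bcont_diff bcont_cmult f)
    have "(\<lambda>x. real k * f x) = (\<lambda>x. \<Sum>i<k. u i x)"
    proof
      fix x
      have "real k * f x \<le> real k * 1"
        using f(3)[of x] by (intro mult_left_mono) auto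
      then show "real k * f x = (\<Sum>i<k. u i x)"
        using f(2)[of x] by (simp add: u_def sum_clamp)
    qed
    then have "real k * L f = (\<Sum>i<k. L (u i))"
      using scale[OF f(1), of "real k"] sum[of "{..<k}" u] u by simp
    also have "\<dots> \<le> (\<Sum>i<k. measure \<mu> {x. 0 < u i x})"
      by (intro sum_mono L_le u)
    also have "\<dots> = (\<integral>x. (\<Sum>i<k. indicator {x. 0 < u i x} x) \<partial>\<mu>)"
      using bcont_measurable[OF refl u(1)]
      by (subst Bochner_Integration.integral_sum) (auto intro!: integrable_real_indicator simp: sets_\<mu> emeasure_eq_measure)
    also have "\<dots> \<le> (\<integral>x. real k * f x + 1 \<partial>\<mu>)"
    proof (rule integral_mono)
      show "integrable \<mu> (\<lambda>x. \<Sum>i<k. indicator {x. 0 < u i x} x :: real)"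
        using bcont_measurable[OF refl u(1)]
        by (intro Bochner_Integration.integrable_sum integrable_real_indicator) (auto simp: sets_\<mu> emeasure_eq_measure)
      show "integrable \<mu> (\<lambda>x. real k * f x + 1)"
        by (intro integrable_bcont fin sets_\<mu> bcont_add bcont_cmult f) auto
      fix x
      have "(\<Sum>i<k. indicator {x. 0 < u i x} x :: real) = (\<Sum>i<k. indicator {i. real i < real k * f x} i)"
        by (intro sum.cong) (auto simp: u_def indicator_def)
      also have "\<dots> \<le> real k * f x + 1"
        using sum_of_bool_less_le[of "real k * f x" k] f by simp
      finally show "(\<Sum>i<k. indicator {x. 0 < u i x} x) \<le> real k * f x + 1" .
    qed
    also have "\<dots> = real k * (\<integral>x. f x \<partial>\<mu>) + 1"
      using integrable_bcont[OF fin sets_\<mu> f(1)] by (simp add: prob_space)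
    finally have "L f \<le> (\<integral>x. f x \<partial>\<mu>) + 1 / real k"
      using k by (simp add: field_simps)
    then show "L f \<le> (\<integral>x. f x \<partial>\<mu>) + e"
      using k by simp
  qed
  have le: "L f \<le> (\<integral>x. f x \<partial>\<mu>)" if f: "bcont f" for f
  proof -
    obtain B where B: "0 < B" "\<And>x. \<bar>f x\<bar> \<le> B"
      using bcontE[OF f] by metis
    let ?g = "\<lambda>x. (1 / (2 * B)) * f x + 1 / 2"
    have g: "bcont ?g"
      by (intro bcont_add bcont_cmult f bcont_const)
    have "L ?g \<le> (\<integral>x. ?g x \<partial>\<mu>)"
    proof (rule step[OF g])
      show "0 \<le> ?g x" "?g x \<le> 1" for x
        using B(1) B(2)[of x] by (auto simp: field_simps abs_le_iff)
    qed
    moreover have "L ?g = (1 / (2 * B)) * L f + 1 / 2"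
      using add[OF bcont_cmult[OF f, of "1 / (2 * B)"] bcont_const[of "1 / 2"]]
        scale[OF f, of "1 / (2 * B)"] scale[of "\<lambda>_. 1" "1 / 2"] one by simp
    moreover have "(\<integral>x. ?g x \<partial>\<mu>) = (1 / (2 * B)) * (\<integral>x. f x \<partial>\<mu>) + 1 / 2"
      using integrable_bcont[OF fin sets_\<mu> f] by (simp add: prob_space)
    ultimately show ?thesis
      using B by (simp add: field_simps)
  qed
  \<comment> \<open>The inequality for -f is the reverse inequality for f.\<close>
  have "(\<integral>x. f x \<partial>\<mu>) = L f" if f: "bcont f" for f
    using le[OF f] le[OF bcont_cmult[OF f, of "-1"]] scale[OF f, of "-1"] by simp
  then show thesis
    using that prob sets_\<mu> by blast
qed

section \<open>Couplings and gliding humps\<close>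

text \<open>The ramps converge pointwise to the indicator of {f > 0}. Since every open set has this
  form, integrals of bounded continuous functions determine the measure of open sets.\<close>

lemma integral_ramp_tendsto:
  assumes "prob_space M" and M: "sets M = sets borel" and f: "bcont f" "\<And>x. 0 \<le> f x"
  shows "(\<lambda>n. \<integral>x. min 1 (real n * f x) \<partial>M) \<longlonglongrightarrow> measure M {x. 0 < f x}"
proof -
  interpret prob_space M by fact
  have [measurable]: "f \<in> borel_measurable M"
    by (intro bcont_measurable M f)
  have sp: "space M = UNIV"
    using sets_eq_imp_space_eq[OF M] by simp
  have [measurable]: "{x. 0 < f x} \<in> sets M"
    using borel_measurable_less[of "\<lambda>_. 0" M f] by (simp add: sp)
  have "(\<lambda>n. \<integral>x. min 1 (real n * f x) \<partial>M) \<longlonglongrightarrow> (\<integral>x. indicator {x. 0 < f x} x \<partial>M)"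
  proof (rule integral_dominated_convergence[where w = "\<lambda>_. 1"])
    show "AE x in M. (\<lambda>n. min 1 (real n * f x)) \<longlonglongrightarrow> indicator {x. 0 < f x} x"
    proof (intro AE_I2)
      fix x
      show "(\<lambda>n. min 1 (real n * f x)) \<longlonglongrightarrow> indicator {x. 0 < f x} x"
      proof (cases "0 < f x")
        case True
        obtain N where N: "1 / f x \<le> real N"
          using real_arch_simple by blast
        have "eventually (\<lambda>n. min 1 (real n * f x) = 1) sequentially"
          using eventually_ge_at_top[of N]
        proof eventually_elim
          case (elim n)
          then have "1 / f x \<le> real n"
            using N by linarith
          then show ?case
            using True by (simp add: divide_le_eq min_def)
        qed
        then show ?thesis
          using True by (simp add: tendsto_eventually)
      next
        case False
        then have "f x = 0" using f(2)[of x] by simp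
        then show ?thesis by simp
      qed
    qed
    show "AE x in M. norm (min 1 (real n * f x)) \<le> 1" for n
      using f(2) by (auto simp: min_def)
  qed auto
  then show ?thesis
    by (simp add: emeasure_eq_measure)
qed

lemma measure_eqI_bcont:
  fixes M N :: "'a::metric_space measure"
  assumes M: "prob_space M" "sets M = sets borel" and N: "prob_space N" "sets N = sets borel"
    and eq: "\<And>f. bcont f \<Longrightarrow> (\<integral>x. f x \<partial>M) = (\<integral>x. f x \<partial>N)"
  shows "M = N"
proof (rule measure_eqI_generator_eq[where E = "{S. open S}" and A = "\<lambda>_. UNIV" and \<Omega> = UNIV])
  show "Int_stable {S::'a set. open S}"
    by (auto simp: Int_stable_def)
  show "sets M = sigma_sets UNIV {S. open S}" "sets N = sigma_sets UNIV {S. open S}"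
    using M N by (auto simp: borel_def)
  fix U :: "'a set" assume "U \<in> {S. open S}"
  then obtain f :: "'a \<Rightarrow> real" where f: "bcont f" "\<And>x. 0 \<le> f x" "U = {x. 0 < f x}"
    using open_eq_bcont_pos[of U] by (metis mem_Collect_eq)
  have "(\<integral>x. min 1 (real n * f x) \<partial>M) = (\<integral>x. min 1 (real n * f x) \<partial>N)" for n
    by (intro eq bcont_min bcont_cmult f bcont_const)
  then have "measure M U = measure N U"
    using integral_ramp_tendsto[OF M f(1,2)] integral_ramp_tendsto[OF N f(1,2)]
    by (auto simp: f(3) intro: LIMSEQ_unique)
  then show "emeasure M U = emeasure N U"
    using M N by (simp add: finite_measure.emeasure_eq_measure prob_space.finite_measure)
next
  show "emeasure M UNIV \<noteq> \<infinity>" for i :: nat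
    using prob_space.finite_measure[OF M(1)] by (simp add: finite_measure.emeasure_eq_measure)
qed auto

section \<open>Strict positivity and supports of measures\<close>

lemma integral_pos_of_measure_pos:
  assumes \<mu>: "prob_space \<mu>" "sets \<mu> = sets borel" and f: "bcont f" "\<And>x. 0 \<le> f x"
    and pos: "0 < measure \<mu> {x. 0 < f x}"
  shows "0 < (\<integral>x. f x \<partial>\<mu>)"
proof -
  interpret prob_space \<mu> by fact
  have "(\<integral>x. f x \<partial>\<mu>) \<noteq> 0"
  proof
    assume "(\<integral>x. f x \<partial>\<mu>) = 0"
    then have "AE x in \<mu>. f x = 0"
      using integral_nonneg_eq_0_iff_AE[OF integrable_bcont[OF finite_measure_axioms \<mu>(2) f(1)]] f(2) by simp
    then have "AE x in \<mu>. x \<notin> {x. 0 < f x}"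
      by eventually_elim simp
    moreover have "{x. 0 < f x} \<in> sets \<mu>"
      using bcont_measurable[OF refl f(1)] \<mu>(2) by simp
    ultimately have "measure \<mu> {x. 0 < f x} = 0"
      using sets_eq_imp_space_eq[OF \<mu>(2)]
      by (subst (asm) AE_iff_measurable[of "{x. 0 < f x}"]) (auto simp: measure_def)
    then show False
      using pos by simp
  qed
  moreover have "0 \<le> (\<integral>x. f x \<partial>\<mu>)"
    using f(2) by simp
  ultimately show ?thesis
    by simp
qed

text \<open>The support has full measure: by the Lindelof property the union of all null balls is
  already the union of countably many of them.\<close>

lemma AE_measure_ball_pos:
  fixes \<mu> :: "'a::polish_space measure"
  assumes "prob_space \<mu>" and \<mu>: "sets \<mu> = sets borel"
  shows "AE u in \<mu>. \<forall>r>0. 0 < measure \<mu> (ball u r)"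
proof -
  interpret prob_space \<mu> by fact
  define F where "F = {ball u r | u r. measure \<mu> (ball u r) = 0}"
  have "\<And>S. S \<in> F \<Longrightarrow> open S"
    by (auto simp: F_def)
  then obtain F' where F': "F' \<subseteq> F" "countable F'" "\<Union>F' = \<Union>F"
    using Lindelof by metis
  have "\<Union>F' \<in> null_sets \<mu>"
  proof (rule null_sets_UN'[of F' "\<lambda>x. x", simplified])
    show "countable F'" by fact
    show "S \<in> null_sets \<mu>" if "S \<in> F'" for S
      using that F'(1) \<mu> by (auto simp: F_def emeasure_eq_measure intro!: null_setsI)
  qed
  moreover have "{u. \<not> (\<forall>r>0. 0 < measure \<mu> (ball u r))} \<subseteq> \<Union>F'"
    unfolding F'(3)
  proof
    fix u assume "u \<in> {u. \<not> (\<forall>r>0. 0 < measure \<mu> (ball u r))}"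
    then obtain r where "0 < r" "measure \<mu> (ball u r) = 0"
      by (auto simp: zero_less_measure_iff)
    then show "u \<in> \<Union>F"
      by (auto simp: F_def intro!: exI[of _ "ball u r"])
  qed
  ultimately show ?thesis
    by (intro AE_I'[of "\<Union>F'"]) auto
qed

text \<open>A form of Schur's lemma. If every row had a large entry, rows could be chosen whose
  large entries move to the right while the mass before and after them is negligible; the subsum
  over exactly these columns would then stay away from 0.\<close>

lemma gliding_hump:
  fixes b :: "nat \<Rightarrow> nat \<Rightarrow> real"
  assumes summ: "\<And>n. summable (\<lambda>j. \<bar>b n j\<bar>)"
    and conv: "\<And>I. (\<lambda>n. \<Sum>j. indicator I j * b n j) \<longlonglongrightarrow> 0"
    and \<eta>: "0 < \<eta>"
  shows "\<exists>n. \<forall>j. \<bar>b n j\<bar> \<le> \<eta>"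
proof (rule ccontr)
  assume "\<not> (\<exists>n. \<forall>j. \<bar>b n j\<bar> \<le> \<eta>)"
  then have bad: "\<exists>j. \<eta> < \<bar>b n j\<bar>" for n
    by (auto simp: not_le)
  have col: "(\<lambda>n. b n j) \<longlonglongrightarrow> 0" for j
  proof -
    have "(\<Sum>i. indicator {j} i * b n i) = b n j" for n
      by (subst suminf_finite[of "{j}"]) auto
    then show ?thesis
      using conv[of "{j}"] by simp
  qed
  have cols: "(\<lambda>n. \<Sum>j<J. \<bar>b n j\<bar>) \<longlonglongrightarrow> 0" for J
    using tendsto_sum[of "{..<J}" "\<lambda>j n. \<bar>b n j\<bar>" "\<lambda>_. 0" sequentially] col
    by (simp add: tendsto_rabs_zero)
  have tail: "\<exists>J>j. (\<Sum>i. \<bar>b n (i + J)\<bar>) < \<eta> / 4" for n j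
  proof -
    obtain N where N: "\<And>J. N \<le> J \<Longrightarrow> norm (\<Sum>i. \<bar>b n (i + J)\<bar>) < \<eta> / 4"
      using suminf_exist_split[OF _ summ, of "\<eta> / 4" n] \<eta> by auto
    have "(\<Sum>i. \<bar>b n (i + max N (Suc j))\<bar>) < \<eta> / 4"
      using N[of "max N (Suc j)"] by simp
    then show ?thesis
      by (intro exI[of _ "max N (Suc j)"]) auto
  qed
  \<comment> \<open>In a triple (n, j, J), row n has a large entry in column j and a small tail from
    J on. \<open>Q\<close> makes the next row small on the columns below J, which forces its large
    entry to lie at J or beyond.\<close>
  define P where "P = (\<lambda>(n, j, J). \<eta> < \<bar>b n j\<bar> \<and> j < J \<and> (\<Sum>i. \<bar>b n (i + J)\<bar>) < \<eta> / 4)"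
  define Q where "Q = (\<lambda>(n, j::nat, J) (n', j', J'::nat). n < n' \<and> J \<le> j' \<and> (\<Sum>j<J. \<bar>b n' j\<bar>) < \<eta> / 4)"
  have "\<exists>s. \<forall>k. P (s k) \<and> Q (s k) (s (Suc k))"
  proof (rule dependent_nat_choice)
    show "\<exists>x. P x"
    proof -
      obtain j where "\<eta> < \<bar>b 0 j\<bar>"
        using bad by blast
      then show ?thesis
        using tail[of j 0] unfolding P_def by blast
    qed
  next
    fix x and k :: nat assume "P x"
    obtain n j J where x: "x = (n, j, J)" by (cases x)
    have "eventually (\<lambda>n'. (\<Sum>j<J. \<bar>b n' j\<bar>) < \<eta> / 4 \<and> n < n') sequentially"
      using order_tendstoD(2)[OF cols, of "\<eta> / 4"] \<eta> by (intro eventually_conj eventually_gt_at_top) auto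
    then obtain n' where n': "(\<Sum>j<J. \<bar>b n' j\<bar>) < \<eta> / 4" "n < n'"
      by (auto simp: eventually_sequentially)
    obtain j' where j': "\<eta> < \<bar>b n' j'\<bar>"
      using bad by blast
    have "J \<le> j'"
    proof (rule ccontr)
      assume "\<not> J \<le> j'"
      then have "\<bar>b n' j'\<bar> \<le> (\<Sum>j<J. \<bar>b n' j\<bar>)"
        by (intro member_le_sum) auto
      then show False using n' j' \<eta> by linarith
    qed
    then show "\<exists>y. P y \<and> Q x y"
      using n' j' tail[of j' n'] by (auto simp: P_def Q_def x)
  qed
  then obtain s where s: "\<And>k. P (s k)" "\<And>k. Q (s k) (s (Suc k))"
    by auto
  define N where "N k = fst (s k)" for k
  define j where "j k = fst (snd (s k))" for k
  define J where "J k = snd (snd (s k))" for k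
  have P: "\<eta> < \<bar>b (N k) (j k)\<bar>" "j k < J k" "(\<Sum>i. \<bar>b (N k) (i + J k)\<bar>) < \<eta> / 4" for k
    using s(1)[of k] by (auto simp: P_def N_def j_def J_def case_prod_beta)
  have Q: "N k < N (Suc k)" "J k \<le> j (Suc k)" "(\<Sum>i<J k. \<bar>b (N (Suc k)) i\<bar>) < \<eta> / 4" for k
    using s(2)[of k] by (auto simp: Q_def N_def j_def J_def case_prod_beta)
  have N_mono: "strict_mono N"
    using Q(1) by (simp add: strict_mono_Suc_iff)
  have J_mono: "mono J"
    using P(2) Q(2) by (intro mono_SucI1 monoI) (metis le_trans less_imp_le lift_Suc_mono_le)
  have j_J: "J k \<le> j i" if "k < i" for k i
  proof -
    obtain i' where i: "i = Suc i'" "k \<le> i'"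
      using \<open>k < i\<close> by (cases i) auto
    show ?thesis
      using monoD[OF J_mono i(2)] Q(2)[of i'] i by simp
  qed
  define I where "I = range j"
  \<comment> \<open>In a chosen row the selected columns consist of a head of mass below \<eta>/4,
    the single large entry above \<eta>, and a tail below \<eta>/4; no other selected column falls
    between head and tail.\<close>
  have big: "\<eta> / 2 \<le> \<bar>\<Sum>i. indicator I i * b (N (Suc k)) i\<bar>" for k
  proof -
    let ?b = "b (N (Suc k))"
    let ?c = "\<lambda>i. indicator I i * ?b i"
    have c_le: "\<bar>?c i\<bar> \<le> \<bar>?b i\<bar>" for i
      by (auto simp: indicator_def)
    have c_summ: "summable (\<lambda>i. \<bar>?c i\<bar>)"
      by (rule summable_comparison_test'[OF summ[of "N (Suc k)"]]) (use c_le in auto)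
    have "\<bar>\<Sum>i. ?c (i + J (Suc k))\<bar> \<le> (\<Sum>i. \<bar>?c (i + J (Suc k))\<bar>)"
      using c_summ by (intro summable_rabs summable_ignore_initial_segment)
    also have "\<dots> \<le> (\<Sum>i. \<bar>?b (i + J (Suc k))\<bar>)"
      using c_le c_summ summ by (intro suminf_le summable_ignore_initial_segment) auto
    finally have 1: "\<bar>\<Sum>i. ?c (i + J (Suc k))\<bar> < \<eta> / 4"
      using P(3)[of "Suc k"] by linarith
    have "\<bar>\<Sum>i<J k. ?c i\<bar> \<le> (\<Sum>i<J k. \<bar>?b i\<bar>)"
      using c_le by (intro order_trans[OF sum_abs] sum_mono) auto
    then have 2: "\<bar>\<Sum>i<J k. ?c i\<bar> < \<eta> / 4"
      using Q(3)[of k] by linarith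
    have "(\<Sum>i<J (Suc k). ?c i) = (\<Sum>i\<in>{..<J k} \<union> {j (Suc k)}. ?c i)"
    proof (rule sum.mono_neutral_right)
      show "{..<J k} \<union> {j (Suc k)} \<subseteq> {..<J (Suc k)}"
        using monoD[OF J_mono, of k "Suc k"] P(2)[of "Suc k"] by auto
      show "\<forall>i\<in>{..<J (Suc k)} - ({..<J k} \<union> {j (Suc k)}). ?c i = 0"
      proof
        fix i assume i: "i \<in> {..<J (Suc k)} - ({..<J k} \<union> {j (Suc k)})"
        have "i \<notin> I"
        proof
          assume "i \<in> I"
          then obtain l where l: "i = j l" by (auto simp: I_def)
          consider "Suc k < l" | "l = Suc k" | "l \<le> k" by linarith
          then show False
          proof cases
            case 1 then show False using j_J[OF 1] i l by auto
          next
            case 2 then show False using i l by auto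
          next
            case 3 then show False using P(2)[of l] monoD[OF J_mono 3] i l by auto
          qed
        qed
        then show "?c i = 0" by simp
      qed
    qed auto
    also have "\<dots> = (\<Sum>i<J k. ?c i) + ?b (j (Suc k))"
      using Q(2)[of k] by (subst sum.union_disjoint) (auto simp: I_def)
    finally have 3: "(\<Sum>i<J (Suc k). ?c i) = (\<Sum>i<J k. ?c i) + ?b (j (Suc k))" .
    have "(\<Sum>i. ?c i) = (\<Sum>i. ?c (i + J (Suc k))) + (\<Sum>i<J (Suc k). ?c i)"
      using c_summ by (intro suminf_split_initial_segment) (rule summable_rabs_cancel)
    then show ?thesis
      using 1 2 3 P(1)[of "Suc k"] by linarith
  qed
  have "(\<lambda>k. \<Sum>i. indicator I i * b (N (Suc k)) i) \<longlonglongrightarrow> 0"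
    using LIMSEQ_subseq_LIMSEQ[OF conv[of I], of "\<lambda>k. N (Suc k)"] N_mono
    by (auto simp: o_def strict_mono_def)
  then have "(\<lambda>k. \<bar>\<Sum>i. indicator I i * b (N (Suc k)) i\<bar>) \<longlonglongrightarrow> 0"
    by (rule tendsto_rabs_zero)
  then have "\<eta> / 2 \<le> 0"
    using big by (intro LIMSEQ_le_const) auto
  then show False using \<eta> by simp
qed

section \<open>Couplings with a density with respect to the product measure\<close>

lemma couplings_density:
  fixes \<mu> \<nu> :: "'a::polish_space measure"
  assumes \<nu>: "prob_space \<nu>" "sets \<nu> = sets borel" and \<mu>: "prob_space \<mu>" "sets \<mu> = sets borel"
    and h[measurable]: "h \<in> borel_measurable (borel \<Otimes>\<^sub>M borel)"
    and fst: "\<And>u. (\<integral>\<^sup>+v. h (u, v) \<partial>\<mu>) = 1" and snd: "\<And>v. (\<integral>\<^sup>+u. h (u, v) \<partial>\<nu>) = 1"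
  shows "density (\<nu> \<Otimes>\<^sub>M \<mu>) h \<in> couplings \<nu> \<mu>"
proof -
  interpret N: prob_space \<nu> by fact
  interpret M: prob_space \<mu> by fact
  interpret P: pair_prob_space \<nu> \<mu> ..
  have sets_P: "sets (\<nu> \<Otimes>\<^sub>M \<mu>) = sets (borel \<Otimes>\<^sub>M borel)"
    using \<nu>(2) \<mu>(2) by (rule sets_pair_measure_cong)
  note [measurable_cong] = \<nu>(2) \<mu>(2)
  have sp: "space \<nu> = UNIV" "space \<mu> = UNIV"
    using sets_eq_imp_space_eq[OF \<nu>(2)] sets_eq_imp_space_eq[OF \<mu>(2)] by auto
  have h': "h \<in> borel_measurable (\<nu> \<Otimes>\<^sub>M \<mu>)"
    by measurable
  let ?\<pi> = "density (\<nu> \<Otimes>\<^sub>M \<mu>) h"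
  have "distr ?\<pi> borel fst = \<nu>"
  proof (rule measure_eqI)
    fix A assume "A \<in> sets (distr ?\<pi> borel fst)"
    then have [measurable]: "A \<in> sets borel" by simp
    have "emeasure (distr ?\<pi> borel fst) A = emeasure ?\<pi> (A \<times> UNIV)"
      by (subst emeasure_distr) (auto simp: space_pair_measure sp fst_vimage_eq_Times)
    also have "\<dots> = (\<integral>\<^sup>+z. h z * indicator (A \<times> UNIV) z \<partial>(\<nu> \<Otimes>\<^sub>M \<mu>))"
      using h' by (intro emeasure_density) auto
    also have "\<dots> = (\<integral>\<^sup>+u. \<integral>\<^sup>+v. h (u, v) * indicator A u \<partial>\<mu> \<partial>\<nu>)"
      by (subst M.nn_integral_fst[symmetric]) (auto simp: indicator_def intro!: nn_integral_cong)
    also have "\<dots> = (\<integral>\<^sup>+u. indicator A u \<partial>\<nu>)"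
      by (intro nn_integral_cong) (simp add: nn_integral_multc fst)
    also have "\<dots> = emeasure \<nu> A"
      using \<nu>(2) by simp
    finally show "emeasure (distr ?\<pi> borel fst) A = emeasure \<nu> A" .
  qed (simp add: \<nu>)
  moreover have "distr ?\<pi> borel snd = \<mu>"
  proof (rule measure_eqI)
    fix A assume "A \<in> sets (distr ?\<pi> borel snd)"
    then have [measurable]: "A \<in> sets borel" by simp
    have "emeasure (distr ?\<pi> borel snd) A = emeasure ?\<pi> (UNIV \<times> A)"
      by (subst emeasure_distr) (auto simp: space_pair_measure sp snd_vimage_eq_Times)
    also have "\<dots> = (\<integral>\<^sup>+z. h z * indicator (UNIV \<times> A) z \<partial>(\<nu> \<Otimes>\<^sub>M \<mu>))"
      using h' by (intro emeasure_density) auto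
    also have "\<dots> = (\<integral>\<^sup>+v. \<integral>\<^sup>+u. h (u, v) * indicator A v \<partial>\<nu> \<partial>\<mu>)"
      by (subst P.nn_integral_snd[symmetric]) (auto simp: indicator_def intro!: nn_integral_cong)
    also have "\<dots> = (\<integral>\<^sup>+v. indicator A v \<partial>\<mu>)"
      by (intro nn_integral_cong) (simp add: nn_integral_multc snd)
    also have "\<dots> = emeasure \<mu> A"
      using \<mu>(2) by simp
    finally show "emeasure (distr ?\<pi> borel snd) A = emeasure \<mu> A" .
  qed (simp add: \<mu>)
  ultimately show ?thesis
    by (simp add: couplings_def sets_P)
qed

text \<open>The coupling puts the mass charged by both measures through the same element of the
  subordinate partition close to the diagonal and couples the small remainders independently.\<close>

lemma coupling_of_partition:
  fixes \<mu> \<nu> :: "'a::polish_space measure" and \<phi> :: "'i \<Rightarrow> 'a \<Rightarrow> real"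
  assumes \<nu>: "prob_space \<nu>" "sets \<nu> = sets borel" and \<mu>: "prob_space \<mu>" "sets \<mu> = sets borel"
    and J: "finite J" and \<phi>: "\<And>i. i \<in> J \<Longrightarrow> bcont (\<phi> i)" "\<And>i x. i \<in> J \<Longrightarrow> 0 \<le> \<phi> i x"
    and sum_le: "\<And>x. (\<Sum>i\<in>J. \<phi> i x) \<le> 1"
    and small: "\<And>i x y. i \<in> J \<Longrightarrow> \<phi> i x \<noteq> 0 \<Longrightarrow> \<phi> i y \<noteq> 0 \<Longrightarrow> dist x y \<le> \<delta>"
    and \<kappa>: "0 < \<kappa>" "\<kappa> < 1" and p: "1 \<le> p"
    and m_pos: "\<And>i. i \<in> J \<Longrightarrow> 0 < (\<integral>x. \<phi> i x \<partial>\<mu>)"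
    and m_le: "\<And>i. i \<in> J \<Longrightarrow> (1 - \<kappa>) * (\<integral>x. \<phi> i x \<partial>\<mu>) \<le> (\<integral>x. \<phi> i x \<partial>\<nu>)"
    and V: "V \<in> borel_measurable borel" "\<And>x. 0 \<le> V x"
    and c: "0 \<le> c" "\<And>x y. dist x y powr p \<le> c * (V x + V y)" and K: "0 \<le> K"
    and \<eta>: "\<eta> = 1 - (1 - \<kappa>) * (\<Sum>i\<in>J. \<integral>x. \<phi> i x \<partial>\<mu>)"
  shows "\<exists>\<pi>\<in>couplings \<nu> \<mu>. (\<integral>\<^sup>+z. ennreal (dist (fst z) (snd z) powr p) \<partial>\<pi>) \<le>
    ennreal (\<delta> powr p) + ennreal c * (2 * ennreal (K * \<eta>) +
      (\<integral>\<^sup>+x. ennreal (V x * indicator {x. K \<le> V x} x) \<partial>\<nu>) +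
      (\<integral>\<^sup>+x. ennreal (V x * indicator {x. K \<le> V x} x) \<partial>\<mu>))"
proof -
  interpret N: prob_space \<nu> by fact
  interpret M: prob_space \<mu> by fact
  interpret P: pair_prob_space \<nu> \<mu> ..
  note [measurable_cong] = \<nu>(2) \<mu>(2)
  note V(1)[measurable]
  have [measurable]: "\<phi> i \<in> borel_measurable borel" if "i \<in> J" for i
    using bcont_measurable[OF refl \<phi>(1)[OF that]] .
  have N_int: "integrable \<nu> f" and M_int: "integrable \<mu> f" if "bcont f" for f
    using integrable_bcont[OF N.finite_measure_axioms \<nu>(2) that]
      integrable_bcont[OF M.finite_measure_axioms \<mu>(2) that] by auto
  define m where "m i = (\<integral>x. \<phi> i x \<partial>\<mu>)" for i
  define n where "n i = (\<integral>x. \<phi> i x \<partial>\<nu>)" for i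
  have m: "0 < m i" "(1 - \<kappa>) * m i \<le> n i" if "i \<in> J" for i
    using m_pos[OF that] m_le[OF that] by (auto simp: m_def n_def)
  have n: "0 < n i" if "i \<in> J" for i
    using mult_pos_pos[of "1 - \<kappa>" "m i"] m[OF that] \<kappa> by linarith
  have frac: "0 \<le> (1 - \<kappa>) * m i / n i" "(1 - \<kappa>) * m i / n i \<le> 1" if "i \<in> J" for i
    using m[OF that] n[OF that] \<kappa> by (auto simp: divide_le_eq)
  have \<eta>': "\<eta> = 1 - (1 - \<kappa>) * (\<Sum>i\<in>J. m i)"
    by (simp add: \<eta> m_def)
  have "(\<Sum>i\<in>J. m i) = (\<integral>x. (\<Sum>i\<in>J. \<phi> i x) \<partial>\<mu>)"
    unfolding m_def using M_int[OF \<phi>(1)] by (subst Bochner_Integration.integral_sum) auto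
  also have "\<dots> \<le> (\<integral>x. 1 \<partial>\<mu>)"
    using sum_le by (intro integral_mono M_int bcont_sum \<phi>) auto
  finally have "(\<Sum>i\<in>J. m i) \<le> 1"
    by (simp add: M.prob_space)
  then have "(1 - \<kappa>) * (\<Sum>i\<in>J. m i) \<le> (1 - \<kappa>) * 1"
    using \<kappa> by (intro mult_left_mono) auto
  also have "\<dots> < 1"
    using \<kappa> by simp
  finally have \<eta>_pos: "0 < \<eta>"
    unfolding \<eta>' by simp
  \<comment> \<open>These are the densities of the mass left over by the transport \<open>g\<close>
    below, with respect to \<mu> and \<nu>. Both have total mass \<eta>, so their product divided by
    \<eta> couples them. The factor 1 - \<kappa> keeps \<open>b\<close> nonnegative by
    \<open>m_le\<close> and keeps \<eta> positive.\<close>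
  define a where "a x = 1 - (\<Sum>i\<in>J. (1 - \<kappa>) * \<phi> i x)" for x
  define b where "b x = 1 - (\<Sum>i\<in>J. ((1 - \<kappa>) * m i / n i) * \<phi> i x)" for x
  have a_cont: "bcont a" and b_cont: "bcont b"
    unfolding a_def[abs_def] b_def[abs_def]
    by (intro bcont_diff bcont_sum bcont_cmult \<phi> bcont_const; assumption)+
  have [measurable]: "a \<in> borel_measurable borel" "b \<in> borel_measurable borel"
    using bcont_measurable[OF refl a_cont] bcont_measurable[OF refl b_cont] by auto
  have a_bnd: "0 \<le> a x" "a x \<le> 1" for x
  proof -
    have "(\<Sum>i\<in>J. (1 - \<kappa>) * \<phi> i x) \<le> (\<Sum>i\<in>J. 1 * \<phi> i x)"
      using \<kappa> \<phi> by (intro sum_mono mult_right_mono) auto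
    then show "0 \<le> a x"
      using sum_le[of x] by (simp add: a_def)
    have "0 \<le> (\<Sum>i\<in>J. (1 - \<kappa>) * \<phi> i x)"
      using \<kappa> \<phi> by (intro sum_nonneg) auto
    then show "a x \<le> 1"
      by (simp add: a_def)
  qed
  have b_bnd: "0 \<le> b x" "b x \<le> 1" for x
  proof -
    have "(\<Sum>i\<in>J. ((1 - \<kappa>) * m i / n i) * \<phi> i x) \<le> (\<Sum>i\<in>J. 1 * \<phi> i x)"
      using frac \<phi> by (intro sum_mono mult_right_mono) auto
    then show "0 \<le> b x"
      using sum_le[of x] by (simp add: b_def)
    have "0 \<le> (\<Sum>i\<in>J. ((1 - \<kappa>) * m i / n i) * \<phi> i x)"
      using frac \<phi> by (intro sum_nonneg mult_nonneg_nonneg) auto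
    then show "b x \<le> 1"
      by (simp add: b_def)
  qed
  have a_int: "(\<integral>x. a x \<partial>\<mu>) = \<eta>"
    unfolding a_def \<eta>' using M_int[OF \<phi>(1)]
    by (subst Bochner_Integration.integral_diff) (auto simp: m_def sum_distrib_left M.prob_space)
  have b_int: "(\<integral>x. b x \<partial>\<nu>) = \<eta>"
  proof -
    have "(\<integral>x. b x \<partial>\<nu>) = 1 - (\<Sum>i\<in>J. ((1 - \<kappa>) * m i / n i) * n i)"
      unfolding b_def using N_int[OF \<phi>(1)]
      by (subst Bochner_Integration.integral_diff) (auto simp: n_def N.prob_space)
    also have "(\<Sum>i\<in>J. ((1 - \<kappa>) * m i / n i) * n i) = (\<Sum>i\<in>J. (1 - \<kappa>) * m i)"
      using n by (intro sum.cong) (auto simp: less_imp_neq[THEN not_sym])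
    finally show ?thesis
      by (simp add: \<eta>' sum_distrib_left)
  qed
  \<comment> \<open>Within cell i the mass (1 - \<kappa>) m_i is moved by a product density;
    dividing by n_i gives the second marginal the density 1 - a and the first the density 1 -
    b.\<close>
  define g where "g u v = (\<Sum>i\<in>J. ((1 - \<kappa>) / n i) * \<phi> i u * \<phi> i v)" for u v
  define r where "r u v = b u * a v / \<eta>" for u v
  have g_nonneg: "0 \<le> g u v" and r_nonneg: "0 \<le> r u v" for u v
    using \<kappa> n \<phi> a_bnd b_bnd \<eta>_pos
    by (auto simp: g_def r_def less_imp_le intro!: sum_nonneg)
  define h where "h z = ennreal (g (fst z) (snd z) + r (fst z) (snd z))" for z
  have [measurable]: "(\<lambda>z. g (fst z) (snd z)) \<in> borel_measurable (borel \<Otimes>\<^sub>M borel)"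
    "(\<lambda>z. r (fst z) (snd z)) \<in> borel_measurable (borel \<Otimes>\<^sub>M borel)"
    unfolding g_def r_def by measurable
  have h_meas[measurable]: "h \<in> borel_measurable (borel \<Otimes>\<^sub>M borel)"
    unfolding h_def[abs_def] by measurable
  have fst: "(\<integral>\<^sup>+v. h (u, v) \<partial>\<mu>) = 1" for u
  proof -
    have g_c: "bcont (\<lambda>v. g u v)"
      unfolding g_def by (intro bcont_sum bcont_cmult \<phi>)
    have r_c: "bcont (\<lambda>v. r u v)"
      using bcont_cmult[OF a_cont, of "b u / \<eta>"] by (simp add: r_def)
    have "(\<integral>v. g u v + r u v \<partial>\<mu>) = (\<integral>v. g u v \<partial>\<mu>) + (\<integral>v. r u v \<partial>\<mu>)"
      by (intro Bochner_Integration.integral_add M_int g_c r_c)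
    also have "(\<integral>v. g u v \<partial>\<mu>) = (\<Sum>i\<in>J. ((1 - \<kappa>) / n i) * \<phi> i u * m i)"
      unfolding g_def using M_int[OF \<phi>(1)] by (subst Bochner_Integration.integral_sum) (auto simp: m_def)
    also have "\<dots> = 1 - b u"
      by (simp add: b_def mult.commute mult.left_commute)
    also have "(\<integral>v. r u v \<partial>\<mu>) = b u"
      unfolding r_def using \<eta>_pos by (simp add: a_int)
    finally show ?thesis
      using g_nonneg r_nonneg by (subst h_def, subst nn_integral_eq_integral) (auto intro!: M_int bcont_add g_c r_c)
  qed
  have snd: "(\<integral>\<^sup>+u. h (u, v) \<partial>\<nu>) = 1" for v
  proof -
    have g_c: "bcont (\<lambda>u. g u v)"
      unfolding g_def by (intro bcont_sum bcont_cmult bcont_mult bcont_const \<phi>)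
    have r_c: "bcont (\<lambda>u. r u v)"
      using bcont_cmult[OF b_cont, of "a v / \<eta>"] by (simp add: r_def mult.commute)
    have "(\<integral>u. g u v + r u v \<partial>\<nu>) = (\<integral>u. g u v \<partial>\<nu>) + (\<integral>u. r u v \<partial>\<nu>)"
      by (intro Bochner_Integration.integral_add N_int g_c r_c)
    also have "(\<integral>u. g u v \<partial>\<nu>) = (\<Sum>i\<in>J. ((1 - \<kappa>) / n i) * n i * \<phi> i v)"
      unfolding g_def using N_int[OF \<phi>(1)] by (subst Bochner_Integration.integral_sum) (auto simp: n_def intro!: sum.cong)
    also have "\<dots> = (\<Sum>i\<in>J. (1 - \<kappa>) * \<phi> i v)"
      using n by (intro sum.cong) (auto simp: less_imp_neq[THEN not_sym])
    also have "\<dots> = 1 - a v"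
      by (simp add: a_def)
    also have "(\<integral>u. r u v \<partial>\<nu>) = a v"
      unfolding r_def using \<eta>_pos by (simp add: b_int)
    finally show ?thesis
      using g_nonneg r_nonneg by (subst h_def, subst nn_integral_eq_integral) (auto intro!: N_int bcont_add g_c r_c)
  qed
  let ?\<pi> = "density (\<nu> \<Otimes>\<^sub>M \<mu>) h"
  let ?T = "\<lambda>x. V x * indicator {x. K \<le> V x} x"
  have [measurable]: "?T \<in> borel_measurable borel"
    by measurable
  have coupl: "?\<pi> \<in> couplings \<nu> \<mu>"
    using \<nu> \<mu> h_meas fst snd by (rule couplings_density)
  \<comment> \<open>Where V < K the integrand is at most K w; elsewhere w \<le> 1 leaves the tail of
    V.\<close>
  have cut: "(\<integral>\<^sup>+x. ennreal (V x * w x) \<partial>\<rho>) \<le> ennreal (K * \<eta>) + (\<integral>\<^sup>+x. ennreal (?T x) \<partial>\<rho>)"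
    if w: "bcont w" "\<And>x. 0 \<le> w x" "\<And>x. w x \<le> 1" "(\<integral>x. w x \<partial>\<rho>) = \<eta>" "integrable \<rho> w"
      and \<rho>[measurable_cong]: "sets \<rho> = sets borel" for w \<rho>
  proof -
    have [measurable]: "w \<in> borel_measurable borel"
      using bcont_measurable[OF refl w(1)] .
    have "(\<integral>\<^sup>+x. ennreal (V x * w x) \<partial>\<rho>) \<le> (\<integral>\<^sup>+x. ennreal K * ennreal (w x) + ennreal (?T x) \<partial>\<rho>)"
    proof (rule nn_integral_mono)
      fix x
      have "V x * w x \<le> K * w x + ?T x"
      proof (cases "K \<le> V x")
        case True
        then show ?thesis
          using mult_left_le[of "w x" "V x"] w(2)[of x] w(3)[of x] V(2)[of x] K
          by (auto simp: indicator_def intro: add_increasing)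
      next
        case False
        then show ?thesis
          using w(2)[of x] by (auto simp: indicator_def intro: mult_right_mono)
      qed
      then have "ennreal (V x * w x) \<le> ennreal (K * w x + ?T x)"
        by (rule ennreal_leI)
      also have "\<dots> = ennreal K * ennreal (w x) + ennreal (?T x)"
        using K w(2) V(2) by (subst ennreal_plus) (auto simp: ennreal_mult)
      finally show "ennreal (V x * w x) \<le> ennreal K * ennreal (w x) + ennreal (?T x)" .
    qed
    also have "\<dots> = ennreal K * (\<integral>\<^sup>+x. ennreal (w x) \<partial>\<rho>) + (\<integral>\<^sup>+x. ennreal (?T x) \<partial>\<rho>)"
      by (subst nn_integral_add) (auto simp: nn_integral_cmult)
    also have "(\<integral>\<^sup>+x. ennreal (w x) \<partial>\<rho>) = ennreal \<eta>"
      using w by (subst nn_integral_eq_integral) auto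
    finally show ?thesis
      using K \<eta>_pos by (simp add: ennreal_mult)
  qed
  \<comment> \<open>Because \<open>a\<close> and \<open>b\<close> have the same integral \<eta>, the
    normalization cancels and the cost of the remainder splits into two one-variable
    integrals.\<close>
  have rem: "(\<integral>\<^sup>+u. \<integral>\<^sup>+v. ennreal (r u v * (V u + V v)) \<partial>\<mu> \<partial>\<nu>) =
    (\<integral>\<^sup>+u. ennreal (V u * b u) \<partial>\<nu>) + (\<integral>\<^sup>+v. ennreal (V v * a v) \<partial>\<mu>)"
  proof -
    have a_nn: "(\<integral>\<^sup>+v. ennreal (a v) \<partial>\<mu>) = ennreal \<eta>"
      using a_bnd a_int M_int[OF a_cont] by (subst nn_integral_eq_integral) auto
    have b_nn: "(\<integral>\<^sup>+v. ennreal (b v) \<partial>\<nu>) = ennreal \<eta>"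
      using b_bnd b_int N_int[OF b_cont] by (subst nn_integral_eq_integral) auto
    let ?A = "\<integral>\<^sup>+v. ennreal (V v * a v) \<partial>\<mu>"
    have "ennreal (r u v * (V u + V v)) =
        ennreal (V u * b u / \<eta>) * ennreal (a v) + ennreal (b u / \<eta>) * ennreal (V v * a v)" for u v
      using a_bnd b_bnd V(2) \<eta>_pos
      by (simp add: r_def ennreal_mult[symmetric] ennreal_plus[symmetric] del: ennreal_plus)
        (simp add: algebra_simps add_divide_distrib)
    then have 1: "(\<integral>\<^sup>+v. ennreal (r u v * (V u + V v)) \<partial>\<mu>) =
        ennreal (V u * b u / \<eta>) * ennreal \<eta> + ennreal (b u / \<eta>) * ?A" for u
      by (simp add: nn_integral_add nn_integral_cmult a_nn)
    have 2: "ennreal (V u * b u / \<eta>) * ennreal \<eta> = ennreal (V u * b u)" for u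
      using \<eta>_pos V(2)[of u] b_bnd(1)[of u] by (simp add: ennreal_mult[symmetric])
    have 3: "ennreal (b u / \<eta>) = ennreal (1 / \<eta>) * ennreal (b u)" for u
      using \<eta>_pos b_bnd(1)[of u] by (simp add: ennreal_mult[symmetric])
    have "(\<integral>\<^sup>+u. \<integral>\<^sup>+v. ennreal (r u v * (V u + V v)) \<partial>\<mu> \<partial>\<nu>) =
        (\<integral>\<^sup>+u. ennreal (V u * b u) \<partial>\<nu>) + ennreal (1 / \<eta>) * ennreal \<eta> * ?A"
      unfolding 1 2 3 by (simp add: nn_integral_add nn_integral_cmult nn_integral_multc b_nn)
    also have "ennreal (1 / \<eta>) * ennreal \<eta> = 1"
      using \<eta>_pos by (simp add: ennreal_mult[symmetric])
    finally show ?thesis by simp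
  qed
  have "(\<integral>\<^sup>+z. ennreal (dist (fst z) (snd z) powr p) \<partial>?\<pi>) =
      (\<integral>\<^sup>+z. h z * ennreal (dist (fst z) (snd z) powr p) \<partial>(\<nu> \<Otimes>\<^sub>M \<mu>))"
    by (intro nn_integral_density) measurable
  also have "\<dots> \<le> (\<integral>\<^sup>+z. ennreal (\<delta> powr p) * h z + ennreal c * ennreal (r (fst z) (snd z) * (V (fst z) + V (snd z))) \<partial>(\<nu> \<Otimes>\<^sub>M \<mu>))"
  proof (rule nn_integral_mono)
    fix z :: "'a \<times> 'a"
    obtain u v where z: "z = (u, v)" by (cases z)
    have "g u v * dist u v powr p \<le> g u v * \<delta> powr p"
    proof (cases "g u v = 0")
      case False
      then obtain i where i: "i \<in> J" "((1 - \<kappa>) / n i) * \<phi> i u * \<phi> i v \<noteq> 0"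
        unfolding g_def by (meson sum.neutral)
      then have "dist u v \<le> \<delta>"
        using small[of i u v] by auto
      then have "dist u v powr p \<le> \<delta> powr p"
        using p by (intro powr_mono2) auto
      then show ?thesis
        using g_nonneg by (intro mult_left_mono) auto
    qed simp
    moreover have "0 \<le> r u v * \<delta> powr p"
      using r_nonneg by simp
    moreover have "r u v * dist u v powr p \<le> r u v * (c * (V u + V v))"
      using r_nonneg c by (intro mult_left_mono) auto
    ultimately have "(g u v + r u v) * dist u v powr p \<le>
        \<delta> powr p * (g u v + r u v) + c * (r u v * (V u + V v))"
      by (simp add: algebra_simps)
    then have "ennreal ((g u v + r u v) * dist u v powr p) \<le>
        ennreal (\<delta> powr p * (g u v + r u v) + c * (r u v * (V u + V v)))"
      by (rule ennreal_leI)
    also have "\<dots> = ennreal (\<delta> powr p) * ennreal (g u v + r u v) + ennreal c * ennreal (r u v * (V u + V v))"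
      using g_nonneg[of u v] r_nonneg[of u v] c(1) V(2)[of u] V(2)[of v]
      by (simp only: ennreal_mult[symmetric] ennreal_plus[symmetric] add_nonneg_nonneg mult_nonneg_nonneg powr_ge_zero)
    finally show "h z * ennreal (dist (fst z) (snd z) powr p) \<le>
        ennreal (\<delta> powr p) * h z + ennreal c * ennreal (r (fst z) (snd z) * (V (fst z) + V (snd z)))"
      using g_nonneg[of u v] r_nonneg[of u v] by (simp add: z h_def ennreal_mult)
  qed
  also have "\<dots> = ennreal (\<delta> powr p) * (\<integral>\<^sup>+z. h z \<partial>(\<nu> \<Otimes>\<^sub>M \<mu>)) +
      ennreal c * (\<integral>\<^sup>+z. ennreal (r (fst z) (snd z) * (V (fst z) + V (snd z))) \<partial>(\<nu> \<Otimes>\<^sub>M \<mu>))"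
    by (subst nn_integral_add) (auto simp: nn_integral_cmult)
  also have "(\<integral>\<^sup>+z. h z \<partial>(\<nu> \<Otimes>\<^sub>M \<mu>)) = 1"
    using fst by (subst M.nn_integral_fst[symmetric]) (auto simp: N.emeasure_space_1)
  also have "(\<integral>\<^sup>+z. ennreal (r (fst z) (snd z) * (V (fst z) + V (snd z))) \<partial>(\<nu> \<Otimes>\<^sub>M \<mu>)) =
      (\<integral>\<^sup>+u. ennreal (V u * b u) \<partial>\<nu>) + (\<integral>\<^sup>+v. ennreal (V v * a v) \<partial>\<mu>)"
    using rem by (subst M.nn_integral_fst[symmetric]) auto
  finally have "(\<integral>\<^sup>+z. ennreal (dist (fst z) (snd z) powr p) \<partial>?\<pi>) \<le>
      ennreal (\<delta> powr p) + ennreal c * ((\<integral>\<^sup>+u. ennreal (V u * b u) \<partial>\<nu>) + (\<integral>\<^sup>+v. ennreal (V v * a v) \<partial>\<mu>))"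
    by simp
  also have "\<dots> \<le> ennreal (\<delta> powr p) + ennreal c * ((ennreal (K * \<eta>) + (\<integral>\<^sup>+x. ennreal (?T x) \<partial>\<nu>)) +
      (ennreal (K * \<eta>) + (\<integral>\<^sup>+x. ennreal (?T x) \<partial>\<mu>)))"
    by (intro add_mono mult_left_mono cut a_cont b_cont a_bnd b_bnd a_int b_int N_int M_int \<nu> \<mu>) auto
  finally have "(\<integral>\<^sup>+z. ennreal (dist (fst z) (snd z) powr p) \<partial>?\<pi>) \<le>
    ennreal (\<delta> powr p) + ennreal c * (2 * ennreal (K * \<eta>) +
      (\<integral>\<^sup>+x. ennreal (?T x) \<partial>\<nu>) + (\<integral>\<^sup>+x. ennreal (?T x) \<partial>\<mu>))"
    by (simp add: mult_2 ac_simps)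
  then show ?thesis
    using coupl by blast
qed

section \<open>Feller semigroups\<close>

lemma eventually_at_top_shift:
  fixes s :: real
  assumes "eventually (\<lambda>t. Q (s + t)) at_top"
  shows "eventually Q at_top"
proof -
  obtain N where N: "\<And>t. N \<le> t \<Longrightarrow> Q (s + t)"
    using assms by (auto simp: eventually_at_top_linorder)
  show ?thesis
    unfolding eventually_at_top_linorder
    by (rule exI[of _ "N + s"]) (use N[of "_ - s"] in \<open>force simp: algebra_simps\<close>)
qed

text \<open>A closed subset of a Polish space is completely metrizable in its own right, so Baire's
  theorem applies within Y; the resulting ball is relative to Y.\<close>

lemma Baire_closed_cover:
  fixes Y :: "'a::polish_space set" and F :: "nat \<Rightarrow> 'a set"
  assumes Y: "closed Y" "Y \<noteq> {}" and F: "\<And>n. closed (F n)" and cover: "Y \<subseteq> (\<Union>n. F n)"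
  obtains n w r where "w \<in> Y" "0 < r" "ball w r \<inter> Y \<subseteq> F n"
proof -
  let ?X = "subtopology euclidean Y"
  have X: "completely_metrizable_space ?X"
    using Y(1) by (intro completely_metrizable_space_closedin completely_metrizable_space_euclidean) auto
  have "\<exists>n. ?X interior_of (F n \<inter> Y) \<noteq> {}"
  proof (rule ccontr)
    assume "\<not> ?thesis"
    then have "?X interior_of \<Union> (range (\<lambda>n. F n \<inter> Y)) = {}"
      using X F Y by (intro Baire_category_alt) (auto simp: closedin_closed)
    moreover have "\<Union> (range (\<lambda>n. F n \<inter> Y)) = topspace ?X"
      using cover by auto
    ultimately show False
      using Y(2) by (metis interior_of_topspace topspace_euclidean_subtopology)
  qed
  then obtain n w where w: "w \<in> ?X interior_of (F n \<inter> Y)"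
    by auto
  then obtain U where "openin ?X U" "w \<in> U" "U \<subseteq> F n \<inter> Y"
    by (auto simp: interior_of_def)
  then obtain V where V: "open V" "w \<in> V" "w \<in> Y" "V \<inter> Y \<subseteq> F n"
    by (auto simp: openin_open)
  then obtain r where "0 < r" "ball w r \<subseteq> V"
    using open_contains_ball by blast
  then show thesis
    using V by (intro that[of w r n]) auto
qed

lemma kernel_measurable:
  assumes "\<And>x. prob_space (K x)" "\<And>x. sets (K x) = sets borel"
    and "\<And>A. A \<in> sets borel \<Longrightarrow> (\<lambda>x. emeasure (K x) A) \<in> borel_measurable borel"
  shows "K \<in> measurable borel (subprob_algebra borel)"
  using assms by (intro measurable_subprob_algebra) (auto intro: prob_space_imp_subprob_space)

lemma kernel_integral_measurable:
  fixes f :: "'b::topological_space \<Rightarrow> real" and K :: "'a::topological_space \<Rightarrow> 'b measure"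
  assumes "\<And>x. prob_space (K x)" "\<And>x. sets (K x) = sets borel"
    and "\<And>A. A \<in> sets borel \<Longrightarrow> (\<lambda>x. emeasure (K x) A) \<in> borel_measurable borel"
    and "f \<in> borel_measurable borel"
  shows "(\<lambda>x. \<integral>y. f y \<partial>K x) \<in> borel_measurable borel"
  using assms(4) by (intro measurable_compose[OF kernel_measurable integral_measurable_subprob_algebra] assms(1-3))

text \<open>The long-time analysis involves only laws at single times, so paths and filtrations are
  left behind. The measure axioms range over all real t, since \<open>kernel\<close> yields a
  probability measure for each; the dynamics are restricted to nonnegative times.\<close>

locale feller_semigroup =
  fixes P :: "real \<Rightarrow> 'a::polish_space \<Rightarrow> 'a measure"
  assumes prob_P: "prob_space (P t x)"
    and sets_P: "sets (P t x) = sets borel"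
    and emeasure_P_measurable: "A \<in> sets borel \<Longrightarrow> (\<lambda>x. emeasure (P t x) A) \<in> borel_measurable borel"
    and chapman_kolmogorov: "0 \<le> s \<Longrightarrow> 0 \<le> t \<Longrightarrow> bcont f \<Longrightarrow>
      (\<integral>y. f y \<partial>P (t + s) x) = (\<integral>u. (\<integral>y. f y \<partial>P s u) \<partial>P t x)"
    and feller_continuous: "0 \<le> t \<Longrightarrow> bcont f \<Longrightarrow> continuous_on UNIV (\<lambda>x. \<integral>y. f y \<partial>P t x)"
begin

definition T :: "real \<Rightarrow> ('a \<Rightarrow> real) \<Rightarrow> 'a \<Rightarrow> real" where
  "T t f x = (\<integral>y. f y \<partial>P t x)"

lemma space_P [simp]: "space (P t x) = UNIV"
  using sets_eq_imp_space_eq[OF sets_P] by simp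

lemma measure_P_UNIV [simp]: "measure (P t x) UNIV = 1"
  using prob_space.prob_space[OF prob_P, of t x] by simp

lemma integrable_P: "bcont f \<Longrightarrow> integrable (P t x) f"
  by (intro integrable_bcont sets_P prob_space.finite_measure prob_P)

lemma T_add: "bcont f \<Longrightarrow> bcont g \<Longrightarrow> T t (\<lambda>x. f x + g x) x = T t f x + T t g x"
  and T_diff: "bcont f \<Longrightarrow> bcont g \<Longrightarrow> T t (\<lambda>x. f x - g x) x = T t f x - T t g x"
  and T_cmult: "T t (\<lambda>x. c * f x) x = c * T t f x"
  by (auto simp: T_def integrable_P)

lemma T_const: "T t (\<lambda>x. c) x = c"
  by (simp add: T_def)

lemma T_mono: "bcont f \<Longrightarrow> bcont g \<Longrightarrow> (\<And>x. f x \<le> g x) \<Longrightarrow> T t f x \<le> T t g x"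
  by (auto simp: T_def intro!: integral_mono integrable_P)

lemma T_nonneg: "(\<And>x. 0 \<le> f x) \<Longrightarrow> 0 \<le> T t f x"
  by (auto simp: T_def)

lemma T_sum: "(\<And>i. i \<in> I \<Longrightarrow> bcont (f i)) \<Longrightarrow> T t (\<lambda>x. \<Sum>i\<in>I. f i x) x = (\<Sum>i\<in>I. T t (f i) x)"
  by (auto simp: T_def integrable_P)

lemma T_abs_le:
  assumes "bcont f" "\<And>x. \<bar>f x\<bar> \<le> B"
  shows "\<bar>T t f x\<bar> \<le> B"
proof -
  have "T t f x \<le> T t (\<lambda>_. B) x" "T t (\<lambda>_. - B) x \<le> T t f x"
    using assms(2) by (auto intro!: T_mono assms(1) simp: abs_le_iff minus_le_iff)
  then show ?thesis
    by (auto simp: T_const)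
qed

lemma T_measurable [measurable]: "bcont f \<Longrightarrow> T t f \<in> borel_measurable borel"
  using kernel_integral_measurable[of "P t" f] prob_P sets_P emeasure_P_measurable bcont_measurable[of borel f]
  by (simp add: T_def[abs_def])

lemma bcont_T:
  assumes "0 \<le> t" "bcont f"
  shows "bcont (T t f)"
proof -
  obtain B where "\<And>x. \<bar>f x\<bar> \<le> B"
    using bcontE[OF assms(2)] by metis
  then have "\<bar>T t f x\<bar> \<le> B" for x
    using assms(2) by (intro T_abs_le)
  then show ?thesis
    using feller_continuous[OF assms] by (intro bcontI[of _ B]) (simp_all add: T_def[abs_def])
qed

lemma T_semigroup: "0 \<le> s \<Longrightarrow> 0 \<le> t \<Longrightarrow> bcont f \<Longrightarrow> T (t + s) f x = T t (T s f) x"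
  using chapman_kolmogorov[of s t f x] by (simp add: T_def[abs_def])

text \<open>Dominated convergence with bound 2 sup |f|. With M a law \<open>P s z\<close> it gives
  invariance of the limit functional; with M invariant it gives convergence to M.\<close>

lemma integral_T_diff_tendsto:
  assumes M: "prob_space M" "sets M = sets borel" and f: "bcont f"
    and lim: "\<And>u. ((\<lambda>t. T t f u - T t f x) \<longlongrightarrow> 0) at_top"
  shows "((\<lambda>t. \<integral>u. T t f u - T t f x \<partial>M) \<longlongrightarrow> 0) at_top"
proof -
  interpret prob_space M by fact
  note [measurable_cong] = M(2)
  note [measurable] = T_measurable[OF f]
  obtain B where B: "\<And>x. \<bar>f x\<bar> \<le> B"
    using bcontE[OF f] by metis
  have "((\<lambda>t. \<integral>u. T t f u - T t f x \<partial>M) \<longlongrightarrow> (\<integral>u. 0 \<partial>M)) at_top"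
  proof (rule integral_dominated_convergence_at_top[where w = "\<lambda>_. 2 * B"])
    show "\<forall>\<^sub>F t in at_top. AE u in M. norm (T t f u - T t f x) \<le> 2 * B"
    proof (intro always_eventually allI AE_I2)
      fix t u
      show "norm (T t f u - T t f x) \<le> 2 * B"
        using T_abs_le[OF f B, of t u] T_abs_le[OF f B, of t x] by simp
    qed
  qed (use lim in \<open>auto\<close>)
  then show ?thesis by simp
qed

text \<open>If two independent copies started at x and y are both close to z at time s, then
  from there on the oscillation of T t f is small; otherwise it is at most the
  asymptotic oscillation over all pairs of points, which is therefore contracted.\<close>

lemma asymptotic_contraction:
  assumes f: "bcont f" and \<alpha>: "0 < \<alpha>"
    and ec: "\<And>x. x \<in> ball z \<delta> \<Longrightarrow> eventually (\<lambda>t. \<bar>T t f x - T t f z\<bar> \<le> \<epsilon>) at_top"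
    and lower: "\<And>x. eventually (\<lambda>t. \<alpha> \<le> measure (P t x) (ball z \<delta>)) at_top"
    and q: "0 \<le> q" and valid: "\<And>x y \<eta>. 0 < \<eta> \<Longrightarrow> eventually (\<lambda>t. \<bar>T t f x - T t f y\<bar> \<le> 2 * \<epsilon> + q + \<eta>) at_top"
    and \<eta>: "0 < \<eta>"
  shows "eventually (\<lambda>t. \<bar>T t f x - T t f y\<bar> \<le> 2 * \<epsilon> + (1 - \<alpha>\<^sup>2) * q + \<eta>) at_top"
proof -
  note [measurable] = T_measurable[OF f]
  obtain B where B: "0 < B" "\<And>x. \<bar>f x\<bar> \<le> B"
    using bcontE[OF f] by metis
  have "eventually (\<lambda>s. \<alpha> \<le> measure (P s x) (ball z \<delta>) \<and> \<alpha> \<le> measure (P s y) (ball z \<delta>) \<and> 0 \<le> s) at_top"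
    by (intro eventually_conj lower eventually_ge_at_top)
  then obtain s where s: "\<alpha> \<le> measure (P s x) (ball z \<delta>)" "\<alpha> \<le> measure (P s y) (ball z \<delta>)" "0 \<le> s"
    by (auto simp: eventually_at_top_linorder)
  interpret X: prob_space "P s x" by (rule prob_P)
  interpret Y: prob_space "P s y" by (rule prob_P)
  interpret XY: pair_prob_space "P s x" "P s y" ..
  note [measurable_cong] = sets_P[of s x] sets_P[of s y]
  let ?Q = "P s x \<Otimes>\<^sub>M P s y"
  let ?B = "ball z \<delta> \<times> ball z \<delta>"
  have [measurable]: "?B \<in> sets ?Q"
    using sets_P by (intro pair_measureI) auto
  define D where "D t w = \<bar>T t f (fst w) - T t f (snd w)\<bar>" for t w
  \<comment> \<open>The asymptotic bound for \<open>D\<close>: 2\<epsilon> if both copies are near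
    z, and 2\<epsilon> + q otherwise. Its mean is at most 2\<epsilon> + (1 - \<alpha>^2) q by
    independence, while the excess \<open>g\<close> of \<open>D\<close> over it tends to 0 at every
    pair and hence in mean.\<close>
  define c where "c w = 2 * \<epsilon> + q - q * indicator ?B w" for w :: "'a \<times> 'a"
  define g where "g t w = max 0 (D t w - c w)" for t w
  have [measurable]: "D t \<in> borel_measurable ?Q" "c \<in> borel_measurable ?Q" "g t \<in> borel_measurable ?Q" for t
    unfolding D_def[abs_def] c_def[abs_def] g_def[abs_def] by measurable
  have D_le: "D t w \<le> 2 * B" "0 \<le> D t w" for t w
    using T_abs_le[OF f B(2), of t "fst w"] T_abs_le[OF f B(2), of t "snd w"] by (auto simp: D_def)
  have c_le: "\<bar>c w\<bar> \<le> \<bar>2 * \<epsilon>\<bar> + q" for w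
    using q by (auto simp: c_def indicator_def)
  have int_D: "integrable ?Q (D t)" for t
    by (rule XY.P.integrable_const_bound[of _ "2 * B"]) (use D_le in auto)
  have int_c: "integrable ?Q c"
    by (rule XY.P.integrable_const_bound[of _ "\<bar>2 * \<epsilon>\<bar> + q"]) (use c_le in auto)
  have int_g: "integrable ?Q (g t)" for t
    unfolding g_def[abs_def] by (intro integrable_max Bochner_Integration.integrable_diff int_D int_c) auto
  have lim: "((\<lambda>t. g t w) \<longlongrightarrow> 0) at_top" for w
  proof (rule tendstoI)
    fix e :: real assume e: "0 < e"
    have "eventually (\<lambda>t. D t w \<le> c w + e / 2) at_top"
    proof (cases "w \<in> ?B")
      case True
      have "eventually (\<lambda>t. \<bar>T t f (fst w) - T t f z\<bar> \<le> \<epsilon>) at_top"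
        "eventually (\<lambda>t. \<bar>T t f (snd w) - T t f z\<bar> \<le> \<epsilon>) at_top"
        using True by (auto intro!: ec)
      then show ?thesis
      proof eventually_elim
        case (elim t)
        then show ?case
          using True e by (simp add: D_def c_def)
      qed
    next
      case False
      then show ?thesis
        using valid[of "e / 2" "fst w" "snd w"] e by (simp add: D_def c_def)
    qed
    then show "eventually (\<lambda>t. dist (g t w) 0 < e) at_top"
    proof eventually_elim
      case (elim t)
      then show ?case
        using e by (simp add: g_def)
    qed
  qed
  have "((\<lambda>t. \<integral>w. g t w \<partial>?Q) \<longlongrightarrow> (\<integral>w. 0 \<partial>?Q)) at_top"
  proof (rule integral_dominated_convergence_at_top[where w = "\<lambda>_. 2 * B + (\<bar>2 * \<epsilon>\<bar> + q)"])
    show "\<forall>\<^sub>F t in at_top. AE w in ?Q. norm (g t w) \<le> 2 * B + (\<bar>2 * \<epsilon>\<bar> + q)"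
    proof (intro always_eventually allI AE_I2)
      fix t w
      show "norm (g t w) \<le> 2 * B + (\<bar>2 * \<epsilon>\<bar> + q)"
        using D_le[of t w] c_le[of w] unfolding g_def real_norm_def by linarith
    qed
  qed (use lim in auto)
  then have "eventually (\<lambda>t. (\<integral>w. g t w \<partial>?Q) < \<eta>) at_top"
    using \<eta> by (intro order_tendstoD(2)) auto
  moreover have "eventually (\<lambda>t. 0 \<le> t) (at_top :: real filter)"
    by (rule eventually_ge_at_top)
  ultimately have "eventually (\<lambda>t. \<bar>T (s + t) f x - T (s + t) f y\<bar> \<le> 2 * \<epsilon> + (1 - \<alpha>\<^sup>2) * q + \<eta>) at_top"
  proof eventually_elim
    case (elim t)
    have Tb: "bcont (T t f)"
      using elim f by (intro bcont_T)
    have fst_int: "integrable ?Q (\<lambda>w. T t f (fst w))" and snd_int: "integrable ?Q (\<lambda>w. T t f (snd w))"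
      by (rule XY.P.integrable_const_bound[of _ B]; use T_abs_le[OF f B(2)] in auto)+
    have 1: "(\<integral>w. T t f (fst w) \<partial>?Q) = T (s + t) f x"
      using XY.integral_fst'[OF fst_int] elim s by (simp add: T_semigroup[OF _ _ f] T_def[of s])
    have 2: "(\<integral>w. T t f (snd w) \<partial>?Q) = T (s + t) f y"
      using XY.integral_fst'[OF snd_int] elim s by (simp add: T_semigroup[OF _ _ f] T_def[of s])
    have "\<bar>T (s + t) f x - T (s + t) f y\<bar> = \<bar>\<integral>w. T t f (fst w) - T t f (snd w) \<partial>?Q\<bar>"
      using fst_int snd_int by (simp add: 1 2)
    also have "\<dots> \<le> (\<integral>w. D t w \<partial>?Q)"
      unfolding D_def by (rule integral_abs_bound)
    also have "\<dots> \<le> (\<integral>w. c w + g t w \<partial>?Q)"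
      by (intro integral_mono int_D Bochner_Integration.integrable_add int_c int_g) (simp add: g_def)
    also have "\<dots> = (\<integral>w. c w \<partial>?Q) + (\<integral>w. g t w \<partial>?Q)"
      by (intro Bochner_Integration.integral_add int_c int_g)
    also have "(\<integral>w. c w \<partial>?Q) = 2 * \<epsilon> + q - q * measure ?Q ?B"
      unfolding c_def by (subst Bochner_Integration.integral_diff) (auto simp: XY.P.prob_space XY.P.emeasure_eq_measure)
    also have "measure ?Q ?B = measure (P s x) (ball z \<delta>) * measure (P s y) (ball z \<delta>)"
      using Y.emeasure_pair_measure_Times[of "ball z \<delta>" "P s x" "ball z \<delta>"] sets_P
      by (simp add: measure_def enn2real_mult)
    finally have "\<bar>T (s + t) f x - T (s + t) f y\<bar> \<le>
        2 * \<epsilon> + q - q * (measure (P s x) (ball z \<delta>) * measure (P s y) (ball z \<delta>)) + \<eta>"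
      using elim by linarith
    moreover have "q * (\<alpha> * \<alpha>) \<le> q * (measure (P s x) (ball z \<delta>) * measure (P s y) (ball z \<delta>))"
      using s \<alpha> q by (intro mult_left_mono mult_mono) auto
    ultimately show ?case
      by (simp add: power2_eq_square algebra_simps)
  qed
  then show ?thesis
    by (rule eventually_at_top_shift)
qed

text \<open>Iterating the contraction from the trivial bound 2B leaves 2\<epsilon> plus a geometric
  term. \<epsilon> fixes \<delta>, which fixes \<alpha>; the number of iterations is chosen
  last.\<close>

lemma asymptotic_coincidence:
  assumes f: "bcont f"
    and ec: "\<And>\<epsilon>. 0 < \<epsilon> \<Longrightarrow> \<exists>\<delta>>0. \<forall>x\<in>ball z \<delta>. eventually (\<lambda>t. \<bar>T t f x - T t f z\<bar> \<le> \<epsilon>) at_top"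
    and lower: "\<And>r. 0 < r \<Longrightarrow> \<exists>\<alpha>>0. \<forall>x. eventually (\<lambda>t. \<alpha> \<le> measure (P t x) (ball z r)) at_top"
  shows "((\<lambda>t. T t f x - T t f y) \<longlongrightarrow> 0) at_top"
proof (rule tendstoI)
  fix e :: real assume e: "0 < e"
  \<comment> \<open>The final bound is 2\<epsilon> from closeness to z, \<epsilon> for the geometric
    term and \<epsilon> of slack: 4\<epsilon> < e.\<close>
  define \<epsilon> where "\<epsilon> = e / 6"
  have \<epsilon>: "0 < \<epsilon>" using e by (simp add: \<epsilon>_def)
  obtain B where B: "0 < B" "\<And>x. \<bar>f x\<bar> \<le> B"
    using bcontE[OF f] by metis
  obtain \<delta> where \<delta>: "0 < \<delta>" "\<And>x. x \<in> ball z \<delta> \<Longrightarrow> eventually (\<lambda>t. \<bar>T t f x - T t f z\<bar> \<le> \<epsilon>) at_top"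
    using ec[OF \<epsilon>] by auto
  obtain \<alpha> where \<alpha>: "0 < \<alpha>" "\<And>x. eventually (\<lambda>t. \<alpha> \<le> measure (P t x) (ball z \<delta>)) at_top"
    using lower[OF \<delta>(1)] by auto
  have "\<alpha> \<le> 1"
  proof -
    obtain t where "\<alpha> \<le> measure (P t z) (ball z \<delta>)"
      using \<alpha>(2)[of z] by (auto simp: eventually_at_top_linorder)
    also have "\<dots> \<le> 1"
      by (rule prob_space.prob_le_1[OF prob_P])
    finally show ?thesis .
  qed
  then have sq: "0 \<le> 1 - \<alpha>\<^sup>2" "1 - \<alpha>\<^sup>2 < 1"
    using \<alpha>(1) by (auto simp: power_le_one)
  have valid: "eventually (\<lambda>t. \<bar>T t f x - T t f y\<bar> \<le> 2 * \<epsilon> + (1 - \<alpha>\<^sup>2) ^ n * (2 * B) + \<eta>) at_top"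
    if "0 < \<eta>" for n x y \<eta>
    using that
  proof (induction n arbitrary: x y \<eta>)
    case 0
    show ?case
    proof (intro always_eventually allI)
      fix t
      show "\<bar>T t f x - T t f y\<bar> \<le> 2 * \<epsilon> + (1 - \<alpha>\<^sup>2) ^ 0 * (2 * B) + \<eta>"
        using T_abs_le[OF f B(2), of t x] T_abs_le[OF f B(2), of t y] \<epsilon> 0 by simp
    qed
  next
    case (Suc n)
    have "eventually (\<lambda>t. \<bar>T t f x - T t f y\<bar> \<le> 2 * \<epsilon> + (1 - \<alpha>\<^sup>2) * ((1 - \<alpha>\<^sup>2) ^ n * (2 * B)) + \<eta>) at_top"
      by (rule asymptotic_contraction[OF f \<alpha>(1) \<delta>(2) \<alpha>(2)]) (use Suc sq B in auto)
    then show ?case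
      by (simp add: mult.assoc)
  qed
  have "(\<lambda>n. (1 - \<alpha>\<^sup>2) ^ n * (2 * B)) \<longlonglongrightarrow> 0 * (2 * B)"
    using sq by (intro tendsto_mult_right LIMSEQ_power_zero) auto
  then have "eventually (\<lambda>n. (1 - \<alpha>\<^sup>2) ^ n * (2 * B) < \<epsilon>) sequentially"
    using \<epsilon> by (intro order_tendstoD(2)) auto
  then obtain n where n: "(1 - \<alpha>\<^sup>2) ^ n * (2 * B) < \<epsilon>"
    by (auto simp: eventually_sequentially)
  show "eventually (\<lambda>t. dist (T t f x - T t f y) 0 < e) at_top"
    using valid[OF \<epsilon>, of x y n]
  proof eventually_elim
    case (elim t)
    then show ?case
      using n e by (simp add: \<epsilon>_def)
  qed
qed

text \<open>Points near which the process started at z is found with probability bounded below at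
  all late times. If z itself is recurrent, this closed set carries every law \<open>P t z\<close>
  with t \<ge> 0, which makes it the right space for Baire's theorem.\<close>

definition recurrent_set :: "'a \<Rightarrow> 'a set" where
  "recurrent_set z = {y. \<forall>r>0. \<exists>\<alpha>>0. eventually (\<lambda>t. \<alpha> \<le> measure (P t z) (ball y r)) at_top}"

lemma closed_recurrent_set: "closed (recurrent_set z)"
proof -
  have "y \<in> recurrent_set z" if y: "y \<in> closure (recurrent_set z)" for y
    unfolding recurrent_set_def
  proof (intro CollectI allI impI)
    fix r :: real assume "0 < r"
    then obtain y' where y': "y' \<in> recurrent_set z" "dist y' y < r / 2"
      using closure_approachable[THEN iffD1, OF y, rule_format, of "r / 2"] by auto
    obtain \<alpha> where \<alpha>: "0 < \<alpha>" "eventually (\<lambda>t. \<alpha> \<le> measure (P t z) (ball y' (r / 2))) at_top"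
      using y'(1) \<open>0 < r\<close> by (auto simp: recurrent_set_def dest!: spec[of _ "r / 2"])
    have "ball y' (r / 2) \<subseteq> ball y r"
    proof
      fix x assume "x \<in> ball y' (r / 2)"
      then show "x \<in> ball y r"
        using y'(2) dist_triangle[of y x y'] by (simp add: dist_commute)
    qed
    then have "measure (P t z) (ball y' (r / 2)) \<le> measure (P t z) (ball y r)" for t
      using sets_P prob_space.finite_measure[OF prob_P]
      by (intro finite_measure.finite_measure_mono) auto
    then show "\<exists>\<alpha>>0. eventually (\<lambda>t. \<alpha> \<le> measure (P t z) (ball y r)) at_top"
      using \<alpha> by (intro exI[of _ \<alpha>]) (auto elim!: eventually_mono intro: order_trans)
  qed
  then show ?thesis
    by (metis closure_subset closure_closed closed_closure subsetI subset_antisym)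
qed

lemma T_le_measure_pos:
  assumes f: "bcont f" "\<And>x. 0 \<le> f x" "\<And>x. f x \<le> 1"
  shows "T t f x \<le> measure (P t x) {x. 0 < f x}"
proof -
  interpret prob_space "P t x" by (rule prob_P)
  have m: "{x. 0 < f x} \<in> sets (P t x)"
    using bcont_measurable[OF refl f(1)] sets_P by simp
  have "T t f x \<le> (\<integral>y. indicator {x. 0 < f x} y \<partial>P t x)"
    unfolding T_def using m f
    by (intro integral_mono integrable_P integrable_real_indicator) (auto simp: indicator_def emeasure_eq_measure not_less)
  then show ?thesis
    using m by simp
qed

text \<open>Markov's inequality. The lower bound on f is only required almost everywhere because it
  will be available only at recurrent points.\<close>

lemma T_ge_measure_ball:
  assumes f: "bcont f" "\<And>x. 0 \<le> f x" and A: "A \<in> sets borel" "AE x in P t x. x \<in> A \<longrightarrow> c \<le> f x"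
  shows "c * measure (P t x) A \<le> T t f x"
proof -
  interpret prob_space "P t x" by (rule prob_P)
  have "(\<integral>y. c * indicator A y \<partial>P t x) \<le> T t f x"
    unfolding T_def
  proof (rule integral_mono_AE)
    show "AE y in P t x. c * indicator A y \<le> f y"
      using A(2) by eventually_elim (use f(2) in \<open>auto simp: indicator_def\<close>)
    show "integrable (P t x) (\<lambda>y. c * indicator A y)"
      using A(1) sets_P by (intro integrable_mult_right integrable_real_indicator) (auto simp: emeasure_eq_measure)
  qed (intro integrable_P f)
  then show ?thesis
    using A(1) sets_P by simp
qed

text \<open>By the Feller property every point of the support of the law at time t inherits
  the recurrence of the starting point.\<close>

lemma AE_recurrent_set:
  assumes z: "z \<in> recurrent_set z" and t: "0 \<le> t"
  shows "AE u in P t z. u \<in> recurrent_set z"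
proof -
  have "u \<in> recurrent_set z" if pos: "\<And>r. 0 < r \<Longrightarrow> 0 < measure (P t z) (ball u r)" for u
    unfolding recurrent_set_def
  proof (intro CollectI allI impI)
    fix r :: real assume r: "0 < r"
    obtain f :: "'a \<Rightarrow> real" where f: "bcont f" "\<And>x. 0 \<le> f x" "\<And>x. f x \<le> 1" "ball u r = {x. 0 < f x}"
      using open_eq_bcont_pos[of "ball u r"] by (metis open_ball)
    have c: "0 < T t f z"
      using integral_pos_of_measure_pos[OF prob_P sets_P f(1,2)] pos[OF r] by (simp add: T_def f(4))
    \<comment> \<open>Any value strictly between 0 and \<open>T t f z\<close> would do: by the
      Feller property it remains a lower bound for \<open>T t f\<close> on a ball around z, and z is
      recurrent.\<close>
    define c where "c = T t f z / 2"
    have c0: "0 < c" "c < T t f z"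
      using c by (auto simp: c_def)
    have "open {x. c < T t f x}"
      using bcont_cont[OF bcont_T[OF t f(1)]] by (intro open_Collect_less) auto
    then obtain r' where r': "0 < r'" "ball z r' \<subseteq> {x. c < T t f x}"
      using c0 open_contains_ball by (metis mem_Collect_eq)
    obtain \<alpha> where \<alpha>: "0 < \<alpha>" "eventually (\<lambda>s. \<alpha> \<le> measure (P s z) (ball z r')) at_top"
      using z r'(1) by (auto simp: recurrent_set_def)
    have "eventually (\<lambda>s. c * \<alpha> \<le> measure (P (t + s) z) (ball u r)) at_top"
      using \<alpha>(2) eventually_ge_at_top[of 0]
    proof eventually_elim
      case (elim s)
      have "c * \<alpha> \<le> c * measure (P s z) (ball z r')"
        using c0 elim by simp
      also have "\<dots> \<le> T s (T t f) z"
        using r'(2) by (intro T_ge_measure_ball bcont_T t f T_nonneg AE_I2 impI) (auto simp: subset_iff less_imp_le)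
      also have "\<dots> = T (t + s) f z"
        using T_semigroup[OF t elim(2) f(1), of z] by (simp add: add.commute)
      also have "\<dots> \<le> measure (P (t + s) z) (ball u r)"
        using T_le_measure_pos[OF f(1-3)] by (simp add: f(4))
      finally show ?case .
    qed
    then have "eventually (\<lambda>s. c * \<alpha> \<le> measure (P s z) (ball u r)) at_top"
      by (rule eventually_at_top_shift)
    then show "\<exists>\<alpha>>0. eventually (\<lambda>t. \<alpha> \<le> measure (P t z) (ball u r)) at_top"
      using c0 \<alpha>(1) by (intro exI[of _ "c * \<alpha>"]) auto
  qed
  then show ?thesis
    using AE_measure_ball_pos[OF prob_P sets_P, of t z] by (auto elim!: AE_mp)
qed

text \<open>A failure would give times tending to infinity with a large difference for some index at
  each. The gliding hump excludes this for the matrix of differences at those times: its hypothesis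
  on subsums is coincidence for the bounded continuous functions obtained by summing the h_j over
  I.\<close>

lemma uniform_over_humps:
  fixes h :: "nat \<Rightarrow> 'a \<Rightarrow> real"
  assumes h: "\<And>j. bcont (h j)" "\<And>j x. 0 \<le> h j x"
    and sums_cont: "\<And>I. bcont (\<lambda>x. \<Sum>j. indicator I j * h j x)" and summ: "\<And>x. summable (\<lambda>j. h j x)"
    and coincide: "\<And>f. bcont f \<Longrightarrow> ((\<lambda>t. T t f x - T t f z) \<longlongrightarrow> 0) at_top" and \<eta>: "0 < \<eta>"
  shows "\<exists>N::nat. \<forall>t\<ge>real N. \<forall>j. \<bar>T t (h j) x - T t (h j) z\<bar> \<le> \<eta>"
proof (rule ccontr)
  assume "\<not> ?thesis"
  then have "\<forall>N::nat. \<exists>t. real N \<le> t \<and> (\<exists>j. \<eta> < \<bar>T t (h j) x - T t (h j) z\<bar>)"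
    by (metis not_le)
  then obtain t where t: "\<And>N::nat. real N \<le> t N" "\<And>N. \<exists>j. \<eta> < \<bar>T (t N) (h j) x - T (t N) (h j) z\<bar>"
    by metis
  \<comment> \<open>Dominated convergence: the partial sums lie between 0 and the bounded full
    sum.\<close>
  have sums: "(\<lambda>j. indicator I j * T s (h j) y) sums T s (\<lambda>x. \<Sum>j. indicator I j * h j x) y" for I s y
  proof -
    interpret prob_space "P s y" by (rule prob_P)
    note [measurable_cong] = sets_P[of s y]
    note [measurable] = bcont_measurable[OF refl h(1)]
    have S: "summable (\<lambda>j. indicator I j * h j x)" for x
      by (rule summable_comparison_test'[OF summ[of x], of 0]) (use h(2) in \<open>auto simp: indicator_def\<close>)
    obtain B where B: "\<And>x. \<bar>\<Sum>j. indicator I j * h j x\<bar> \<le> B"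
      using bcontE[OF sums_cont[of I]] by metis
    have "(\<lambda>n. \<integral>x. (\<Sum>j<n. indicator I j * h j x) \<partial>P s y) \<longlonglongrightarrow> (\<integral>x. (\<Sum>j. indicator I j * h j x) \<partial>P s y)"
    proof (rule integral_dominated_convergence[where w = "\<lambda>_. B"])
      show "AE x in P s y. (\<lambda>n. \<Sum>j<n. indicator I j * h j x) \<longlonglongrightarrow> (\<Sum>j. indicator I j * h j x)"
        using summable_LIMSEQ[OF S] by simp
      show "AE x in P s y. norm (\<Sum>j<n. indicator I j * h j x) \<le> B" for n
      proof (rule AE_I2)
        fix x
        have "(\<Sum>j<n. indicator I j * h j x) \<le> (\<Sum>j. indicator I j * h j x)"
          using h(2) by (intro sum_le_suminf S) auto
        moreover have "0 \<le> (\<Sum>j<n. indicator I j * h j x)"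
          using h(2) by (intro sum_nonneg) auto
        ultimately show "norm (\<Sum>j<n. indicator I j * h j x) \<le> B"
          using B[of x] by simp
      qed
      show "(\<lambda>x. \<Sum>j. indicator I j * h j x) \<in> borel_measurable (P s y)"
        by (intro bcont_measurable sets_P sums_cont)
    qed auto
    then show ?thesis
      by (simp add: sums_def T_def integrable_P h(1))
  qed
  define b where "b n j = T (t n) (h j) x - T (t n) (h j) z" for n j
  have "\<exists>n. \<forall>j. \<bar>b n j\<bar> \<le> \<eta>"
  proof (rule gliding_hump[OF _ _ \<eta>])
    show "summable (\<lambda>j. \<bar>b n j\<bar>)" for n
    proof (rule summable_comparison_test')
      show "summable (\<lambda>j. T (t n) (h j) x + T (t n) (h j) z)"
        using sums[of UNIV, THEN sums_summable] by (intro summable_add) simp_all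
      show "norm \<bar>b n j\<bar> \<le> T (t n) (h j) x + T (t n) (h j) z" for j
        using T_nonneg[of "h j"] h(2) by (simp add: b_def abs_le_iff add_increasing add_increasing2)
    qed
    show "(\<lambda>n. \<Sum>j. indicator I j * b n j) \<longlonglongrightarrow> 0" for I
    proof -
      let ?f = "\<lambda>x. \<Sum>j. indicator I j * h j x"
      have "(\<lambda>j. indicator I j * b n j) sums (T (t n) ?f x - T (t n) ?f z)" for n
        using sums_diff[OF sums[of I "t n" x] sums[of I "t n" z]] by (simp add: b_def algebra_simps)
      then have "(\<Sum>j. indicator I j * b n j) = T (t n) ?f x - T (t n) ?f z" for n
        by (rule sums_unique[symmetric])
      moreover have "filterlim t at_top sequentially"
        by (rule filterlim_at_top_mono[OF filterlim_real_sequentially]) (simp add: t)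
      then have "(\<lambda>n. T (t n) ?f x - T (t n) ?f z) \<longlonglongrightarrow> 0"
        by (rule filterlim_compose[OF coincide[OF sums_cont]])
      ultimately show ?thesis by simp
    qed
  qed
  then show False
    using t(2) by (auto simp: b_def not_le[symmetric])
qed

end

text \<open>As in Dini's theorem, each tail is dominated by the continuous function g n. If g n is
  small at x it is small near x, so every subseries converges locally uniformly.\<close>

lemma bcont_subseries_telescope:
  fixes g :: "nat \<Rightarrow> 'a::metric_space \<Rightarrow> real"
  assumes g: "\<And>k. bcont (g k)" "\<And>k x. 0 \<le> g k x" "\<And>k x. g (Suc k) x \<le> g k x" "\<And>x. (\<lambda>k. g k x) \<longlonglongrightarrow> 0"
  defines "h \<equiv> \<lambda>k x. g k x - g (Suc k) x"
  shows "summable (\<lambda>k. h k x)" and "bcont (\<lambda>x. \<Sum>k. indicator I k * h k x)"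
proof -
  have h0: "0 \<le> h k x" for k x
    using g(3) by (simp add: h_def)
  have tele: "(\<lambda>k. h (k + n) x) sums g n x" for n x
  proof -
    have "(\<lambda>k. g (k + n) x) \<longlonglongrightarrow> 0"
      using g(4)[of x] by (rule LIMSEQ_ignore_initial_segment)
    from telescope_sums'[OF this] show ?thesis
      by (simp add: h_def)
  qed
  show "summable (\<lambda>k. h k x)" for x
    using sums_summable[OF tele[of 0]] by simp
  define f where "f x = (\<Sum>k. indicator I k * h k x)" for x
  define S where "S n x = (\<Sum>k<n. indicator I k * h k x)" for n x
  have summ: "summable (\<lambda>k. indicator I (k + n) * h (k + n) x)" for n x
    by (rule summable_comparison_test'[OF sums_summable[OF tele[of n x]], of 0])
      (use h0 in \<open>auto simp: indicator_def\<close>)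
  have tail: "\<bar>f x - S n x\<bar> \<le> g n x" for n x
  proof -
    have "f x - S n x = (\<Sum>k. indicator I (k + n) * h (k + n) x)"
      using suminf_split_initial_segment[of "\<lambda>k. indicator I k * h k x" n] summ[of 0 x]
      by (simp add: f_def S_def)
    moreover have "0 \<le> (\<Sum>k. indicator I (k + n) * h (k + n) x)"
      using h0 by (intro suminf_nonneg summ) auto
    moreover have "(\<Sum>k. indicator I (k + n) * h (k + n) x) \<le> (\<Sum>k. h (k + n) x)"
      using h0 by (intro suminf_le summ sums_summable[OF tele]) (auto simp: indicator_def)
    ultimately show ?thesis
      using sums_unique[OF tele[of n x]] by simp
  qed
  have S_cont: "continuous_on UNIV (S n)" for n
    unfolding S_def[abs_def] h_def by (intro bcont_cont bcont_sum bcont_cmult bcont_diff g)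
  have "isCont f x" for x
    unfolding continuous_at_eps_delta
  proof (intro allI impI)
    fix e :: real assume e: "0 < e"
    obtain n where n: "g n x < e / 4"
      using order_tendstoD(2)[OF g(4), of "e / 4" x] e by (auto simp: eventually_sequentially)
    have "open {y. g n y < e / 4} \<and> open {y. dist (S n y) (S n x) < e / 4}"
      using bcont_cont[OF g(1)[of n]] S_cont[of n]
      by (auto intro!: open_Collect_less continuous_intros)
    then have "open ({y. g n y < e / 4} \<inter> {y. dist (S n y) (S n x) < e / 4})"
      by auto
    moreover have "x \<in> {y. g n y < e / 4} \<inter> {y. dist (S n y) (S n x) < e / 4}"
      using n e by simp
    ultimately obtain d where d: "0 < d" "ball x d \<subseteq> {y. g n y < e / 4} \<inter> {y. dist (S n y) (S n x) < e / 4}"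
      using open_contains_ball by meson
    have "dist (f y) (f x) < e" if "dist y x < d" for y
    proof -
      have "g n y < e / 4" "\<bar>S n y - S n x\<bar> < e / 4"
        using d(2) that by (auto simp: subset_iff dist_commute dist_real_def)
      then show ?thesis
        using tail[of y n] tail[of x n] n unfolding dist_real_def by linarith
    qed
    then show "\<exists>d>0. \<forall>y. dist y x < d \<longrightarrow> dist (f y) (f x) < e"
      using d(1) by auto
  qed
  moreover obtain B where B: "\<And>x. \<bar>g 0 x\<bar> \<le> B"
    using bcontE[OF g(1)[of 0]] by metis
  have "\<bar>f x\<bar> \<le> B" for x
    using tail[of x 0] B[of x] by (simp add: S_def)
  ultimately have "bcont f"
    by (intro bcontI[of _ B] continuous_at_imp_continuous_on) auto
  then show "bcont (\<lambda>x. \<Sum>k. indicator I k * h k x)"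
    by (simp add: f_def[abs_def])
qed

section \<open>Countable additivity of the limit functional and the invariant measure\<close>

context feller_semigroup
begin

text \<open>If mass escaped along a sequence decreasing to 0, infinitely many humps h j would each
  carry mass at some time. Coincidence is uniform over the humps and, by Baire, over a ball that
  is visited with a frequency bounded below; hence at one late time many humps would carry a fixed
  amount of mass simultaneously.\<close>

lemma no_escape_of_mass:
  fixes g :: "nat \<Rightarrow> 'a \<Rightarrow> real"
  assumes g: "\<And>k. bcont (g k)" "\<And>k x. 0 \<le> g k x" "\<And>k x. g (Suc k) x \<le> g k x" "\<And>x. (\<lambda>k. g k x) \<longlonglongrightarrow> 0"
    and z: "z \<in> recurrent_set z"
    and coincide: "\<And>f x. bcont f \<Longrightarrow> ((\<lambda>t. T t f x - T t f z) \<longlongrightarrow> 0) at_top"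
    and \<epsilon>: "0 < \<epsilon>"
  shows "\<exists>k. eventually (\<lambda>t. T t (g k) z \<le> \<epsilon>) at_top"
proof (rule ccontr)
  assume "\<not> ?thesis"
  then have freq: "\<exists>t\<ge>r. \<epsilon> < T t (g k) z" for k r
    unfolding eventually_at_top_linorder by (meson not_le)
  have g_mono: "g l x \<le> g k x" if "k \<le> l" for k l x
    by (rule lift_Suc_antimono_le[of "\<lambda>k. g k x", OF g(3) that])
  have T_lim: "(\<lambda>k. T t (g k) z) \<longlonglongrightarrow> 0" for t
  proof -
    obtain B where B: "\<And>x. \<bar>g 0 x\<bar> \<le> B"
      using bcontE[OF g(1)[of 0]] by metis
    have "(\<lambda>k. T t (g k) z) \<longlonglongrightarrow> (\<integral>x. 0 \<partial>P t z)"
      unfolding T_def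
    proof (rule integral_dominated_convergence[where w = "\<lambda>_. B"])
      show "AE x in P t z. norm (g k x) \<le> B" for k
      proof (rule AE_I2)
        fix x
        show "norm (g k x) \<le> B"
          using g_mono[of 0 k x] g(2)[of k x] B[of x] by simp
      qed
    qed (auto intro!: integrable_P g(4) bcont_measurable sets_P g(1))
    then show ?thesis by simp
  qed
  \<comment> \<open>The choice alternates: at time q the function g k still has mass above
    \<epsilon>; then the next index is taken so large that the law at the same q gives it less than
    \<epsilon>/2. The difference therefore keeps more than \<epsilon>/2 at time q.\<close>
  define A where "A n = (\<lambda>(k, q). real n \<le> q \<and> \<epsilon> < T q (g k) z)" for n :: nat
  define R where "R = (\<lambda>(k, q) (k', q'::real). k < k' \<and> T q (g k') z < \<epsilon> / 2)"
  have "\<exists>s. \<forall>n. A n (s n) \<and> R (s n) (s (Suc n))"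
  proof (rule dependent_nat_choice)
    show "\<exists>x. A 0 x"
      using freq[of 0 0] by (auto simp: A_def)
  next
    fix x n assume "A n x"
    obtain k q where x: "x = (k, q)" by (cases x)
    have "eventually (\<lambda>l. T q (g l) z < \<epsilon> / 2 \<and> k < l) sequentially"
      using order_tendstoD(2)[OF T_lim, of "\<epsilon> / 2" q] \<epsilon> by (intro eventually_conj eventually_gt_at_top) auto
    then obtain l where "T q (g l) z < \<epsilon> / 2" "k < l"
      by (auto simp: eventually_sequentially)
    moreover obtain q' where "real (Suc n) \<le> q'" "\<epsilon> < T q' (g l) z"
      using freq by blast
    ultimately show "\<exists>y. A (Suc n) y \<and> R x y"
      by (intro exI[of _ "(l, q')"]) (auto simp: A_def R_def x)
  qed
  then obtain s where s: "\<And>n. A n (s n)" "\<And>n. R (s n) (s (Suc n))"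
    by auto
  define k where "k n = fst (s n)" for n
  define q where "q n = snd (s n)" for n
  have kq: "real n \<le> q n" "\<epsilon> < T (q n) (g (k n)) z" "k n < k (Suc n)" "T (q n) (g (k (Suc n))) z < \<epsilon> / 2" for n
    using s(1)[of n] s(2)[of n] by (auto simp: A_def R_def k_def q_def case_prod_beta)
  have k_mono: "strict_mono k"
    using kq(3) by (simp add: strict_mono_Suc_iff)
  define G where "G n = g (k n)" for n
  define h where "h n x = G n x - G (Suc n) x" for n x
  have G: "bcont (G n)" "0 \<le> G n x" "G (Suc n) x \<le> G n x" "(\<lambda>n. G n x) \<longlonglongrightarrow> 0" for n x
    using g(1,2) g_mono[of "k n" "k (Suc n)" x] kq(3)[of n] LIMSEQ_subseq_LIMSEQ[OF g(4) k_mono, of x]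
    by (auto simp: G_def o_def)
  have h: "bcont (h n)" "0 \<le> h n x" for n x
    unfolding h_def[abs_def] using G(3) by (auto intro!: bcont_diff G(1))
  have h_big: "\<epsilon> / 2 < T (q n) (h n) z" for n
    using kq(2)[of n] kq(4)[of n] by (simp add: h_def[abs_def] T_diff G(1)) (simp add: G_def)
  have unif: "\<exists>N::nat. \<forall>t\<ge>real N. \<forall>j. \<bar>T t (h j) x - T t (h j) z\<bar> \<le> \<epsilon> / 4" for x
  proof (rule uniform_over_humps[OF h _ _ coincide])
    show "bcont (\<lambda>x. \<Sum>j. indicator I j * h j x)" "summable (\<lambda>j. h j x)" for I x
      using bcont_subseries_telescope[of G, OF G] unfolding h_def by auto
  qed (use \<epsilon> in auto)
  \<comment> \<open>The points at which coincidence, already uniform in j, holds from time N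
    on.\<close>
  define F where "F N = {x. \<forall>t\<ge>real N. \<forall>j. \<bar>T t (h j) x - T t (h j) z\<bar> \<le> \<epsilon> / 4}" for N
  have F: "closed (F N)" for N
  proof -
    have "F N = (\<Inter>t\<in>{real N..}. \<Inter>j. {x. \<bar>T t (h j) x - T t (h j) z\<bar> \<le> \<epsilon> / 4})"
      by (auto simp: F_def)
    moreover have "closed {x. \<bar>T t (h j) x - T t (h j) z\<bar> \<le> \<epsilon> / 4}" if "real N \<le> t" for t j
      using that by (intro closed_Collect_le continuous_intros bcont_cont[OF bcont_T] h) auto
    ultimately show ?thesis
      by (simp only:) (intro closed_INT ballI; simp)
  qed
  obtain N w r where w: "w \<in> recurrent_set z" "0 < r" "ball w r \<inter> recurrent_set z \<subseteq> F N"
  proof (rule Baire_closed_cover[of "recurrent_set z" F])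
    show "recurrent_set z \<subseteq> (\<Union>N. F N)"
      using unif by (auto simp: F_def)
  qed (use z in \<open>auto intro: closed_recurrent_set F\<close>)
  obtain \<alpha> where \<alpha>: "0 < \<alpha>" "eventually (\<lambda>t. \<alpha> \<le> measure (P t z) (ball w r)) at_top"
    using w(1,2) by (auto simp: recurrent_set_def)
  \<comment> \<open>At a recurrent point of the ball, waiting for time \<open>q j\<close> yields at
    least \<epsilon>/2 - \<epsilon>/4, since q j \<ge> j \<ge> N lies in the range covered by
    \<open>F N\<close>. The ball is occupied with probability at least \<alpha> at every late time
    s.\<close>
  have late: "eventually (\<lambda>t. \<epsilon> / 4 * \<alpha> \<le> T t (h j) z) at_top" if "N \<le> j" for j
  proof -
    have q: "real N \<le> q j" "0 \<le> q j"
      using kq(1)[of j] that by (auto intro: order_trans[of _ "real j"])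
    have "eventually (\<lambda>s. \<epsilon> / 4 * \<alpha> \<le> T (q j + s) (h j) z) at_top"
      using \<alpha>(2) eventually_ge_at_top[of 0]
    proof eventually_elim
      case (elim s)
      have "\<epsilon> / 4 * \<alpha> \<le> \<epsilon> / 4 * measure (P s z) (ball w r)"
        using \<epsilon> elim by simp
      also have "\<dots> \<le> T s (T (q j) (h j)) z"
      proof (intro T_ge_measure_ball bcont_T q h T_nonneg)
        show "AE x in P s z. x \<in> ball w r \<longrightarrow> \<epsilon> / 4 \<le> T (q j) (h j) x"
          using AE_recurrent_set[OF z elim(2)]
        proof eventually_elim
          case (elim x)
          show ?case
          proof
            assume "x \<in> ball w r"
            then have "x \<in> F N"
              using elim w(3) by auto
            then have "\<bar>T (q j) (h j) x - T (q j) (h j) z\<bar> \<le> \<epsilon> / 4"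
              using q by (auto simp: F_def)
            then show "\<epsilon> / 4 \<le> T (q j) (h j) x"
              using h_big[of j] by linarith
          qed
        qed
      qed simp
      also have "\<dots> = T (q j + s) (h j) z"
        using T_semigroup[OF q(2) elim(2) h(1), where x = z] by (simp add: add.commute)
      finally show ?case .
    qed
    then show ?thesis
      by (rule eventually_at_top_shift)
  qed
  obtain B where B: "\<And>x. \<bar>G 0 x\<bar> \<le> B"
    using bcontE[OF G(1)[of 0]] by metis
  \<comment> \<open>With m humps present at one common time, their total mass exceeds B, although
    the humps telescope to a function bounded by B.\<close>
  obtain m :: nat where m: "B / (\<epsilon> / 4 * \<alpha>) < real m"
    using reals_Archimedean2 by blast
  have "eventually (\<lambda>t. \<forall>j\<in>{N..<N + m}. \<epsilon> / 4 * \<alpha> \<le> T t (h j) z) at_top"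
    using late by (intro eventually_ball_finite) auto
  then obtain t where t: "\<And>j. j \<in> {N..<N + m} \<Longrightarrow> \<epsilon> / 4 * \<alpha> \<le> T t (h j) z"
    unfolding eventually_at_top_linorder by blast
  have "real m * (\<epsilon> / 4 * \<alpha>) = (\<Sum>j\<in>{N..<N + m}. \<epsilon> / 4 * \<alpha>)"
    by simp
  also have "\<dots> \<le> (\<Sum>j\<in>{N..<N + m}. T t (h j) z)"
    by (intro sum_mono t)
  also have "\<dots> \<le> (\<Sum>j<N + m. T t (h j) z)"
    by (intro sum_mono2 T_nonneg h) auto
  also have "\<dots> = T t (\<lambda>x. \<Sum>j<N + m. h j x) z"
    by (intro T_sum[symmetric] h)
  also have "\<dots> \<le> T t (\<lambda>_. B) z"
  proof (intro T_mono bcont_sum h bcont_const)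
    fix x
    have "(\<Sum>j<n. h j x) = G 0 x - G n x" for n
      by (induction n) (auto simp: h_def)
    then show "(\<Sum>j<N + m. h j x) \<le> B"
      using G(2)[of "N + m" x] B[of x] by simp
  qed
  finally have "real m * (\<epsilon> / 4 * \<alpha>) \<le> B"
    by (simp add: T_const)
  then show False
    using m \<epsilon> \<alpha>(1) by (simp add: divide_less_eq)
qed

text \<open>By Tychonoff's theorem the functionals f \<mapsto> \<open>T t f z\<close> have a cluster
  point as t tends to infinity. Expressing it as a limit along one filter, common to all f, lets
  algebraic identities and inequalities pass to L.\<close>

lemma limit_functional_exists:
  obtains L :: "('a \<Rightarrow> real) \<Rightarrow> real" and G :: "real filter"
  where "G \<noteq> bot" "G \<le> at_top" "\<And>f. bcont f \<Longrightarrow> ((\<lambda>t. T t f z) \<longlongrightarrow> L f) G"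
proof -
  define b where "b f = (SOME B. \<forall>x::'a. \<bar>f x\<bar> \<le> B)" for f :: "'a \<Rightarrow> real"
  have b: "\<bar>f x\<bar> \<le> b f" if "bcont f" for f x
  proof -
    have "\<exists>B. \<forall>x. \<bar>f x\<bar> \<le> B"
      using bcontE[OF that] by metis
    then show ?thesis
      unfolding b_def by (rule someI2_ex) auto
  qed
  \<comment> \<open>The product runs over all real functions; those outside the class get the dummy
    value 0, so that every factor in \<open>K\<close> is compact.\<close>
  define E where "E t f = (if bcont f then T t f z else 0)" for t and f :: "'a \<Rightarrow> real"
  define K where "K f = (if bcont f then {- b f .. b f} else {0})" for f :: "'a \<Rightarrow> real"
  have "compactin (product_topology (\<lambda>_. euclidean) UNIV) (PiE UNIV K)"
    by (simp add: compactin_PiE K_def)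
  then have "compact (PiE UNIV K)"
    by (simp add: euclidean_product_topology)
  moreover have "filtermap E at_top \<noteq> bot"
    by (simp add: filtermap_bot_iff)
  moreover have "E t \<in> PiE UNIV K" for t
  proof -
    have "E t f \<in> K f" for f
      using T_abs_le[of f "b f" t z] b[of f] by (auto simp: E_def K_def abs_le_iff)
    then show ?thesis by auto
  qed
  then have "eventually (\<lambda>L. L \<in> PiE UNIV K) (filtermap E at_top)"
    by (simp add: eventually_filtermap)
  ultimately obtain L where L: "inf (nhds L) (filtermap E at_top) \<noteq> bot"
    unfolding compact_filter by blast
  \<comment> \<open>The cluster filter is pulled back to the time axis; it refines
    \<open>at_top\<close>, and along it \<open>E\<close> converges to L.\<close>
  define G where "G = inf (filtercomap E (nhds L)) at_top"
  have "G \<noteq> bot"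
  proof
    assume "G = bot"
    then have "eventually (\<lambda>_. False) G" by simp
    then obtain Q Q' where Q: "eventually Q (filtercomap E (nhds L))" "eventually Q' at_top" "\<And>t. Q t \<Longrightarrow> Q' t \<Longrightarrow> False"
      unfolding G_def eventually_inf by auto
    then obtain Q'' where Q'': "eventually Q'' (nhds L)" "\<And>t. Q'' (E t) \<Longrightarrow> Q t"
      unfolding eventually_filtercomap by auto
    have "eventually (\<lambda>l. \<not> Q'' l) (filtermap E at_top)"
      unfolding eventually_filtermap using Q(2) by eventually_elim (use Q(3) Q''(2) in blast)
    then have "eventually (\<lambda>_. False) (inf (nhds L) (filtermap E at_top))"
      unfolding eventually_inf using Q''(1) by blast
    then show False
      using L by (simp add: trivial_limit_def)
  qed
  moreover have "G \<le> at_top"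
    by (simp add: G_def)
  moreover have "((\<lambda>t. T t f z) \<longlongrightarrow> L f) G" if "bcont f" for f
  proof -
    have "filterlim E (nhds L) G"
      by (rule filterlim_mono[OF filterlim_filtercomap order_refl]) (simp add: G_def)
    then have "((\<lambda>t. E t f) \<longlongrightarrow> L f) G"
      by (rule continuous_on_tendsto_compose[OF continuous_on_product_coordinates[of f]]) auto
    then show ?thesis
      using that by (simp add: E_def)
  qed
  ultimately show thesis
    by (rule that)
qed

theorem invariant_measure_exists:
  assumes z: "z \<in> recurrent_set z"
    and coincide: "\<And>f x. bcont f \<Longrightarrow> ((\<lambda>t. T t f x - T t f z) \<longlongrightarrow> 0) at_top"
  obtains \<mu> where "prob_space \<mu>" "sets \<mu> = sets borel"
    "\<And>f s. bcont f \<Longrightarrow> 0 \<le> s \<Longrightarrow> (\<integral>x. T s f x \<partial>\<mu>) = (\<integral>x. f x \<partial>\<mu>)"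
proof -
  obtain L G where G: "G \<noteq> bot" "G \<le> at_top" and L: "\<And>f. bcont f \<Longrightarrow> ((\<lambda>t. T t f z) \<longlongrightarrow> L f) G"
    using limit_functional_exists[of z] by metis
  have L_eq: "L f = c" if "bcont f" "((\<lambda>t. T t f z) \<longlongrightarrow> c) G" for f c
    using tendsto_unique[OF G(1) L[OF that(1)] that(2)] .
  \<comment> \<open>\<open>T s\<close> and \<open>T t\<close> commute, so T t (T s f) z - T t f z is
    the mean under \<open>P s z\<close> of differences that tend to 0 by coincidence.\<close>
  have L_inv: "L (T s f) = L f" if f: "bcont f" and s: "0 \<le> s" for f s
  proof (rule L_eq[OF bcont_T[OF s f]])
    have "((\<lambda>t. \<integral>u. T t f u - T t f z \<partial>P s z) \<longlongrightarrow> 0) at_top"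
      using f by (intro integral_T_diff_tendsto prob_P sets_P coincide)
    moreover have "eventually (\<lambda>t. (\<integral>u. T t f u - T t f z \<partial>P s z) = T t (T s f) z - T t f z) at_top"
      using eventually_ge_at_top[of 0]
    proof eventually_elim
      case (elim t)
      have "(\<integral>u. T t f u - T t f z \<partial>P s z) = T s (T t f) z - T t f z"
        using T_diff[OF bcont_T[OF elim f] bcont_const, of s "T t f z" z] by (simp add: T_def[of s] T_const)
      also have "T s (T t f) z = T t (T s f) z"
        using T_semigroup[OF s elim f, of z] T_semigroup[OF elim s f, of z] by (simp add: add.commute)
      finally show ?case .
    qed
    ultimately have "((\<lambda>t. T t (T s f) z - T t f z) \<longlongrightarrow> 0) at_top"
      by (rule Lim_transform_eventually)
    then have "((\<lambda>t. T t (T s f) z - T t f z) \<longlongrightarrow> 0) G"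
      by (rule tendsto_mono[OF G(2)])
    from tendsto_add[OF this L[OF f]] show "((\<lambda>t. T t (T s f) z) \<longlongrightarrow> L f) G"
      by simp
  qed
  have L_add: "L (\<lambda>x. f x + g x) = L f + L g" if "bcont f" "bcont g" for f g
    using that by (intro L_eq bcont_add) (auto simp: T_add intro!: tendsto_add L)
  have L_scale: "L (\<lambda>x. c * f x) = c * L f" if "bcont f" for c f
    using that by (intro L_eq bcont_cmult) (auto simp: T_cmult intro!: tendsto_mult L)
  have L_pos: "0 \<le> L f" if "bcont f" "\<And>x. 0 \<le> f x" for f
    using that by (intro tendsto_lowerbound[OF L _ G(1)] always_eventually allI T_nonneg)
  have L_one: "L (\<lambda>x. 1) = 1"
    by (intro L_eq) (auto simp: T_const)
  have L_cont: "(\<lambda>k. L (g k)) \<longlonglongrightarrow> 0"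
    if g: "\<And>k. bcont (g k)" "\<And>k x. 0 \<le> g k x" "\<And>k x. g (Suc k) x \<le> g k x" "\<And>x. (\<lambda>k. g k x) \<longlonglongrightarrow> 0"
    for g :: "nat \<Rightarrow> 'a \<Rightarrow> real"
  proof (rule tendstoI)
    fix e :: real assume e: "0 < e"
    obtain k where "eventually (\<lambda>t. T t (g k) z \<le> e / 2) at_top"
      using no_escape_of_mass[OF g z coincide, of "e / 2"] e by auto
    then have ev: "eventually (\<lambda>t. T t (g k) z \<le> e / 2) G"
      using G(2) by (simp add: le_filter_def)
    have "dist (L (g l)) 0 < e" if "k \<le> l" for l
    proof -
      have le: "g l x \<le> g k x" for x
        by (rule lift_Suc_antimono_le[of "\<lambda>k. g k x", OF g(3) that])
      have "eventually (\<lambda>t. T t (g l) z \<le> e / 2) G"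
        using ev
      proof eventually_elim
        case (elim t)
        then show ?case
          using T_mono[OF g(1) g(1) le, of t z] by linarith
      qed
      then have "L (g l) \<le> e / 2"
        by (rule tendsto_upperbound[OF L[OF g(1)] _ G(1)])
      then show ?thesis
        using L_pos[OF g(1,2), of l] e by simp
    qed
    then show "eventually (\<lambda>l. dist (L (g l)) 0 < e) sequentially"
      by (auto simp: eventually_sequentially)
  qed
  show thesis
  proof (rule daniell_representation[OF L_add L_scale L_pos L_one L_cont])
    fix \<mu> assume \<mu>: "prob_space \<mu>" "sets \<mu> = sets borel" "\<And>f. bcont f \<Longrightarrow> (\<integral>x. f x \<partial>\<mu>) = L f"
    show thesis
      using \<mu> by (intro that[of \<mu>]) (auto simp: L_inv bcont_T)
  qed
qed

text \<open>Coincidence is integrated over the starting point u: under \<mu> the mean of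
  \<open>T t f u\<close> does not depend on t.\<close>

lemma tendsto_invariant:
  assumes \<mu>: "prob_space \<mu>" "sets \<mu> = sets borel"
    and inv: "\<And>s. 0 \<le> s \<Longrightarrow> (\<integral>x. T s f x \<partial>\<mu>) = (\<integral>x. f x \<partial>\<mu>)" and f: "bcont f"
    and coincide: "\<And>u. ((\<lambda>t. T t f u - T t f x) \<longlongrightarrow> 0) at_top"
  shows "((\<lambda>t. T t f x) \<longlongrightarrow> (\<integral>y. f y \<partial>\<mu>)) at_top"
proof -
  interpret prob_space \<mu> by fact
  have "((\<lambda>t. \<integral>u. T t f u - T t f x \<partial>\<mu>) \<longlongrightarrow> 0) at_top"
    by (intro integral_T_diff_tendsto \<mu> f coincide)
  moreover have "eventually (\<lambda>t. (\<integral>u. T t f u - T t f x \<partial>\<mu>) = (\<integral>y. f y \<partial>\<mu>) - T t f x) at_top"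
    using eventually_ge_at_top[of 0]
  proof eventually_elim
    case (elim t)
    show ?case
      using integrable_bcont[OF finite_measure_axioms \<mu>(2) bcont_T[OF elim f]] inv[OF elim]
      by (simp add: prob_space)
  qed
  ultimately have "((\<lambda>t. (\<integral>y. f y \<partial>\<mu>) - T t f x) \<longlongrightarrow> 0) at_top"
    by (rule Lim_transform_eventually)
  from tendsto_diff[OF tendsto_const[of "\<integral>y. f y \<partial>\<mu>"] this] show ?thesis
    by simp
qed

end

section \<open>Wasserstein convergence and weak convergence\<close>

text \<open>This and its converse replace the infimum in the distance by a single coupling of small
  cost. A suitable coupling also rules out the infinite value.\<close>

lemma wasserstein_tendsto_0I:
  assumes p: "1 \<le> p"
    and small: "\<And>\<epsilon>. 0 < \<epsilon> \<Longrightarrow> eventually (\<lambda>t. \<exists>\<pi>\<in>couplings (\<nu> t) \<mu>.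
      (\<integral>\<^sup>+z. ennreal (dist (fst z) (snd z) powr p) \<partial>\<pi>) \<le> ennreal \<epsilon>) F"
  shows "((\<lambda>t. wasserstein p (\<nu> t) \<mu>) \<longlongrightarrow> 0) F"
proof (rule order_tendstoI)
  fix a :: ennreal assume a: "0 < a"
  obtain x where x: "0 < x" "x < a"
    using dense[OF a] by blast
  then obtain b where b: "0 < b" "ennreal b < a"
    by (cases x) auto
  have "0 < b powr p" using b by simp
  from small[OF this] show "eventually (\<lambda>t. wasserstein p (\<nu> t) \<mu> < a) F"
  proof eventually_elim
    case (elim t)
    define c where "c = (INF \<pi>\<in>couplings (\<nu> t) \<mu>. \<integral>\<^sup>+z. ennreal (dist (fst z) (snd z) powr p) \<partial>\<pi>)"
    have "c \<le> ennreal (b powr p)"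
      using elim unfolding c_def by (auto intro: INF_lower2)
    then have c: "c \<noteq> \<infinity>" "enn2real c \<le> b powr p"
      using enn2real_mono[of c "ennreal (b powr p)"] by (auto simp: top_unique)
    have "enn2real c powr (1 / p) \<le> (b powr p) powr (1 / p)"
      using c(2) p by (intro powr_mono2) auto
    also have "\<dots> = b"
      using p b by (simp add: powr_powr)
    finally have "wasserstein p (\<nu> t) \<mu> \<le> ennreal b"
      using c(1) by (simp add: wasserstein_def c_def[symmetric] Let_def ennreal_leI)
    then show ?case
      using b(2) by (rule le_less_trans)
  qed
qed simp

lemma wasserstein_tendsto_0D:
  assumes p: "1 \<le> p" and lim: "((\<lambda>t. wasserstein p (\<nu> t) \<mu>) \<longlongrightarrow> 0) F" and \<epsilon>: "0 < \<epsilon>"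
  shows "eventually (\<lambda>t. \<exists>\<pi>\<in>couplings (\<nu> t) \<mu>.
      (\<integral>\<^sup>+z. ennreal (dist (fst z) (snd z) powr p) \<partial>\<pi>) \<le> ennreal \<epsilon>) F"
proof -
  have "eventually (\<lambda>t. wasserstein p (\<nu> t) \<mu> < ennreal (\<epsilon> powr (1 / p))) F"
    using \<epsilon> by (intro order_tendstoD(2)[OF lim]) simp
  then show ?thesis
  proof eventually_elim
    case (elim t)
    define c where "c = (INF \<pi>\<in>couplings (\<nu> t) \<mu>. \<integral>\<^sup>+z. ennreal (dist (fst z) (snd z) powr p) \<partial>\<pi>)"
    have c: "c \<noteq> \<infinity>" "enn2real c powr (1 / p) < \<epsilon> powr (1 / p)"
      using elim by (auto simp: wasserstein_def c_def[symmetric] Let_def ennreal_less_iff split: if_splits)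
    have "enn2real c < \<epsilon>"
    proof (rule ccontr)
      assume "\<not> enn2real c < \<epsilon>"
      then have "\<epsilon> powr (1 / p) \<le> enn2real c powr (1 / p)"
        using \<epsilon> p by (intro powr_mono2) auto
      then show False using c by simp
    qed
    then have "c < ennreal \<epsilon>"
      using c(1) by (metis enn2real_nonneg ennreal_enn2real ennreal_less_iff infinity_ennreal_def less_top)
    then show ?case
      unfolding c_def INF_less_iff by (auto intro: less_imp_le)
  qed
qed

text \<open>A continuous function need not be uniformly continuous, but the open set of points
  near which it oscillates by more than e at scale 1/n has small mass under the fixed marginal.\<close>

lemma weak_convergence_of_couplings:
  fixes \<nu> :: "'t \<Rightarrow> 'a::polish_space measure"
  assumes \<mu>: "prob_space \<mu>" "sets \<mu> = sets borel" and \<nu>: "\<And>t. prob_space (\<nu> t)" and p: "1 \<le> p"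
    and small: "\<And>\<epsilon>. 0 < \<epsilon> \<Longrightarrow> eventually (\<lambda>t. \<exists>\<pi>\<in>couplings (\<nu> t) \<mu>.
      (\<integral>\<^sup>+z. ennreal (dist (fst z) (snd z) powr p) \<partial>\<pi>) \<le> ennreal \<epsilon>) F"
    and f: "bcont f"
  shows "((\<lambda>t. \<integral>x. f x \<partial>\<nu> t) \<longlongrightarrow> (\<integral>x. f x \<partial>\<mu>)) F"
proof (rule tendstoI)
  fix e :: real assume e: "0 < e"
  interpret M: prob_space \<mu> by fact
  obtain B where B: "0 < B" "\<And>x. \<bar>f x\<bar> \<le> B"
    using bcontE[OF f] by metis
  have fm[measurable]: "f \<in> borel_measurable borel"
    using bcont_measurable[OF refl f] .
  define G where "G n = {v. \<exists>u. dist u v < 1 / real (Suc n) \<and> e / 4 < \<bar>f u - f v\<bar>}" for n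
  have G_open: "open (G n)" for n
  proof -
    have "G n = (\<Union>u. {v. dist u v < 1 / real (Suc n)} \<inter> {v. e / 4 < \<bar>f u - f v\<bar>})"
      by (auto simp: G_def)
    then show ?thesis
      by (auto intro!: open_UN open_Int open_Collect_less continuous_intros bcont_cont[OF f])
  qed
  have "(\<lambda>n. measure \<mu> (G n)) \<longlonglongrightarrow> measure \<mu> (\<Inter>n. G n)"
  proof (rule M.finite_Lim_measure_decseq)
    show "range G \<subseteq> sets \<mu>"
      using G_open \<mu>(2) by auto
    show "decseq G"
    proof (rule decseq_SucI, rule subsetI)
      fix n v assume "v \<in> G (Suc n)"
      then obtain u where u: "dist u v < 1 / real (Suc (Suc n))" "e / 4 < \<bar>f u - f v\<bar>"
        by (auto simp: G_def)
      have "1 / real (Suc (Suc n)) \<le> 1 / real (Suc n)"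
        by (simp add: frac_le)
      then show "v \<in> G n"
        using u unfolding G_def by (intro CollectI exI[of _ u]) simp
    qed
  qed
  moreover have "(\<Inter>n. G n) = {}"
  proof (rule ccontr)
    assume "(\<Inter>n. G n) \<noteq> {}"
    then obtain v where v: "\<And>n. v \<in> G n" by auto
    have "isCont f v"
      using bcont_cont[OF f] by (simp add: continuous_on_eq_continuous_at)
    then obtain d where d: "0 < d" "\<And>u. dist u v < d \<Longrightarrow> dist (f u) (f v) < e / 4"
      unfolding continuous_at_eps_delta using e by (meson divide_pos_pos zero_less_numeral)
    obtain n where n: "1 / real (Suc n) < d"
      using d(1) reals_Archimedean[of d] by (auto simp: inverse_eq_divide)
    obtain u where "dist u v < 1 / real (Suc n)" "e / 4 < \<bar>f u - f v\<bar>"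
      using v[of n] by (auto simp: G_def)
    then show False
      using d(2)[of u] n by (simp add: dist_real_def)
  qed
  ultimately have "(\<lambda>n. measure \<mu> (G n)) \<longlonglongrightarrow> 0"
    by simp
  then have "eventually (\<lambda>n. measure \<mu> (G n) < e / (8 * B)) sequentially"
    using e B by (intro order_tendstoD(2)) auto
  then obtain n where n: "measure \<mu> (G n) < e / (8 * B)"
    by (auto simp: eventually_sequentially)
  define \<delta> where "\<delta> = 1 / real (Suc n)"
  have \<delta>: "0 < \<delta>" by (simp add: \<delta>_def)
  \<comment> \<open>With this cost, Markov's inequality bounds the mass at distance \<delta> or more
    by e/(8B). The two exceptional sets then contribute at most 2B e/(8B) = e/4 each, besides e/4
    off them.\<close>
  have "0 < \<delta> powr p * (e / (8 * B))"
    using \<delta> e B by simp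
  from small[OF this] show "eventually (\<lambda>t. dist (\<integral>x. f x \<partial>\<nu> t) (\<integral>x. f x \<partial>\<mu>) < e) F"
  proof eventually_elim
    case (elim t)
    then obtain \<pi> where \<pi>: "sets \<pi> = sets (borel \<Otimes>\<^sub>M borel)" "distr \<pi> borel fst = \<nu> t" "distr \<pi> borel snd = \<mu>"
      and cost: "(\<integral>\<^sup>+z. ennreal (dist (fst z) (snd z) powr p) \<partial>\<pi>) \<le> ennreal (\<delta> powr p * (e / (8 * B)))"
      by (auto simp: couplings_def)
    note [measurable_cong] = \<pi>(1)
    have sp: "space \<pi> = UNIV"
      using sets_eq_imp_space_eq[OF \<pi>(1)] by (simp add: space_pair_measure)
    interpret prob_space \<pi>
      by (rule prob_space_distrD[of fst \<pi> borel]) (use \<nu>[of t] \<pi>(2) in auto)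
    define A where "A = {z. \<delta> \<le> dist (fst z) (snd z :: 'a)}"
    have [measurable]: "A \<in> sets \<pi>"
    proof -
      have "{z \<in> space \<pi>. \<delta> \<le> dist (fst z) (snd z :: 'a)} \<in> sets \<pi>"
        by measurable
      then show ?thesis by (simp add: A_def sp)
    qed
    \<comment> \<open>The oscillation set is pulled back along the second coordinate, whose law
      \<mu> does not vary with t.\<close>
    define H where "H = (UNIV :: 'a set) \<times> G n"
    have [measurable]: "H \<in> sets \<pi>"
      unfolding H_def \<pi>(1) using G_open by (intro pair_measureI) auto
    have "ennreal (\<delta> powr p) * emeasure \<pi> A = (\<integral>\<^sup>+z. ennreal (\<delta> powr p) * indicator A z \<partial>\<pi>)"
      by (simp add: nn_integral_cmult_indicator)
    also have "\<dots> \<le> (\<integral>\<^sup>+z. ennreal (dist (fst z) (snd z) powr p) \<partial>\<pi>)"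
      using \<delta> p by (intro nn_integral_mono) (auto simp: A_def indicator_def intro!: ennreal_leI powr_mono2)
    also note cost
    finally have "\<delta> powr p * measure \<pi> A \<le> \<delta> powr p * (e / (8 * B))"
      using e B by (simp add: emeasure_eq_measure ennreal_mult[symmetric])
    then have A_le: "measure \<pi> A \<le> e / (8 * B)"
      by (rule mult_left_le_imp_le) (use \<delta> in simp)
    have "measure \<pi> H = measure \<mu> (G n)"
      unfolding \<pi>(3)[symmetric] using G_open[of n]
      by (subst measure_distr) (auto simp: H_def sp snd_vimage_eq_Times)
    then have H_le: "measure \<pi> H < e / (8 * B)"
      using n by simp
    have int_f: "integrable \<pi> (\<lambda>z. f (fst z))" "integrable \<pi> (\<lambda>z. f (snd z))"
      by (rule integrable_const_bound[of _ B]; use B in auto)+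
    have "\<bar>(\<integral>x. f x \<partial>\<nu> t) - (\<integral>x. f x \<partial>\<mu>)\<bar> = \<bar>\<integral>z. f (fst z) - f (snd z) \<partial>\<pi>\<bar>"
      using int_f by (simp add: \<pi>(2,3)[symmetric] integral_distr)
    also have "\<dots> \<le> (\<integral>z. \<bar>f (fst z) - f (snd z)\<bar> \<partial>\<pi>)"
      by (rule integral_abs_bound)
    also have "\<dots> \<le> (\<integral>z. e / 4 + 2 * B * indicator A z + 2 * B * indicator H z \<partial>\<pi>)"
    proof (rule integral_mono)
      show "integrable \<pi> (\<lambda>z. \<bar>f (fst z) - f (snd z)\<bar>)"
        using int_f by auto
      show "integrable \<pi> (\<lambda>z. e / 4 + 2 * B * indicator A z + 2 * B * indicator H z)"
        by (intro Bochner_Integration.integrable_add integrable_mult_right integrable_real_indicator)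
          (auto simp: emeasure_eq_measure)
      fix z :: "'a \<times> 'a"
      have "\<bar>f (fst z) - f (snd z)\<bar> \<le> 2 * B"
        using B(2)[of "fst z"] B(2)[of "snd z"] by linarith
      moreover have "\<bar>f (fst z) - f (snd z)\<bar> \<le> e / 4" if "z \<notin> A" "z \<notin> H"
        using that by (cases z) (force simp: A_def H_def G_def \<delta>_def not_le)
      ultimately show "\<bar>f (fst z) - f (snd z)\<bar> \<le> e / 4 + 2 * B * indicator A z + 2 * B * indicator H z"
        using e B(1) by (auto simp: indicator_def)
    qed
    also have "\<dots> = e / 4 + 2 * B * measure \<pi> A + 2 * B * measure \<pi> H"
      by (subst Bochner_Integration.integral_add; (subst Bochner_Integration.integral_add)?)
        (auto simp: emeasure_eq_measure prob_space)
    also have "\<dots> < e"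
    proof -
      have "2 * B * measure \<pi> A \<le> e / 4" "2 * B * measure \<pi> H \<le> e / 4"
        using A_le H_le B(1) by (auto simp: field_simps)
      then show ?thesis using e by linarith
    qed
    finally show ?case
      by (simp add: dist_real_def)
  qed
qed

text \<open>With \<phi> i = \<theta> i times the product of the earlier 1 - \<theta> l, the partial
  sums telescope to 1 - G n. Density of the centres makes G n vanish eventually at each point, so
  finitely many cells leave less than \<eta> of the mass uncovered.\<close>

lemma bcont_partition:
  fixes \<mu> :: "'a::polish_space measure"
  assumes \<mu>: "prob_space \<mu>" "sets \<mu> = sets borel" and \<delta>: "0 < \<delta>" and \<eta>: "0 < \<eta>"
  obtains m and \<phi> :: "nat \<Rightarrow> 'a \<Rightarrow> real"
  where "\<And>i. bcont (\<phi> i)" "\<And>i x. 0 \<le> \<phi> i x" "\<And>x. (\<Sum>i<m. \<phi> i x) \<le> 1"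
    "\<And>i x y. \<phi> i x \<noteq> 0 \<Longrightarrow> \<phi> i y \<noteq> 0 \<Longrightarrow> dist x y \<le> \<delta>" "1 - \<eta> \<le> (\<Sum>i<m. \<integral>x. \<phi> i x \<partial>\<mu>)"
proof -
  interpret prob_space \<mu> by fact
  obtain D :: "'a set" where D: "countable D" "\<And>X. open X \<Longrightarrow> X \<noteq> {} \<Longrightarrow> \<exists>d\<in>D. d \<in> X"
    using countable_dense_exists by blast
  have "D \<noteq> {}"
    using D(2)[of UNIV] by auto
  define d where "d = from_nat_into D"
  have dense: "\<exists>i. dist x (d i) < r" if r: "0 < r" for x r
  proof -
    obtain y where "y \<in> D" "y \<in> ball x r"
      using D(2)[of "ball x r"] r by auto
    then show ?thesis
      using from_nat_into_surj[OF D(1)] by (auto simp: d_def)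
  qed
  \<comment> \<open>Equal to 1 within \<delta>/4 of the centre and to 0 from distance \<delta>/2 on,
    so two points of one cell are at most \<delta> apart.\<close>
  define \<theta> where "\<theta> i x = max 0 (min 1 (2 - dist x (d i) * 4 / \<delta>))" for i x
  define G where "G n x = (\<Prod>i<n. 1 - \<theta> i x)" for n x
  define \<phi> where "\<phi> i x = \<theta> i x * G i x" for i x
  have \<theta>: "bcont (\<theta> i)" "0 \<le> \<theta> i x" "\<theta> i x \<le> 1" for i x
    unfolding \<theta>_def[abs_def] using \<delta> by (auto intro!: bcontI[of _ 1] continuous_intros)
  have G_bcont: "bcont (G n)" for n
    unfolding G_def[abs_def] by (induction n) (auto intro!: bcont_mult bcont_diff \<theta>)
  have G_bnd: "0 \<le> G n x" "G n x \<le> 1" for n x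
    unfolding G_def using \<theta> by (auto intro!: prod_nonneg prod_le_1)
  have tele: "(\<Sum>i<n. \<phi> i x) = 1 - G n x" for n x
    by (induction n) (auto simp: \<phi>_def G_def algebra_simps)
  have \<phi>_bcont: "bcont (\<phi> i)" for i
    unfolding \<phi>_def[abs_def] by (intro bcont_mult \<theta> G_bcont)
  have "(\<lambda>n. \<integral>x. G n x \<partial>\<mu>) \<longlonglongrightarrow> (\<integral>x. 0 \<partial>\<mu>)"
  proof (rule integral_dominated_convergence[where w = "\<lambda>_. 1"])
    show "AE x in \<mu>. (\<lambda>n. G n x) \<longlonglongrightarrow> 0"
    proof (rule AE_I2)
      fix x
      obtain i where i: "dist x (d i) < \<delta> / 4"
        using dense[of "\<delta> / 4" x] \<delta> by auto
      then have "dist x (d i) * 4 / \<delta> \<le> 1"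
        using \<delta> by (simp add: divide_le_eq)
      then have "\<theta> i x = 1"
        by (simp add: \<theta>_def)
      then have "G n x = 0" if "i < n" for n
        using that by (auto simp: G_def intro!: prod_zero)
      then have "eventually (\<lambda>n. G n x = 0) sequentially"
        by (rule eventually_mono[OF eventually_gt_at_top[of i]])
      then show "(\<lambda>n. G n x) \<longlonglongrightarrow> 0"
        by (rule tendsto_eventually)
    qed
  qed (use G_bnd in \<open>auto intro!: bcont_measurable \<mu> G_bcont\<close>)
  then have "eventually (\<lambda>n. (\<integral>x. G n x \<partial>\<mu>) < \<eta>) sequentially"
    using \<eta> by (intro order_tendstoD(2)) auto
  then obtain m where m: "(\<integral>x. G m x \<partial>\<mu>) < \<eta>"
    by (auto simp: eventually_sequentially)
  have "(\<Sum>i<m. \<integral>x. \<phi> i x \<partial>\<mu>) = (\<integral>x. 1 - G m x \<partial>\<mu>)"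
    unfolding tele[symmetric]
    by (intro Bochner_Integration.integral_sum[symmetric] integrable_bcont \<mu> finite_measure_axioms \<phi>_bcont)
  also have "\<dots> = 1 - (\<integral>x. G m x \<partial>\<mu>)"
    using integrable_bcont[OF finite_measure_axioms \<mu>(2) G_bcont] by (simp add: prob_space)
  finally have mass: "1 - \<eta> \<le> (\<Sum>i<m. \<integral>x. \<phi> i x \<partial>\<mu>)"
    using m by simp
  have near: "dist x (d i) < \<delta> / 2" if "\<phi> i x \<noteq> 0" for i x
  proof -
    have "\<theta> i x \<noteq> 0" using that by (auto simp: \<phi>_def)
    then have "dist x (d i) * 4 / \<delta> < 2"
      by (auto simp: \<theta>_def max_def min_def split: if_splits)
    then show ?thesis
      using \<delta> by (simp add: divide_less_eq)
  qed
  show thesis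
  proof (rule that[of \<phi> m])
    show "dist x y \<le> \<delta>" if "\<phi> i x \<noteq> 0" "\<phi> i y \<noteq> 0" for i x y
      using near[OF that(1)] near[OF that(2)] dist_triangle2[of x y "d i"] by linarith
    show "0 \<le> \<phi> i x" for i x
      using \<theta> G_bnd by (simp add: \<phi>_def)
    show "(\<Sum>i<m. \<phi> i x) \<le> 1" for x
      using G_bnd[of m x] by (simp add: tele)
  qed (use mass \<phi>_bcont in auto)
qed

lemma dist_powr_le:
  fixes x0 :: "'a::metric_space"
  assumes p: "1 \<le> p"
  shows "dist u v powr p \<le> 2 powr p * (dist x0 u powr p + dist x0 v powr p)"
proof -
  let ?m = "max (dist x0 u) (dist x0 v)"
  have "dist u v \<le> 2 * ?m"
    using dist_triangle3[of u v x0] by linarith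
  then have "dist u v powr p \<le> (2 * ?m) powr p"
    using p by (intro powr_mono2) auto
  also have "\<dots> = 2 powr p * ?m powr p"
    by (rule powr_mult)
  also have "\<dots> \<le> 2 powr p * (dist x0 u powr p + dist x0 v powr p)"
    by (intro mult_left_mono) (auto simp: max_def)
  finally show ?thesis .
qed

lemma continuous_on_dist_powr:
  assumes "1 \<le> p"
  shows "continuous_on UNIV (\<lambda>x. dist x0 x powr p)"
  by (rule continuous_on_powr') (use assms in \<open>auto intro!: continuous_intros\<close>)

text \<open>Weak convergence tested on finitely many cells gives \<nu> t nearly the mass of \<mu> in
  each, so most mass moves within cells. The rest is controlled by a cut-off of the cost and by the
  tails of both measures.\<close>

theorem wasserstein_tendsto_0_of_weak:
  fixes \<nu> :: "real \<Rightarrow> 'a::polish_space measure"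
  assumes \<mu>: "prob_space \<mu>" "sets \<mu> = sets borel" and \<nu>: "\<And>t. prob_space (\<nu> t)" "\<And>t. sets (\<nu> t) = sets borel"
    and p: "1 \<le> p"
    and weak: "\<And>f. bcont f \<Longrightarrow> ((\<lambda>t. \<integral>x. f x \<partial>\<nu> t) \<longlongrightarrow> (\<integral>x. f x \<partial>\<mu>)) at_top"
    and tails: "((\<lambda>K. SUP t\<in>{0..}. \<integral>\<^sup>+x. ennreal (dist x0 x powr p * indicator {x. K \<le> dist x0 x powr p} x) \<partial>\<nu> t) \<longlongrightarrow> 0) at_top"
  shows "((\<lambda>t. wasserstein p (\<nu> t) \<mu>) \<longlongrightarrow> 0) at_top"
proof (rule wasserstein_tendsto_0I[OF p])
  fix e :: real assume e: "0 < e"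
  define V where "V x = dist x0 x powr p" for x
  have V_cont: "continuous_on UNIV V"
    unfolding V_def[abs_def] by (rule continuous_on_dist_powr[OF p])
  have V_meas[measurable]: "V \<in> borel_measurable borel"
    by (rule borel_measurable_continuous_onI[OF V_cont])
  have V_nonneg: "0 \<le> V x" for x
    by (simp add: V_def)
  define c :: real where "c = 2 powr p"
  have c: "0 < c" by (simp add: c_def)
  \<comment> \<open>Budget: e/4 for moves within cells, e/4 for the cut-off remainder, and c (e1 + 2
    e1) = e/4 for the two tails.\<close>
  define e1 where "e1 = e / (12 * c)"
  have e1: "0 < e1" using e c by (simp add: e1_def)
  let ?tail = "\<lambda>\<rho> K. \<integral>\<^sup>+x. ennreal (V x * indicator {x. K \<le> V x} x) \<partial>\<rho>"
  have "eventually (\<lambda>K. (SUP t\<in>{0..}. ?tail (\<nu> t) K) < ennreal e1 \<and> 0 \<le> K) at_top"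
    using e1 tails unfolding V_def[symmetric] by (intro eventually_conj order_tendstoD(2) eventually_ge_at_top) auto
  then obtain K where K: "(SUP t\<in>{0..}. ?tail (\<nu> t) K) < ennreal e1" "0 \<le> K"
    by (auto simp: eventually_at_top_linorder)
  have tail_\<nu>: "?tail (\<nu> t) K \<le> ennreal e1" if "0 \<le> t" for t
    using K(1) that by (intro order_trans[OF SUP_upper less_imp_le]) auto
  have tail_\<nu>2: "?tail (\<nu> t) (2 * K) \<le> ennreal e1" if "0 \<le> t" for t
    using K(2) V_nonneg by (intro order_trans[OF nn_integral_mono tail_\<nu>[OF that]] ennreal_leI)
      (auto simp: indicator_def)
  \<comment> \<open>The tail integrand is neither continuous nor bounded. The truncated excess over
    K is both, so its bound passes to the weak limit; monotone convergence then removes the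
    truncation.\<close>
  have excess: "(\<integral>\<^sup>+x. ennreal (max 0 (V x - K)) \<partial>\<mu>) \<le> ennreal e1"
  proof -
    define f where "f n x = min (real n) (max 0 (V x - K))" for n x
    have f: "bcont (f n)" for n
      unfolding f_def[abs_def] using V_cont by (intro bcontI[of _ "real n"] continuous_intros) auto
    note [measurable_cong] = \<mu>(2) and [measurable] = bcont_measurable[OF refl f]
    have "(\<lambda>n. \<integral>\<^sup>+x. ennreal (f n x) \<partial>\<mu>) \<longlonglongrightarrow> (\<integral>\<^sup>+x. ennreal (max 0 (V x - K)) \<partial>\<mu>)"
    proof (rule nn_integral_LIMSEQ)
      show "incseq (\<lambda>n x. ennreal (f n x))"
        by (auto simp: incseq_def le_fun_def f_def intro!: ennreal_leI)
      fix x
      obtain N where N: "max 0 (V x - K) \<le> real N"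
        using real_arch_simple by blast
      have "eventually (\<lambda>n. ennreal (f n x) = ennreal (max 0 (V x - K))) sequentially"
        using eventually_ge_at_top[of N]
      proof eventually_elim
        case (elim n)
        then have "max 0 (V x - K) \<le> real n"
          using N by linarith
        then show ?case by (simp add: f_def)
      qed
      then show "(\<lambda>n. ennreal (f n x)) \<longlonglongrightarrow> ennreal (max 0 (V x - K))"
        by (rule tendsto_eventually)
    qed simp
    moreover have "(\<integral>\<^sup>+x. ennreal (f n x) \<partial>\<mu>) \<le> ennreal e1" for n
    proof -
      have nn: "(\<integral>\<^sup>+x. ennreal (f n x) \<partial>\<rho>) = ennreal (\<integral>x. f n x \<partial>\<rho>)" if "prob_space \<rho>" "sets \<rho> = sets borel" for \<rho>
        using that by (intro nn_integral_eq_integral integrable_bcont prob_space.finite_measure f) (auto simp: f_def)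
      have "eventually (\<lambda>t. (\<integral>x. f n x \<partial>\<nu> t) \<le> e1) at_top"
        using eventually_ge_at_top[of 0]
      proof eventually_elim
        case (elim t)
        have "ennreal (\<integral>x. f n x \<partial>\<nu> t) \<le> ?tail (\<nu> t) K"
          unfolding nn[OF \<nu>, symmetric] using K(2)
          by (intro nn_integral_mono ennreal_leI) (auto simp: f_def indicator_def)
        also have "\<dots> \<le> ennreal e1"
          by (rule tail_\<nu>[OF elim])
        finally show ?case
          using e1 by (simp add: ennreal_le_iff)
      qed
      then have "(\<integral>x. f n x \<partial>\<mu>) \<le> e1"
        by (rule tendsto_upperbound[OF weak[OF f]]) simp
      then show ?thesis
        unfolding nn[OF \<mu>] by (rule ennreal_leI)
    qed
    ultimately show ?thesis
      by (intro LIMSEQ_le_const2) auto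
  qed
  \<comment> \<open>V \<le> 2 (V - K) wherever V \<ge> 2K, which is the reason for doubling the
    threshold.\<close>
  have tail_\<mu>: "?tail \<mu> (2 * K) \<le> ennreal (2 * e1)"
  proof -
    note [measurable_cong] = \<mu>(2)
    have "?tail \<mu> (2 * K) \<le> (\<integral>\<^sup>+x. 2 * ennreal (max 0 (V x - K)) \<partial>\<mu>)"
    proof (rule nn_integral_mono)
      fix x
      have "ennreal (V x * indicator {x. 2 * K \<le> V x} x) \<le> ennreal (2 * max 0 (V x - K))"
        using K(2) by (intro ennreal_leI) (auto simp: indicator_def)
      then show "ennreal (V x * indicator {x. 2 * K \<le> V x} x) \<le> 2 * ennreal (max 0 (V x - K))"
        by (simp add: ennreal_mult)
    qed
    also have "\<dots> = 2 * (\<integral>\<^sup>+x. ennreal (max 0 (V x - K)) \<partial>\<mu>)"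
      by (rule nn_integral_cmult) measurable
    also have "\<dots> \<le> 2 * ennreal e1"
      by (intro mult_left_mono excess) simp
    finally show ?thesis
      using e1 by (simp add: ennreal_mult)
  qed
  \<comment> \<open>Since \<eta> \<le> 2 \<eta>0, the constant 32 makes 2 (2K \<eta>) at most
    e/(4c); K + 1 in place of K keeps the denominator positive.\<close>
  define \<eta>0 where "\<eta>0 = min (1 / 2) (e / (32 * c * (K + 1)))"
  have \<eta>0: "0 < \<eta>0" "\<eta>0 < 1"
    using e c K(2) by (auto simp: \<eta>0_def)
  define \<delta> where "\<delta> = (e / 4) powr (1 / p)"
  have \<delta>: "0 < \<delta>" "\<delta> powr p = e / 4"
    using e p by (auto simp: \<delta>_def powr_powr)
  obtain m and \<phi> :: "nat \<Rightarrow> 'a \<Rightarrow> real"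
    where \<phi>: "\<And>i. bcont (\<phi> i)" "\<And>i x. 0 \<le> \<phi> i x" "\<And>x. (\<Sum>i<m. \<phi> i x) \<le> 1"
      "\<And>i x y. \<phi> i x \<noteq> 0 \<Longrightarrow> \<phi> i y \<noteq> 0 \<Longrightarrow> dist x y \<le> \<delta>" "1 - \<eta>0 \<le> (\<Sum>i<m. \<integral>x. \<phi> i x \<partial>\<mu>)"
    by (rule bcont_partition[OF \<mu> \<delta>(1) \<eta>0(1)]) (rule that)
  \<comment> \<open>Cells of \<mu>-mass 0 are dropped: positive mass makes (1 - \<eta>0) times the
    mass strictly smaller than the mass, so weak convergence gives the comparison at late
    times.\<close>
  define J where "J = {i. i < m \<and> 0 < (\<integral>x. \<phi> i x \<partial>\<mu>)}"
  have J: "finite J" "J \<subseteq> {..<m}"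
    by (auto simp: J_def)
  define \<eta> where "\<eta> = 1 - (1 - \<eta>0) * (\<Sum>i\<in>J. \<integral>x. \<phi> i x \<partial>\<mu>)"
  have int_nonneg: "0 \<le> (\<integral>x. \<phi> i x \<partial>\<mu>)" for i
    using \<phi>(2) by simp
  have "(\<Sum>i\<in>J. \<integral>x. \<phi> i x \<partial>\<mu>) = (\<Sum>i<m. \<integral>x. \<phi> i x \<partial>\<mu>)"
  proof (rule sum.mono_neutral_left)
    show "\<forall>i\<in>{..<m} - J. (\<integral>x. \<phi> i x \<partial>\<mu>) = 0"
      using int_nonneg by (auto simp: J_def intro: antisym)
  qed (use J in auto)
  then have "(1 - \<eta>0) * (1 - \<eta>0) \<le> (1 - \<eta>0) * (\<Sum>i\<in>J. \<integral>x. \<phi> i x \<partial>\<mu>)"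
    using \<phi>(5) \<eta>0 by (intro mult_left_mono) auto
  moreover have "1 - 2 * \<eta>0 \<le> (1 - \<eta>0) * (1 - \<eta>0)"
    by (simp add: algebra_simps)
  ultimately have \<eta>_le: "\<eta> \<le> 2 * \<eta>0"
    unfolding \<eta>_def by linarith
  have K_\<eta>: "2 * (2 * K * \<eta>) \<le> e / (4 * c)"
  proof -
    have "2 * (2 * K * \<eta>) \<le> 2 * (2 * K * (2 * \<eta>0))"
      using \<eta>_le K(2) by (intro mult_left_mono) auto
    also have "\<dots> \<le> 2 * (2 * (K + 1) * (2 * (e / (32 * c * (K + 1)))))"
      using K(2) \<eta>0 by (intro mult_left_mono mult_mono) (auto simp: \<eta>0_def)
    also have "\<dots> = e / (4 * c)"
    proof -
      have "K + 1 \<noteq> 0" using K(2) by linarith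
      then show ?thesis using c by (simp add: divide_simps)
    qed
    finally show ?thesis .
  qed
  have "eventually (\<lambda>t. \<forall>i\<in>J. (1 - \<eta>0) * (\<integral>x. \<phi> i x \<partial>\<mu>) < (\<integral>x. \<phi> i x \<partial>\<nu> t)) at_top"
  proof (intro eventually_ball_finite J ballI order_tendstoD(1)[OF weak[OF \<phi>(1)]])
    fix i assume "i \<in> J"
    then show "(1 - \<eta>0) * (\<integral>x. \<phi> i x \<partial>\<mu>) < (\<integral>x. \<phi> i x \<partial>\<mu>)"
      using \<eta>0 by (simp add: J_def)
  qed
  then show "eventually (\<lambda>t. \<exists>\<pi>\<in>couplings (\<nu> t) \<mu>.
      (\<integral>\<^sup>+z. ennreal (dist (fst z) (snd z) powr p) \<partial>\<pi>) \<le> ennreal e) at_top"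
    using eventually_ge_at_top[of 0]
  proof eventually_elim
    case (elim t)
    have "\<exists>\<pi>\<in>couplings (\<nu> t) \<mu>. (\<integral>\<^sup>+z. ennreal (dist (fst z) (snd z) powr p) \<partial>\<pi>) \<le>
      ennreal (\<delta> powr p) + ennreal c * (2 * ennreal (2 * K * \<eta>) + ?tail (\<nu> t) (2 * K) + ?tail \<mu> (2 * K))"
    proof (rule coupling_of_partition[OF \<nu>(1,2) \<mu> J(1), of \<phi> \<delta> \<eta>0])
      show "(\<Sum>i\<in>J. \<phi> i x) \<le> 1" for x
        using sum_mono2[OF _ J(2), of "\<lambda>i. \<phi> i x"] \<phi>(2) \<phi>(3)[of x] by fastforce
      show "dist x y powr p \<le> c * (V x + V y)" for x y
        unfolding c_def V_def by (rule dist_powr_le[OF p])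
      show "(1 - \<eta>0) * (\<integral>x. \<phi> i x \<partial>\<mu>) \<le> (\<integral>x. \<phi> i x \<partial>\<nu> t)" if "i \<in> J" for i
        using elim that by (auto intro: less_imp_le)
    qed (use \<phi> \<eta>0 p c K V_nonneg V_meas in \<open>auto simp: J_def \<eta>_def\<close>)
    then obtain \<pi> where \<pi>: "\<pi> \<in> couplings (\<nu> t) \<mu>" and cost: "(\<integral>\<^sup>+z. ennreal (dist (fst z) (snd z) powr p) \<partial>\<pi>) \<le>
      ennreal (\<delta> powr p) + ennreal c * (2 * ennreal (2 * K * \<eta>) + ?tail (\<nu> t) (2 * K) + ?tail \<mu> (2 * K))"
      by blast
    note cost
    also have "ennreal (\<delta> powr p) + ennreal c * (2 * ennreal (2 * K * \<eta>) + ?tail (\<nu> t) (2 * K) + ?tail \<mu> (2 * K)) \<le>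
      ennreal (e / 4) + ennreal c * (ennreal (e / (4 * c)) + ennreal e1 + ennreal (2 * e1))"
    proof (intro add_mono mult_left_mono tail_\<nu>2 tail_\<mu> elim)
      have "2 * ennreal (2 * K * \<eta>) = ennreal (2 * (2 * K * \<eta>))"
        by (simp only: ennreal_mult'[of 2 "2 * K * \<eta>"] ennreal_numeral zero_le_numeral)
      also have "\<dots> \<le> ennreal (e / (4 * c))"
        by (rule ennreal_leI[OF K_\<eta>])
      finally show "2 * ennreal (2 * K * \<eta>) \<le> ennreal (e / (4 * c))" .
    qed (auto simp: \<delta>)
    also have "\<dots> = ennreal (e / 4 + c * (e / (4 * c) + e1 + 2 * e1))"
    proof -
      have "0 \<le> e / 4" "0 \<le> c" "0 \<le> e / (4 * c)" "0 \<le> e1" "0 \<le> 2 * e1"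
        using e e1 c by auto
      then show ?thesis
        by (simp only: ennreal_plus ennreal_mult add_nonneg_nonneg mult_nonneg_nonneg)
    qed
    also have "\<dots> \<le> ennreal e"
      using c e by (intro ennreal_leI) (simp add: e1_def field_simps)
    finally show ?case
      using \<pi> by blast
  qed
qed

section \<open>The Markov process\<close>

context feller_semigroup
begin

lemma integral_bind_bcont:
  assumes \<mu>: "prob_space \<mu>" "sets \<mu> = sets borel" and f: "bcont f" and t: "0 \<le> t"
  shows "(\<integral>x. f x \<partial>(\<mu> \<bind> P t)) = (\<integral>x. T t f x \<partial>\<mu>)"
proof -
  interpret M: prob_space \<mu> by fact
  have P_meas: "P t \<in> measurable \<mu> (subprob_algebra borel)"
    unfolding measurable_cong_sets[OF \<mu>(2) refl] by (intro kernel_measurable prob_P sets_P emeasure_P_measurable)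
  interpret N: prob_space "\<mu> \<bind> P t"
    by (rule M.prob_space_bind[OF _ P_meas]) (simp add: prob_P)
  have sets_N: "sets (\<mu> \<bind> P t) = sets borel"
    using P_meas by (intro sets_bind) (auto simp: sets_P M.not_empty)
  have nonneg: "(\<integral>x. g x \<partial>(\<mu> \<bind> P t)) = (\<integral>x. T t g x \<partial>\<mu>)" if g: "bcont g" "\<And>x. 0 \<le> g x" for g
  proof -
    have "ennreal (\<integral>x. g x \<partial>(\<mu> \<bind> P t)) = (\<integral>\<^sup>+x. ennreal (g x) \<partial>(\<mu> \<bind> P t))"
      using g(2) by (intro nn_integral_eq_integral[symmetric] integrable_bcont N.finite_measure_axioms sets_N g) auto
    also have "\<dots> = (\<integral>\<^sup>+x. \<integral>\<^sup>+y. ennreal (g y) \<partial>P t x \<partial>\<mu>)"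
      using bcont_measurable[OF refl g(1)] by (intro nn_integral_bind[OF _ P_meas]) auto
    also have "\<dots> = (\<integral>\<^sup>+x. ennreal (T t g x) \<partial>\<mu>)"
      unfolding T_def using g by (intro nn_integral_cong nn_integral_eq_integral integrable_P) auto
    also have "\<dots> = ennreal (\<integral>x. T t g x \<partial>\<mu>)"
      using T_nonneg[of g] g t
      by (intro nn_integral_eq_integral integrable_bcont M.finite_measure_axioms \<mu> bcont_T) auto
    finally show ?thesis
      using g(2) T_nonneg[of g t] by (subst (asm) ennreal_inj) auto
  qed
  obtain B where B: "\<And>x. \<bar>f x\<bar> \<le> B"
    using bcontE[OF f] by metis
  have "(\<integral>x. f x + B \<partial>(\<mu> \<bind> P t)) = (\<integral>x. T t (\<lambda>x. f x + B) x \<partial>\<mu>)"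
  proof (intro nonneg bcont_add f bcont_const)
    show "0 \<le> f x + B" for x
      using B[of x] by linarith
  qed
  then show ?thesis
    using integrable_bcont[OF N.finite_measure_axioms sets_N f]
      integrable_bcont[OF M.finite_measure_axioms \<mu>(2) bcont_T[OF t f]]
    by (simp add: T_add f T_const N.prob_space M.prob_space)
qed

text \<open>Both sides express \<open>\<mu> \<bind> P t = \<mu>\<close>, one on Borel sets and the
  other on a class of functions that determines measures.\<close>

lemma invariant_iff_integral:
  assumes \<mu>: "prob_space \<mu>" "sets \<mu> = sets borel" and t: "0 \<le> t"
  shows "(\<forall>A\<in>sets borel. (\<integral>\<^sup>+x. emeasure (P t x) A \<partial>\<mu>) = emeasure \<mu> A) \<longleftrightarrow>
    (\<forall>f. bcont f \<longrightarrow> (\<integral>x. T t f x \<partial>\<mu>) = (\<integral>x. f x \<partial>\<mu>))" (is "?L \<longleftrightarrow> ?R")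
proof -
  interpret M: prob_space \<mu> by fact
  have P_meas: "P t \<in> measurable \<mu> (subprob_algebra borel)"
    unfolding measurable_cong_sets[OF \<mu>(2) refl] by (intro kernel_measurable prob_P sets_P emeasure_P_measurable)
  have prob_N: "prob_space (\<mu> \<bind> P t)"
    by (rule M.prob_space_bind[OF _ P_meas]) (simp add: prob_P)
  have sets_N: "sets (\<mu> \<bind> P t) = sets borel"
    using P_meas by (intro sets_bind) (auto simp: sets_P M.not_empty)
  have em: "emeasure (\<mu> \<bind> P t) A = (\<integral>\<^sup>+x. emeasure (P t x) A \<partial>\<mu>)" if "A \<in> sets borel" for A
    using that by (intro emeasure_bind[OF _ P_meas]) (auto simp: M.not_empty)
  have "?L \<longleftrightarrow> \<mu> \<bind> P t = \<mu>"
    using em by (auto intro!: measure_eqI simp: sets_N \<mu>(2))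
  also have "\<dots> \<longleftrightarrow> ?R"
  proof
    show "?R" if "\<mu> \<bind> P t = \<mu>"
      using integral_bind_bcont[OF \<mu> _ t] that by simp
    show "\<mu> \<bind> P t = \<mu>" if "?R"
      using integral_bind_bcont[OF \<mu> _ t] that by (intro measure_eqI_bcont prob_N sets_N \<mu>) auto
  qed
  finally show ?thesis .
qed

end

section \<open>From the process to its transition semigroup\<close>

lemma prob_kernel: "markov_process M Phi \<Longrightarrow> prob_space (kernel M Phi t x)"
  unfolding kernel_def by (intro prob_space.prob_space_distr) (auto simp: markov_process_def)

lemma sets_kernel_borel: "sets (kernel M Phi t x) = sets borel"
  by (simp add: kernel_def)

text \<open>The expectation of the Markov property: integrating the conditional expectation removes
  the conditioning.\<close>

lemma kernel_chapman_kolmogorov: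
  fixes f :: "'a::polish_space \<Rightarrow> real"
  assumes markov: "markov_process M Phi" and st: "0 \<le> s" "0 \<le> t"
    and f: "f \<in> borel_measurable borel" "bounded (range f)"
  shows "(\<integral>y. f y \<partial>kernel M Phi (t + s) x) = (\<integral>u. (\<integral>y. f y \<partial>kernel M Phi s u) \<partial>kernel M Phi t x)"
proof -
  have "prob_space (M x)"
    using markov by (simp add: markov_process_def)
  then interpret prob_space "M x" .
  have Phi[measurable]: "Phi r \<in> measurable (M x) borel" for r
    using markov by (simp add: markov_process_def)
  have meas: "(\<lambda>x. emeasure (kernel M Phi s x) A) \<in> borel_measurable borel" if "A \<in> sets borel" for A
    using markov that by (simp add: markov_process_def)
  note f(1)[measurable]
  let ?F = "natural_filtration (M x) Phi t"
  have gen: "{Phi s -` A \<inter> space (M x) | s A. 0 \<le> s \<and> s \<le> t \<and> A \<in> sets borel} \<subseteq> sets (M x)"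
    using measurable_sets[OF Phi] by auto
  have "subalgebra (M x) ?F"
    using sets.sigma_sets_subset[OF gen] sets.sets_into_space gen
    by (auto simp: subalgebra_def natural_filtration_def space_measure_of_conv sets_measure_of_conv)
  then interpret finite_measure_subalgebra "M x" ?F
    by unfold_locales
  have [measurable]: "(\<lambda>u. \<integral>y. f y \<partial>kernel M Phi s u) \<in> borel_measurable borel"
    by (intro kernel_integral_measurable prob_kernel[OF markov] sets_kernel_borel f meas)
  obtain B where B: "\<And>x. \<bar>f x\<bar> \<le> B"
    using f(2) by (auto simp: bounded_iff)
  have int: "integrable (M x) (\<lambda>\<omega>. f (Phi (t + s) \<omega>))"
    by (rule integrable_const_bound[of _ B]) (use B in auto)
  have "(\<integral>y. f y \<partial>kernel M Phi (t + s) x) = (\<integral>\<omega>. f (Phi (t + s) \<omega>) \<partial>M x)"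
    unfolding kernel_def by (intro integral_distr) auto
  also have "\<dots> = (\<integral>\<omega>. real_cond_exp (M x) ?F (\<lambda>\<omega>. f (Phi (t + s) \<omega>)) \<omega> \<partial>M x)"
    by (rule real_cond_exp_int(2)[OF int, symmetric])
  also have "\<dots> = (\<integral>\<omega>. (\<integral>y. f y \<partial>kernel M Phi s (Phi t \<omega>)) \<partial>M x)"
  proof (intro integral_cong_AE borel_measurable_cond_exp2)
    show "AE \<omega> in M x. real_cond_exp (M x) ?F (\<lambda>\<omega>. f (Phi (t + s) \<omega>)) \<omega> = (\<integral>y. f y \<partial>kernel M Phi s (Phi t \<omega>))"
      using markov st f by (simp add: markov_process_def)
  qed measurable
  also have "\<dots> = (\<integral>u. (\<integral>y. f y \<partial>kernel M Phi s u) \<partial>kernel M Phi t x)"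
    unfolding kernel_def[of M Phi t] by (intro integral_distr[symmetric]) auto
  finally show ?thesis .
qed

lemma feller_semigroup_kernel:
  assumes "cadlag_feller_markov M Phi"
  shows "feller_semigroup (kernel M Phi)"
proof (rule feller_semigroup.intro)
  have markov: "markov_process M Phi" and feller: "feller M Phi"
    using assms by (auto simp: cadlag_feller_markov_def)
  show "prob_space (kernel M Phi t x)" for t x
    by (rule prob_kernel[OF markov])
  show "sets (kernel M Phi t x) = sets borel" for t x
    by (rule sets_kernel_borel)
  show "A \<in> sets borel \<Longrightarrow> (\<lambda>x. emeasure (kernel M Phi t x) A) \<in> borel_measurable borel" for A t
    using markov by (auto simp: markov_process_def)
  show "(\<integral>y. f y \<partial>kernel M Phi (t + s) x) = (\<integral>u. (\<integral>y. f y \<partial>kernel M Phi s u) \<partial>kernel M Phi t x)"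
    if "0 \<le> s" "0 \<le> t" "bcont f" for s t f x
    using that bcont_measurable[of borel f] by (intro kernel_chapman_kolmogorov[OF markov]) (auto simp: bcont_def)
  show "continuous_on UNIV (\<lambda>x. \<integral>y. f y \<partial>kernel M Phi t x)" if "0 \<le> t" "bcont f" for t f
    using feller that by (auto simp: feller_def bcont_def)
qed

lemma H1_kernel:
  assumes markov: "markov_process M Phi" and H1: "H1 M Phi (Ffam p x0)" and f: "f \<in> Ffam p x0"
  shows "((\<lambda>K. SUP t\<in>{0..}. \<integral>\<^sup>+y. ennreal (\<bar>f y\<bar> * indicator {y. K \<le> \<bar>f y\<bar>} y) \<partial>kernel M Phi t x) \<longlongrightarrow> 0) at_top"
proof -
  have [measurable]: "f \<in> borel_measurable borel"
    using f by (auto simp: Ffam_def intro: borel_measurable_continuous_onI)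
  have [measurable]: "Phi t \<in> measurable (M x) borel" for t
    using markov by (auto simp: markov_process_def)
  have "(\<integral>\<^sup>+y. ennreal (\<bar>f y\<bar> * indicator {y. K \<le> \<bar>f y\<bar>} y) \<partial>kernel M Phi t x) =
      (\<integral>\<^sup>+\<omega>. ennreal (\<bar>f (Phi t \<omega>)\<bar> * indicator {\<omega>. \<bar>f (Phi t \<omega>)\<bar> \<ge> K} \<omega>) \<partial>M x)" for K t
    unfolding kernel_def by (subst nn_integral_distr) (auto intro!: nn_integral_cong simp: indicator_def)
  then show ?thesis
    using H1 f by (simp add: H1_def)
qed

text \<open>f and its truncation differ only where |f| \<ge> K, and there by at most |f|. The finite
  tail integral also makes f integrable, so the difference of integrals is the integral of the
  difference.\<close>

lemma truncation_error:
  fixes f :: "'a::topological_space \<Rightarrow> real"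
  assumes \<rho>: "prob_space \<rho>" "sets \<rho> = sets borel" and f: "f \<in> borel_measurable borel" and K: "0 \<le> K" and e: "0 \<le> e"
    and tail: "(\<integral>\<^sup>+y. ennreal (\<bar>f y\<bar> * indicator {y. K \<le> \<bar>f y\<bar>} y) \<partial>\<rho>) \<le> ennreal e"
  shows "\<bar>(\<integral>y. f y \<partial>\<rho>) - (\<integral>y. max (- K) (min K (f y)) \<partial>\<rho>)\<bar> \<le> e"
proof -
  interpret prob_space \<rho> by fact
  note [measurable_cong] = \<rho>(2) and [measurable] = f
  let ?h = "\<lambda>y. \<bar>f y\<bar> * indicator {y. K \<le> \<bar>f y\<bar>} y"
  let ?g = "\<lambda>y. max (- K) (min K (f y))"
  have h_int: "integrable \<rho> ?h"
    using tail by (intro integrableI_bounded) (auto intro: le_less_trans)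
  have g_int: "integrable \<rho> ?g"
    by (rule integrable_const_bound[of _ K]) (use K in auto)
  have diff: "\<bar>f y - ?g y\<bar> \<le> ?h y" for y
    using K by (auto simp: indicator_def)
  have "integrable \<rho> (\<lambda>y. f y - ?g y)"
    by (rule Bochner_Integration.integrable_bound[OF h_int]) (use diff in auto)
  from Bochner_Integration.integrable_add[OF this g_int] have f_int: "integrable \<rho> f"
    by simp
  have "\<bar>(\<integral>y. f y \<partial>\<rho>) - (\<integral>y. ?g y \<partial>\<rho>)\<bar> = \<bar>\<integral>y. f y - ?g y \<partial>\<rho>\<bar>"
    using f_int g_int by simp
  also have "\<dots> \<le> (\<integral>y. \<bar>f y - ?g y\<bar> \<partial>\<rho>)"
    by (rule integral_abs_bound)
  also have "\<dots> \<le> (\<integral>y. ?h y \<partial>\<rho>)"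
    using f_int g_int h_int diff by (intro integral_mono) auto
  also have "\<dots> \<le> e"
    using tail nn_integral_eq_integral[OF h_int] e by (simp add: ennreal_le_iff)
  finally show ?thesis .
qed

text \<open>At a common level K the tails at x and x' stay below e/4 for all t \<ge> 0, and the
  truncation has the same limit from both points. Hence the inner upper limit is 0 for every x', not
  merely for x' near x.\<close>

lemma eventually_continuous_of_weak:
  assumes cfm: "cadlag_feller_markov M Phi" and H1: "H1 M Phi (Ffam p x0)"
    and weak: "\<And>f x. bcont f \<Longrightarrow> ((\<lambda>t. \<integral>y. f y \<partial>kernel M Phi t x) \<longlongrightarrow> (\<integral>y. f y \<partial>\<mu>)) at_top"
  shows "eventually_continuous_at M Phi (Ffam p x0) x"
  unfolding eventually_continuous_at_def
proof
  fix f assume f: "f \<in> Ffam p x0"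
  have markov: "markov_process M Phi"
    using cfm by (simp add: cadlag_feller_markov_def)
  interpret feller_semigroup "kernel M Phi"
    by (rule feller_semigroup_kernel[OF cfm])
  have f_cont: "continuous_on UNIV f"
    using f by (simp add: Ffam_def)
  have f_meas: "f \<in> borel_measurable borel"
    by (rule borel_measurable_continuous_onI[OF f_cont])
  let ?I = "\<lambda>t x. \<integral>y. f y \<partial>kernel M Phi t x"
  let ?tail = "\<lambda>K x t. \<integral>\<^sup>+y. ennreal (\<bar>f y\<bar> * indicator {y. K \<le> \<bar>f y\<bar>} y) \<partial>kernel M Phi t x"
  have lim: "((\<lambda>t. \<bar>?I t x' - ?I t x\<bar>) \<longlongrightarrow> 0) at_top" for x'
  proof (rule tendstoI)
    fix e :: real assume e: "0 < e"
    have "eventually (\<lambda>K. (SUP t\<in>{0..}. ?tail K x' t) < ennreal (e / 4) \<and> (SUP t\<in>{0..}. ?tail K x t) < ennreal (e / 4) \<and> 0 \<le> K) at_top"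
      using e by (intro eventually_conj order_tendstoD(2)[OF H1_kernel[OF markov H1 f]] eventually_ge_at_top) auto
    then obtain K where K: "(SUP t\<in>{0..}. ?tail K x' t) < ennreal (e / 4)" "(SUP t\<in>{0..}. ?tail K x t) < ennreal (e / 4)" "0 \<le> K"
      unfolding eventually_at_top_linorder by blast
    let ?g = "\<lambda>y. max (- K) (min K (f y))"
    have g: "bcont ?g"
      using K(3) f_cont by (intro bcontI[of _ K] continuous_intros) auto
    have "((\<lambda>t. (\<integral>y. ?g y \<partial>kernel M Phi t x') - (\<integral>y. ?g y \<partial>kernel M Phi t x)) \<longlongrightarrow> (\<integral>y. ?g y \<partial>\<mu>) - (\<integral>y. ?g y \<partial>\<mu>)) at_top"
      by (intro tendsto_diff weak g)
    then have "eventually (\<lambda>t. dist ((\<integral>y. ?g y \<partial>kernel M Phi t x') - (\<integral>y. ?g y \<partial>kernel M Phi t x)) 0 < e / 2) at_top"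
      using e by (intro tendstoD) auto
    then show "eventually (\<lambda>t. dist \<bar>?I t x' - ?I t x\<bar> 0 < e) at_top"
      using eventually_ge_at_top[of 0]
    proof eventually_elim
      case (elim t)
      have tail: "?tail K x' t \<le> ennreal (e / 4)" "?tail K x t \<le> ennreal (e / 4)"
        using elim(2) by (auto intro!: order_trans[OF SUP_upper less_imp_le[OF K(1)]] order_trans[OF SUP_upper less_imp_le[OF K(2)]])
      have "\<bar>?I t x' - (\<integral>y. ?g y \<partial>kernel M Phi t x')\<bar> \<le> e / 4" "\<bar>?I t x - (\<integral>y. ?g y \<partial>kernel M Phi t x)\<bar> \<le> e / 4"
        by (rule truncation_error[OF prob_P sets_P f_meas K(3) _ tail(1)], use e in simp)
          (rule truncation_error[OF prob_P sets_P f_meas K(3) _ tail(2)], use e in simp)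
      then show ?case
        using elim(1) unfolding dist_real_def by linarith
    qed
  qed
  have "Limsup at_top (\<lambda>t. ereal \<bar>?I t x' - ?I t x\<bar>) = 0" for x'
    using tendsto_ereal[OF lim[of x']] by (intro lim_imp_Limsup) (auto simp: zero_ereal_def)
  then show "Limsup (at x) (\<lambda>x'. Limsup at_top (\<lambda>t. ereal \<bar>?I t x' - ?I t x\<bar>)) \<le> 0"
    by (simp add: Limsup_bounded)
qed

text \<open>Any point of the support of \<mu> serves as z. The lower bound is half the
  \<mu>-integral of a function that is positive exactly on the ball; being independent of x, it
  survives the infimum.\<close>

lemma C1_of_weak:
  assumes cfm: "cadlag_feller_markov M Phi" and \<mu>: "prob_space \<mu>" "sets \<mu> = sets borel"
    and weak: "\<And>f x. bcont f \<Longrightarrow> ((\<lambda>t. \<integral>y. f y \<partial>kernel M Phi t x) \<longlongrightarrow> (\<integral>y. f y \<partial>\<mu>)) at_top"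
  shows "\<exists>z. C1_at M Phi z"
proof -
  interpret feller_semigroup "kernel M Phi"
    by (rule feller_semigroup_kernel[OF cfm])
  interpret prob_space \<mu> by fact
  have "\<exists>z. \<forall>r>0. 0 < measure \<mu> (ball z r)"
    using eventually_happens'[OF ae_filter_bot AE_measure_ball_pos[OF \<mu>]] by blast
  then obtain z where z: "\<And>r. 0 < r \<Longrightarrow> 0 < measure \<mu> (ball z r)"
    by auto
  have "0 < (INF x. Liminf at_top (\<lambda>t. ereal (measure (kernel M Phi t x) (ball z r))))" if r: "0 < r" for r
  proof -
    obtain f :: "'a \<Rightarrow> real" where f: "bcont f" "\<And>x. 0 \<le> f x" "\<And>x. f x \<le> 1" "ball z r = {x. 0 < f x}"
      using open_eq_bcont_pos[of "ball z r"] by (metis open_ball)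
    define c where "c = (\<integral>y. f y \<partial>\<mu>)"
    have c: "0 < c"
      using integral_pos_of_measure_pos[OF \<mu> f(1,2)] z[OF r] by (simp add: c_def f(4))
    have "ereal (c / 2) \<le> Liminf at_top (\<lambda>t. ereal (measure (kernel M Phi t x) (ball z r)))" for x
    proof (rule Liminf_bounded)
      have "eventually (\<lambda>t. c / 2 < (\<integral>y. f y \<partial>kernel M Phi t x)) at_top"
        using c by (intro order_tendstoD(1)[OF weak[OF f(1)]]) (simp add: c_def)
      then show "eventually (\<lambda>t. ereal (c / 2) \<le> ereal (measure (kernel M Phi t x) (ball z r))) at_top"
      proof eventually_elim
        case (elim t)
        then show ?case
          using T_le_measure_pos[OF f(1-3), of t x] by (simp add: T_def f(4))
      qed
    qed
    then have "ereal (c / 2) \<le> (INF x. Liminf at_top (\<lambda>t. ereal (measure (kernel M Phi t x) (ball z r))))"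
      by (intro INF_greatest)
    moreover have "0 < ereal (c / 2)"
      using c by simp
    ultimately show ?thesis
      by (rule less_le_trans[rotated])
  qed
  then show ?thesis
    by (auto simp: C1_at_def)
qed

text \<open>\<alpha> is uniform in x, whereas the time from which the bound holds may depend on
  x.\<close>

lemma C1_lower_bound:
  assumes "C1_at M Phi z" "0 < r"
  shows "\<exists>\<alpha>>0. \<forall>x. eventually (\<lambda>t. \<alpha> \<le> measure (kernel M Phi t x) (ball z r)) at_top"
proof -
  have "0 < (INF x. Liminf at_top (\<lambda>t. ereal (measure (kernel M Phi t x) (ball z r))))"
    using assms by (simp add: C1_at_def)
  then obtain \<alpha> where \<alpha>: "0 < ereal \<alpha>" "ereal \<alpha> < (INF x. Liminf at_top (\<lambda>t. ereal (measure (kernel M Phi t x) (ball z r))))"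
    using ereal_dense2 by blast
  have "eventually (\<lambda>t. \<alpha> \<le> measure (kernel M Phi t x) (ball z r)) at_top" for x
  proof -
    have "ereal \<alpha> < Liminf at_top (\<lambda>t. ereal (measure (kernel M Phi t x) (ball z r)))"
      using \<alpha>(2) by (rule less_le_trans) (rule INF_lower, simp)
    then have "eventually (\<lambda>t. ereal \<alpha> < ereal (measure (kernel M Phi t x) (ball z r))) at_top"
      by (rule less_LiminfD)
    then show ?thesis
      by eventually_elim simp
  qed
  then show ?thesis
    using \<alpha>(1) by auto
qed

text \<open>Divided by a bound B, the function has absolute value at most 1 and so belongs to the
  family; scaling back turns \<epsilon>/B into \<epsilon>.\<close>

lemma eventually_continuous_bcont:
  fixes f :: "'a::polish_space \<Rightarrow> real"
  assumes ec: "eventually_continuous_at M Phi (Ffam p x0) z" and f: "bcont f" and \<epsilon>: "0 < \<epsilon>"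
  shows "\<exists>\<delta>>0. \<forall>x\<in>ball z \<delta>. eventually (\<lambda>t. \<bar>(\<integral>y. f y \<partial>kernel M Phi t x) - (\<integral>y. f y \<partial>kernel M Phi t z)\<bar> \<le> \<epsilon>) at_top"
proof -
  obtain B where B: "0 < B" "\<And>x. \<bar>f x\<bar> \<le> B"
    using bcontE[OF f] by metis
  let ?g = "\<lambda>x. (1 / B) * f x"
  have "\<bar>?g x\<bar> \<le> 1 + dist x0 x powr p" for x
  proof -
    have "\<bar>?g x\<bar> \<le> 1"
      using B by (simp add: abs_mult)
    then show ?thesis
      using powr_ge_zero[of "dist x0 x" p] by linarith
  qed
  then have "?g \<in> Ffam p x0"
    using bcont_cont[OF bcont_cmult[OF f, of "1 / B"]] by (simp add: Ffam_def)
  let ?D = "\<lambda>t x. \<bar>(\<integral>y. ?g y \<partial>kernel M Phi t x) - (\<integral>y. ?g y \<partial>kernel M Phi t z)\<bar>"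
  have "Limsup (at z) (\<lambda>x. Limsup at_top (\<lambda>t. ereal (?D t x))) \<le> 0"
    using ec \<open>?g \<in> Ffam p x0\<close> unfolding eventually_continuous_at_def by blast
  also have "(0::ereal) < ereal (\<epsilon> / B)"
    using \<epsilon> B by simp
  finally have "eventually (\<lambda>x. Limsup at_top (\<lambda>t. ereal (?D t x)) < ereal (\<epsilon> / B)) (at z)"
    by (rule Limsup_lessD)
  then obtain \<delta> where \<delta>: "0 < \<delta>" "\<And>x. x \<noteq> z \<Longrightarrow> dist x z < \<delta> \<Longrightarrow> Limsup at_top (\<lambda>t. ereal (?D t x)) < ereal (\<epsilon> / B)"
    by (auto simp: eventually_at)
  have "eventually (\<lambda>t. \<bar>(\<integral>y. f y \<partial>kernel M Phi t x) - (\<integral>y. f y \<partial>kernel M Phi t z)\<bar> \<le> \<epsilon>) at_top"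
    if x: "x \<in> ball z \<delta>" for x
  \<comment> \<open>The filter \<open>at z\<close> ignores z itself, where the difference is
    0.\<close>
  proof (cases "x = z")
    case True
    then show ?thesis using \<epsilon> by simp
  next
    case False
    then have "eventually (\<lambda>t. ereal (?D t x) < ereal (\<epsilon> / B)) at_top"
      using \<delta>(2)[of x] x by (intro Limsup_lessD) (simp add: dist_commute)
    then show ?thesis
    proof eventually_elim
      case (elim t)
      have "?D t x = (1 / B) * \<bar>(\<integral>y. f y \<partial>kernel M Phi t x) - (\<integral>y. f y \<partial>kernel M Phi t z)\<bar>"
        using B(1) by (simp add: diff_divide_distrib[symmetric])
      then show ?case
        using elim B(1) by (simp add: divide_less_cancel)
    qed
  qed
  then show ?thesis
    using \<delta>(1) by blast
qed

theorem ergodic_of_eventually_continuous: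
  assumes cfm: "cadlag_feller_markov M Phi" and p: "1 \<le> p" and H1: "H1 M Phi (Ffam p x0)"
    and ec: "eventually_continuous_at M Phi (Ffam p x0) z" and C1: "C1_at M Phi z"
  shows "\<exists>\<mu>. invariant_prob M Phi \<mu> \<and> (\<forall>\<nu>. invariant_prob M Phi \<nu> \<longrightarrow> \<nu> = \<mu>) \<and>
    (\<forall>x. ((\<lambda>t. wasserstein p (kernel M Phi t x) \<mu>) \<longlongrightarrow> 0) at_top)"
proof -
  have markov: "markov_process M Phi"
    using cfm by (simp add: cadlag_feller_markov_def)
  interpret feller_semigroup "kernel M Phi"
    by (rule feller_semigroup_kernel[OF cfm])
  have coincide: "((\<lambda>t. T t f x - T t f y) \<longlongrightarrow> 0) at_top" if "bcont f" for f x y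
    using that by (rule asymptotic_coincidence)
      (use eventually_continuous_bcont[OF ec that] C1_lower_bound[OF C1] in \<open>simp_all add: T_def\<close>)
  have "z \<in> recurrent_set z"
    using C1_lower_bound[OF C1] by (fastforce simp: recurrent_set_def)
  then obtain \<mu> where \<mu>: "prob_space \<mu>" "sets \<mu> = sets borel"
    and inv: "\<And>f s. bcont f \<Longrightarrow> 0 \<le> s \<Longrightarrow> (\<integral>x. T s f x \<partial>\<mu>) = (\<integral>x. f x \<partial>\<mu>)"
    by (rule invariant_measure_exists[OF _ coincide]) (assumption, rule that)
  have weak: "((\<lambda>t. T t f x) \<longlongrightarrow> (\<integral>y. f y \<partial>\<mu>)) at_top" if "bcont f" for f x
    using that by (intro tendsto_invariant \<mu> inv coincide)
  have "invariant_prob M Phi \<mu>"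
    using invariant_iff_integral[OF \<mu>] inv \<mu> by (simp add: invariant_prob_def)
  \<comment> \<open>Both integrals of a test function f are the limit of the same function t
    \<mapsto> \<open>T t f z\<close>.\<close>
  moreover have "\<nu> = \<mu>" if "invariant_prob M Phi \<nu>" for \<nu>
  proof -
    have \<nu>: "prob_space \<nu>" "sets \<nu> = sets borel"
      using that by (auto simp: invariant_prob_def)
    have inv_\<nu>: "(\<integral>x. T s f x \<partial>\<nu>) = (\<integral>x. f x \<partial>\<nu>)" if "bcont f" "0 \<le> s" for f s
      using invariant_iff_integral[OF \<nu> that(2)] \<open>invariant_prob M Phi \<nu>\<close> that
      by (simp add: invariant_prob_def)
    have "(\<integral>x. f x \<partial>\<nu>) = (\<integral>x. f x \<partial>\<mu>)" if f: "bcont f" for f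
    proof (rule tendsto_unique[OF _ _ weak[OF f, of z]])
      show "((\<lambda>t. T t f z) \<longlongrightarrow> (\<integral>y. f y \<partial>\<nu>)) at_top"
        using f by (intro tendsto_invariant \<nu> inv_\<nu> coincide)
    qed simp
    then show ?thesis
      by (intro measure_eqI_bcont \<nu> \<mu>)
  qed
  moreover have "((\<lambda>t. wasserstein p (kernel M Phi t x) \<mu>) \<longlongrightarrow> 0) at_top" for x
  proof (rule wasserstein_tendsto_0_of_weak[OF \<mu> prob_P sets_P p])
    show "((\<lambda>t. \<integral>x. f x \<partial>kernel M Phi t x) \<longlongrightarrow> (\<integral>x. f x \<partial>\<mu>)) at_top" if "bcont f" for f
      using weak[OF that, of x] by (simp add: T_def)
    \<comment> \<open>The cost function is itself a member of the family, so the uniform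
      integrability hypothesis is the tail condition for the transport.\<close>
    have "(\<lambda>y. dist x0 y powr p) \<in> Ffam p x0"
      using continuous_on_dist_powr[OF p] by (simp add: Ffam_def)
    from H1_kernel[OF markov H1 this, of x]
    show "((\<lambda>K. SUP t\<in>{0..}. \<integral>\<^sup>+y. ennreal (dist x0 y powr p * indicator {y. K \<le> dist x0 y powr p} y) \<partial>kernel M Phi t x) \<longlongrightarrow> 0) at_top"
      by simp
  qed
  ultimately show ?thesis
    by blast
qed

theorem mainTheorem6:
  fixes M :: "'a::polish_space \<Rightarrow> 'w measure" and Phi :: "real \<Rightarrow> 'w \<Rightarrow> 'a"
    and p :: real and x0 :: 'a
  assumes "cadlag_feller_markov M Phi"
    and "1 \<le> p"
    and "H1 M Phi (Ffam p x0)"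
  shows "((\<exists>\<mu>. invariant_prob M Phi \<mu> \<and> (\<forall>\<nu>. invariant_prob M Phi \<nu> \<longrightarrow> \<nu> = \<mu>) \<and>
              (\<forall>x. ((\<lambda>t. wasserstein p (kernel M Phi t x) \<mu>) \<longlongrightarrow> 0) at_top))
          \<longleftrightarrow> ((\<forall>x. eventually_continuous_at M Phi (Ffam p x0) x) \<and> (\<exists>z. C1_at M Phi z)))
       \<and> (((\<forall>x. eventually_continuous_at M Phi (Ffam p x0) x) \<and> (\<exists>z. C1_at M Phi z))
          \<longleftrightarrow> (\<exists>z. eventually_continuous_at M Phi (Ffam p x0) z \<and> C1_at M Phi z))"
proof -
  \<comment> \<open>This is (i) implies (ii); from (ii) to (iii) it suffices to restrict to the
    point z, and (iii) implies (i) is \<open>ergodic_of_eventually_continuous\<close>.\<close>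
  have "(\<forall>x. eventually_continuous_at M Phi (Ffam p x0) x) \<and> (\<exists>z. C1_at M Phi z)"
    if inv: "invariant_prob M Phi \<mu>" and W: "\<And>x. ((\<lambda>t. wasserstein p (kernel M Phi t x) \<mu>) \<longlongrightarrow> 0) at_top" for \<mu>
  proof -
    interpret feller_semigroup "kernel M Phi"
      by (rule feller_semigroup_kernel[OF assms(1)])
    have \<mu>: "prob_space \<mu>" "sets \<mu> = sets borel"
      using inv by (auto simp: invariant_prob_def)
    have weak: "((\<lambda>t. \<integral>y. f y \<partial>kernel M Phi t x) \<longlongrightarrow> (\<integral>y. f y \<partial>\<mu>)) at_top" if "bcont f" for f x
      using wasserstein_tendsto_0D[OF assms(2) W] that
      by (intro weak_convergence_of_couplings[OF \<mu> prob_P assms(2)])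
    show ?thesis
      using eventually_continuous_of_weak[OF assms(1,3) weak] C1_of_weak[OF assms(1) \<mu> weak] by blast
  qed
  then show ?thesis
    using ergodic_of_eventually_continuous[OF assms] by blast
qed

end
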